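(* Fix $m\ge1$ and $c:\mathcal Y\to[0,\infty)$. Suppose that at least one of the following two conditions holds: (UI) for every $i\in\mathcal M$, the family $\big(\upsilon_B^{(i)}/(-\log B_{ij(i)})\big)^m$, indexed by small $B_i=(B_{ij})_{j\in\mathcal M_0\setminus\{i\}}$ with positive entries, is $\mathbb P_i$-uniformly integrable; (RQ) for every $i\in\mathcal M$, $\mathrm{m\text{-}quick}\text{-}\liminf_{n\to\infty}\Psi_n^{(i)}/n\ge l(i)$ under $\mathbb P_i$. For strictly positive $\overline R=(\overline R_{yi})_{i\in\mathcal M,\,y\in\mathcal Y\setminus\mathcal Y_i}$ put $B_{ij}(\overline R):=\min_{y\in\mathcal Y_j}\overline R_{yi}/\nu_i$ for $i\in\mathcal M$, $j\in\mathcal M_0\setminus\{i\}$. Then the strategy $(\upsilon_{B(\overline R)},d_{B(\overline R)})$ is asymptotically optimal as $\|\overline R\|:=\max_{i\in\mathcal M,\,y\in\mathcal Y\setminus\mathcal Y_i}\overline R_{yi}\downarrow0$; that is, for every $i\in\mathcal M$, $$D_i^{(c,m)}(\upsilon_{B(\overline R)})\sim\inf_{(\tau,d)\in\Delta(\overline R)}D_i^{(c,m)}(\tau)\qquad\text{as }\|\overline R\|\downarrow0,$$ where $x\sim y$ means that the ratio $x/y$ tends to $1$, and where the limit is taken along $\overline R$ satisfying $\min_{y\in\mathcal Y\setminus\mathcal Y_i}\overline R_{yi}\big/\max_{y\in\mathcal Y\setminus\mathcal Y_i}\overline R_{yi}>\beta_i$, $i\in\mathcal M$, for some fixed strictly positive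 constants $(\beta_i)_{i\in\mathcal M}$.
   Context: Setting. On $(\Omega,\mathcal F,\mathbb P)$, $Y=(Y_n)_{n\ge0}$ is a time-homogeneous Markov chain with finite state space $\mathcal Y$, initial distribution $\eta$ and transition matrix $P$. $\mathcal Y_1,\dots,\mathcal Y_M$ are closed (not necessarily irreducible), mutually disjoint subsets of $\mathcal Y$, and $\mathcal Y_0:=\mathcal Y\setminus\bigcup_{k=1}^M\mathcal Y_k$ is transient. $\mathcal M:=\{1,\dots,M\}$, $\mathcal M_0:=\mathcal M\cup\{0\}$. $\theta:=\min\{t\ge0:Y_t\notin\mathcal Y_0\}$ (a.s. finite) and $\mu$ is the index $j\in\mathcal M$ with $Y_\theta\in\mathcal Y_j$. The observed process $X=(X_n)_{n\ge1}$ takes values in a measurable space $(E,\mathcal E)$ and $\mathbb P\{Y_0=y_0,\dots,Y_t=y_t,X_1\in E_1,\dots,X_t\in E_t\}=\eta(y_0)\prod_{n=1}^tP(y_{n-1},y_n)\int_{E_n}f(y_n,x)\,m(dx)$, where $f(y,\cdot)$, $y\in\mathcal Y$, are densities with respect to a $\sigma$-finite measure on $(E,\mathcal E)$ (also denoted $m$). $\mathcal F_0$ is trivial, $\mathcal F_n=\sigma(X_1,\dots,X_n)$, $\mathbb F=(\mathcal F_n)_{n\ge 0}$. $\nu_i:=\mathbb P\{\mu=i\}>0$ for all $i\in\mathcal M$; $\mathbb P_i:=\mathbb P(\cdot\mid\mu=i)$ with expectation $\mathbb E_i$. Strategies. $\Delta$ is the set of pairs $(\tau,d)$ with $\tau$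 an $\mathbb F$-stopping time and $d$ an $\mathcal M$-valued $\mathcal F_\tau$-measurable random variable. $R_{yi}(\tau,d):=\mathbb P\{d=i,Y_\tau=y,\tau<\infty\}$ and $\Delta(\overline R):=\{(\tau,d)\in\Delta:R_{yi}(\tau,d)\le\overline R_{yi},\ i\in\mathcal M,\ y\in\mathcal Y\setminus\mathcal Y_i\}$. $D_i^{(c,m)}(\tau):=\mathbb E_i\big[\big(\sum_{t=0}^\infty c(Y_t)1_{\{t<\tau\}}\big)^m\big]$. Processes. $\widetilde\Pi_n^{(i)}:=\mathbb P\{Y_n\in\mathcal Y_i\mid\mathcal F_n\}$, $i\in\mathcal M_0$. $\Lambda_n(i,j):=\log(\widetilde\Pi_n^{(i)}/\widetilde\Pi_n^{(j)})$ for $n\ge1$, $i\in\mathcal M$, $j\in\mathcal M_0\setminus\{i\}$, and $\Psi_n^{(i)}:=\min_{j\in\mathcal M_0\setminus\{i\}}\Lambda_n(i,j)$. Standing assumptions. (1) For all $y,z\in\mathcal Y$, $0<f(y,X_1)/f(z,X_1)<\infty$ a.s., and $0<\widetilde\Pi_n^{(i)}<1$ a.s. for every finite $n\ge1$ and $i\in\mathcal M$. (2) For every $i\in\mathcal M$ and $j\in\mathcal M_0\setminus\{i\}$, $\Lambda_n(i,j)/n\to l(i,j)$ $\mathbb P_i$-a.s. for some constant $l(i,j)\in(0,\infty]$, and $l(i):=\min_{j\in\mathcal M_0\setminus\{i\}}l(i,j)<\infty$; $j(i)$ is any index in $\mathcal M_0\setminus\{i\}$ attaining this minimum. (3) For every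 $i\in\mathcal M$ there are unique nonnegative $w_i(y)$, $y\in\mathcal Y_i$, with $\frac1{n+1}\sum_{k=0}^n1_{\{y\}}(Y_k)\to w_i(y)$ $\mathbb P_i$-a.s. on $\{Y_0\in\mathcal Y_i\}$. The strategy. For $B=(B_{ij})_{i\in\mathcal M,\,j\in\mathcal M_0\setminus\{i\}}$ with $B_{ij}>0$: $\upsilon_B^{(i)}:=\inf\{n\ge1:\Lambda_n(i,j)>-\log B_{ij}\text{ for every }j\in\mathcal M_0\setminus\{i\}\}$, $\upsilon_B:=\min_{i\in\mathcal M}\upsilon_B^{(i)}$, $d_B\in\arg\min_{i\in\mathcal M}\upsilon_B^{(i)}$. When limits in $B$ are taken, $0<B_{ij}<1$ and the ratios $\min_jB_{ij}/\max_jB_{ij}$ are assumed bounded below by strictly positive numbers; this also applies to the index set of the family in (UI). $r$-quick convergence. For a process $(\xi_n)$, a constant $k$ and $r>0$, $\mathrm{r\text{-}quick}\text{-}\liminf_{n\to\infty}\xi_n\ge k$ means that $\mathbb E[(T_\delta)^r]<\infty$ for every $\delta>0$, where $T_\delta:=\inf\{n\ge1:\inf_{q\ge n}\xi_q>k-\delta\}$. *)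

theory Defs
  imports "HOL-Probability.Probability"
begin

section \<open>Extended real auxiliaries\<close>

text \<open>Real powers, also at infinity; used with exponents \<open>r > 0\<close> only.\<close>

definition epowr :: "ennreal \<Rightarrow> real \<Rightarrow> ennreal" where
  "epowr x r = (if x = \<infinity> then \<infinity> else ennreal (enn2real x powr r))"

definition elog :: "ereal \<Rightarrow> ereal" where
  "elog x = (if x \<le> 0 then -\<infinity> else if x = \<infinity> then \<infinity> else ereal (ln (real_of_ereal x)))"

text \<open>
  The relation \<open>x \<sim> y\<close> for \<open>[0, \<infinity>]\<close>-valued functions: the ratio tends to 1. As for
  \<^const>\<open>asymp_equiv\<close>, the ratio \<open>0 / 0\<close> counts as 1 (it occurs below if no cost is ever
  incurred, for instance for \<open>c = 0\<close>). The ratio \<open>\<infinity> / \<infinity>\<close> is 0 in \<^typ>\<open>ennreal\<close>, so infinite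
  values are never equivalent.
\<close>

definition ennreal_asymp_equiv :: "'a filter \<Rightarrow> ('a \<Rightarrow> ennreal) \<Rightarrow> ('a \<Rightarrow> ennreal) \<Rightarrow> bool" where
  "ennreal_asymp_equiv \<F> f g \<longleftrightarrow>
     ((\<lambda>x. if f x = 0 \<and> g x = 0 then 1 else f x / g x) \<longlongrightarrow> 1) \<F>"

definition uniformly_integrable ::
    "'a measure \<Rightarrow> 'b set \<Rightarrow> ('b \<Rightarrow> 'a \<Rightarrow> ennreal) \<Rightarrow> bool" where
  "uniformly_integrable N A Z \<longleftrightarrow>
     (\<forall>b\<in>A. Z b \<in> borel_measurable N) \<and>
     ((\<lambda>K::real. SUP b\<in>A. \<integral>\<^sup>+\<omega>. Z b \<omega> * indicator {\<omega>. ennreal K < Z b \<omega>} \<omega> \<partial>N)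
        \<longlongrightarrow> 0) at_top"

definition quick_time :: "(nat \<Rightarrow> 'a \<Rightarrow> ereal) \<Rightarrow> ereal \<Rightarrow> real \<Rightarrow> 'a \<Rightarrow> enat" where
  "quick_time \<xi> k \<delta> \<omega> = Inf {enat n | n. 1 \<le> n \<and> (INF q\<in>{n..}. \<xi> q \<omega>) > k - ereal \<delta>}"

definition quick_liminf_ge ::
    "'a measure \<Rightarrow> real \<Rightarrow> (nat \<Rightarrow> 'a \<Rightarrow> ereal) \<Rightarrow> ereal \<Rightarrow> bool" where
  "quick_liminf_ge N r \<xi> k \<longleftrightarrow>
     (\<forall>\<delta>>0. (\<integral>\<^sup>+\<omega>. epowr (ennreal_of_enat (quick_time \<xi> k \<delta> \<omega>)) r \<partial>N) < \<infinity>)"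

section \<open>Transient states of a finite Markov chain\<close>

text \<open>\<open>first_passage P z n y\<close>: the chain started in \<open>y\<close> hits \<open>z\<close> for the first time after
  time 0 at time \<open>n + 1\<close>.\<close>

primrec first_passage :: "('y::finite \<Rightarrow> 'y \<Rightarrow> real) \<Rightarrow> 'y \<Rightarrow> nat \<Rightarrow> 'y \<Rightarrow> real" where
  "first_passage P z 0 y = P y z"
| "first_passage P z (Suc n) y = (\<Sum>u\<in>UNIV - {z}. P y u * first_passage P z n u)"

definition transient :: "('y::finite \<Rightarrow> 'y \<Rightarrow> real) \<Rightarrow> 'y \<Rightarrow> bool" where
  "transient P y \<longleftrightarrow> (\<Sum>n. first_passage P y n y) < 1"

section \<open>The hidden Markov model\<close>

text \<open>
  The state space is the whole type \<open>'y\<close>. \<open>Prob\<close> carries \<open>(\<Omega>, \<F>, \<P>)\<close>; \<open>Obs\<close> is the measurable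
  space \<open>(E, \<E>)\<close> together with the reference measure of the densities; \<open>M\<close> is \<open>num\<close>;
  \<open>cls k\<close> is \<open>\<Y>\<^sub>k\<close> for \<open>0 \<le> k \<le> M\<close>. The observations are \<open>obs 1, obs 2, \<dots>\<close>; \<open>obs 0\<close> is
  never used.
\<close>

record ('w, 'y, 'e) hmm =
  Prob :: "'w measure"
  Obs :: "'e measure"
  num :: nat
  cls :: "nat \<Rightarrow> 'y set"
  eta :: "'y \<Rightarrow> real"
  tmat :: "'y \<Rightarrow> 'y \<Rightarrow> real"
  dens :: "'y \<Rightarrow> 'e \<Rightarrow> real"
  state :: "nat \<Rightarrow> 'w \<Rightarrow> 'y"
  obs :: "nat \<Rightarrow> 'w \<Rightarrow> 'e"

definition hyps :: "('w, 'y, 'e) hmm \<Rightarrow> nat set" where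
  "hyps H = {1..num H}"

definition others :: "('w, 'y, 'e) hmm \<Rightarrow> nat \<Rightarrow> nat set" where
  "others H i = {0..num H} - {i}"

definition theta :: "('w, 'y, 'e) hmm \<Rightarrow> 'w \<Rightarrow> enat" where
  "theta H \<omega> = Inf {enat t | t. state H t \<omega> \<notin> cls H 0}"

text \<open>On the null set where \<open>\<theta> = \<infinity>\<close> we put \<open>\<mu> = 0\<close>, which is not in \<open>\<M>\<close>.\<close>

definition mu :: "('w, 'y, 'e) hmm \<Rightarrow> 'w \<Rightarrow> nat" where
  "mu H \<omega> = (if theta H \<omega> = \<infinity> then 0
              else THE j. j \<in> hyps H \<and> state H (the_enat (theta H \<omega>)) \<omega> \<in> cls H j)"

definition nu :: "('w, 'y, 'e) hmm \<Rightarrow> nat \<Rightarrow> real" where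
  "nu H i = measure (Prob H) {\<omega> \<in> space (Prob H). mu H \<omega> = i}"

definition cond_law :: "('w, 'y, 'e) hmm \<Rightarrow> nat \<Rightarrow> 'w measure" where
  "cond_law H i = uniform_measure (Prob H) {\<omega> \<in> space (Prob H). mu H \<omega> = i}"

text \<open>The filtration is indexed by \<^typ>\<open>enat\<close> because stopping times may be infinite:
  \<open>obs_filtration H \<infinity>\<close> is generated by all observations and \<open>obs_filtration H 0\<close> is trivial.\<close>

definition obs_filtration :: "('w, 'y, 'e) hmm \<Rightarrow> enat \<Rightarrow> 'w measure" where
  "obs_filtration H t = sigma (space (Prob H))
     {obs H n -` A \<inter> space (Prob H) | n A. 1 \<le> n \<and> enat n \<le> t \<and> A \<in> sets (Obs H)}"

locale hidden_markov =
  fixes H :: "('w, 'y::finite, 'e) hmm"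
  assumes prob_space_Prob: "prob_space (Prob H)"
    and sigma_finite_Obs: "sigma_finite_measure (Obs H)"
    and state_measurable: "\<And>n. state H n \<in> measurable (Prob H) (count_space UNIV)"
    and obs_measurable: "\<And>n. 1 \<le> n \<Longrightarrow> obs H n \<in> measurable (Prob H) (Obs H)"
    and eta_distribution: "\<And>y. 0 \<le> eta H y" "(\<Sum>y\<in>UNIV. eta H y) = 1"
    and tmat_stochastic: "\<And>y z. 0 \<le> tmat H y z" "\<And>y. (\<Sum>z\<in>UNIV. tmat H y z) = 1"
    and dens_measurable: "\<And>y. dens H y \<in> borel_measurable (Obs H)"
    and dens_nonneg: "\<And>y x. 0 \<le> dens H y x"
    and dens_total: "\<And>y. (\<integral>\<^sup>+x. ennreal (dens H y x) \<partial>Obs H) = 1"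
    and joint_law: "\<And>t y A. (\<And>n. n \<in> {1..t} \<Longrightarrow> A n \<in> sets (Obs H)) \<Longrightarrow>
      measure (Prob H) {\<omega> \<in> space (Prob H).
          (\<forall>n\<le>t. state H n \<omega> = y n) \<and> (\<forall>n\<in>{1..t}. obs H n \<omega> \<in> A n)}
        = eta H (y 0) *
          (\<Prod>n=1..t. tmat H (y (n - 1)) (y n) * (LINT x:A n|Obs H. dens H (y n) x))"
    and cls_disjoint: "disjoint_family_on (cls H) (hyps H)"
    and cls_closed: "\<And>k y z. \<lbrakk>k \<in> hyps H; y \<in> cls H k; z \<notin> cls H k\<rbrakk> \<Longrightarrow> tmat H y z = 0"
    and cls_0: "cls H 0 = UNIV - (\<Union>k\<in>hyps H. cls H k)"
    and cls_0_transient: "\<And>y. y \<in> cls H 0 \<Longrightarrow> transient (tmat H) y"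
    and nu_pos: "\<And>i. i \<in> hyps H \<Longrightarrow> 0 < nu H i"

section \<open>Posterior and log-likelihood-ratio processes\<close>

definition post :: "('w, 'y, 'e) hmm \<Rightarrow> nat \<Rightarrow> nat \<Rightarrow> 'w \<Rightarrow> real" where
  "post H i n = real_cond_exp (Prob H) (obs_filtration H (enat n))
     (indicator {\<omega> \<in> space (Prob H). state H n \<omega> \<in> cls H i})"

text \<open>Extended values are needed: \<open>post H 0 n\<close> may vanish, and then the ratio is \<open>\<infinity>\<close>.\<close>

definition Lam :: "('w, 'y, 'e) hmm \<Rightarrow> nat \<Rightarrow> nat \<Rightarrow> nat \<Rightarrow> 'w \<Rightarrow> ereal" where
  "Lam H i j n \<omega> = elog (ereal (post H i n \<omega>) / ereal (post H j n \<omega>))"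

definition Psi :: "('w, 'y, 'e) hmm \<Rightarrow> nat \<Rightarrow> nat \<Rightarrow> 'w \<Rightarrow> ereal" where
  "Psi H i n \<omega> = Min ((\<lambda>j. Lam H i j n \<omega>) ` others H i)"

definition lmin :: "('w, 'y, 'e) hmm \<Rightarrow> (nat \<Rightarrow> nat \<Rightarrow> ereal) \<Rightarrow> nat \<Rightarrow> ereal" where
  "lmin H l i = Min (l i ` others H i)"

section \<open>Standing assumptions\<close>

definition nondegenerate_likelihoods :: "('w, 'y, 'e) hmm \<Rightarrow> bool" where
  "nondegenerate_likelihoods H \<longleftrightarrow>
     (\<forall>y z. AE \<omega> in Prob H.
        0 < ereal (dens H y (obs H 1 \<omega>)) / ereal (dens H z (obs H 1 \<omega>)) \<and>
        ereal (dens H y (obs H 1 \<omega>)) / ereal (dens H z (obs H 1 \<omega>)) < \<infinity>) \<and>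
     (\<forall>n\<ge>1. \<forall>i\<in>hyps H. AE \<omega> in Prob H. 0 < post H i n \<omega> \<and> post H i n \<omega> < 1)"

definition llr_rates :: "('w, 'y, 'e) hmm \<Rightarrow> (nat \<Rightarrow> nat \<Rightarrow> ereal) \<Rightarrow> bool" where
  "llr_rates H l \<longleftrightarrow>
     (\<forall>i\<in>hyps H. \<forall>j\<in>others H i. 0 < l i j \<and>
        (AE \<omega> in cond_law H i. (\<lambda>n. Lam H i j n \<omega> / ereal (real n)) \<longlonglongrightarrow> l i j)) \<and>
     (\<forall>i\<in>hyps H. lmin H l i < \<infinity>)"

text \<open>Uniqueness of the limits \<open>w y\<close> needs no separate requirement: limits of real sequences
  are unique, so \<open>w y\<close> is determined as soon as \<open>state H 0 \<in> cls H i\<close> has positive probability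
  under \<open>cond_law H i\<close>. If it does not, no value is singled out and the condition holds
  trivially.\<close>

definition occupation_limits :: "('w, 'y, 'e) hmm \<Rightarrow> bool" where
  "occupation_limits H \<longleftrightarrow>
     (\<forall>i\<in>hyps H. \<exists>w. \<forall>y\<in>cls H i. 0 \<le> w y \<and>
        (AE \<omega> in cond_law H i. state H 0 \<omega> \<in> cls H i \<longrightarrow>
           (\<lambda>n. (1 / real (n + 1)) * (\<Sum>k=0..n. indicator {y} (state H k \<omega>))) \<longlonglongrightarrow> (w y :: real)))"

section \<open>Strategies and costs\<close>

definition strategies :: "('w, 'y, 'e) hmm \<Rightarrow> (('w \<Rightarrow> enat) \<times> ('w \<Rightarrow> nat)) set" where
  "strategies H = {(\<tau>, d). stopping_time (obs_filtration H) \<tau> \<and>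
     d \<in> measurable (filtration.pre_sigma (space (Prob H)) (obs_filtration H) \<tau>)
                    (count_space (hyps H))}"

definition risk ::
    "('w, 'y, 'e) hmm \<Rightarrow> 'y \<Rightarrow> nat \<Rightarrow> ('w \<Rightarrow> enat) \<times> ('w \<Rightarrow> nat) \<Rightarrow> real" where
  "risk H y i = (\<lambda>(\<tau>, d). measure (Prob H)
     {\<omega> \<in> space (Prob H). d \<omega> = i \<and> \<tau> \<omega> < \<infinity> \<and> state H (the_enat (\<tau> \<omega>)) \<omega> = y})"

text \<open>A bound \<open>R y i\<close> is meaningful for \<open>i \<in> hyps H\<close> and \<open>y \<notin> cls H i\<close>; other values of \<open>R\<close> are
  never used.\<close>

definition admissible ::
    "('w, 'y, 'e) hmm \<Rightarrow> ('y \<Rightarrow> nat \<Rightarrow> real) \<Rightarrow> (('w \<Rightarrow> enat) \<times> ('w \<Rightarrow> nat)) set" where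
  "admissible H R = {s \<in> strategies H. \<forall>i\<in>hyps H. \<forall>y\<in>UNIV - cls H i. risk H y i s \<le> R y i}"

definition delay ::
    "('w, 'y, 'e) hmm \<Rightarrow> ('y \<Rightarrow> real) \<Rightarrow> real \<Rightarrow> nat \<Rightarrow> ('w \<Rightarrow> enat) \<Rightarrow> ennreal" where
  "delay H c m i \<tau> =
     (\<integral>\<^sup>+\<omega>. epowr (\<Sum>t. ennreal (c (state H t \<omega>)) * (if enat t < \<tau> \<omega> then 1 else 0)) m
        \<partial>cond_law H i)"

definition upsilon1 :: "('w, 'y, 'e) hmm \<Rightarrow> nat \<Rightarrow> (nat \<Rightarrow> real) \<Rightarrow> 'w \<Rightarrow> enat" where
  "upsilon1 H i b \<omega> =
     Inf {enat n | n. 1 \<le> n \<and> (\<forall>j\<in>others H i. Lam H i j n \<omega> > ereal (- ln (b j)))}"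

definition upsilon :: "('w, 'y, 'e) hmm \<Rightarrow> (nat \<Rightarrow> nat \<Rightarrow> real) \<Rightarrow> 'w \<Rightarrow> enat" where
  "upsilon H B \<omega> = Min ((\<lambda>i. upsilon1 H i (B i) \<omega>) ` hyps H)"

section \<open>The two sufficient conditions\<close>

definition small_thresholds ::
    "('w, 'y, 'e) hmm \<Rightarrow> nat \<Rightarrow> real \<Rightarrow> real \<Rightarrow> (nat \<Rightarrow> real) set" where
  "small_thresholds H i \<beta> \<epsilon> = {b. (\<forall>j\<in>others H i. 0 < b j \<and> b j < \<epsilon>) \<and>
     Min (b ` others H i) / Max (b ` others H i) > \<beta>}"

definition cond_UI ::
    "('w, 'y, 'e) hmm \<Rightarrow> (nat \<Rightarrow> nat) \<Rightarrow> (nat \<Rightarrow> real) \<Rightarrow> real \<Rightarrow> bool" where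
  "cond_UI H js \<beta> m \<longleftrightarrow>
     (\<forall>i\<in>hyps H. \<exists>\<epsilon>. 0 < \<epsilon> \<and> \<epsilon> \<le> 1 \<and>
        uniformly_integrable (cond_law H i) (small_thresholds H i (\<beta> i) \<epsilon>)
          (\<lambda>b \<omega>. epowr (ennreal_of_enat (upsilon1 H i b \<omega>) / ennreal (- ln (b (js i)))) m))"

definition cond_RQ ::
    "('w, 'y, 'e) hmm \<Rightarrow> (nat \<Rightarrow> nat \<Rightarrow> ereal) \<Rightarrow> real \<Rightarrow> bool" where
  "cond_RQ H l m \<longleftrightarrow>
     (\<forall>i\<in>hyps H. quick_liminf_ge (cond_law H i) m
        (\<lambda>n \<omega>. Psi H i n \<omega> / ereal (real n)) (lmin H l i))"

section \<open>Asymptotic optimality\<close>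

text \<open>If \<open>cls H 0\<close> is empty, then \<open>thresholds H R i 0\<close> is an unspecified real number; it has no
  influence, since then \<open>Lam H i 0 n = \<infinity>\<close> almost surely for \<open>n \<ge> 1\<close>. The sets \<open>cls H j\<close> with
  \<open>j \<in> hyps H\<close> are nonempty because \<open>nu H j > 0\<close>.\<close>

definition thresholds ::
    "('w, 'y, 'e) hmm \<Rightarrow> ('y \<Rightarrow> nat \<Rightarrow> real) \<Rightarrow> nat \<Rightarrow> nat \<Rightarrow> real" where
  "thresholds H R i j = Min ((\<lambda>y. R y i) ` cls H j) / nu H i"

definition bound_norm :: "('w, 'y, 'e) hmm \<Rightarrow> ('y \<Rightarrow> nat \<Rightarrow> real) \<Rightarrow> real" where
  "bound_norm H R = Max {R y i | y i. i \<in> hyps H \<and> y \<in> UNIV - cls H i}"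

definition bounds_to_0 ::
    "('w, 'y, 'e) hmm \<Rightarrow> (nat \<Rightarrow> real) \<Rightarrow> ('y \<Rightarrow> nat \<Rightarrow> real) filter" where
  "bounds_to_0 H \<beta> = inf (filtercomap (bound_norm H) (at_right 0))
     (principal {R. \<forall>i\<in>hyps H. (\<forall>y\<in>UNIV - cls H i. 0 < R y i) \<and>
        Min ((\<lambda>y. R y i) ` (UNIV - cls H i)) / Max ((\<lambda>y. R y i) ` (UNIV - cls H i)) > \<beta> i})"

definition asymptotically_optimal ::
    "('w, 'y, 'e) hmm \<Rightarrow> ('y \<Rightarrow> real) \<Rightarrow> real \<Rightarrow> (nat \<Rightarrow> real) \<Rightarrow>
     (('y \<Rightarrow> nat \<Rightarrow> real) \<Rightarrow> ('w \<Rightarrow> enat) \<times> ('w \<Rightarrow> nat)) \<Rightarrow> bool" where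
  "asymptotically_optimal H c m \<beta> S \<longleftrightarrow>
     (\<forall>i\<in>hyps H. ennreal_asymp_equiv (bounds_to_0 H \<beta>)
        (\<lambda>R. delay H c m i (fst (S R)))
        (\<lambda>R. INF (\<tau>, d)\<in>admissible H R. delay H c m i \<tau>))"

end

theory Submission
  imports Defs "HOL-Real_Asymp.Real_Asymp"
begin

text \<open>
  Fix a hypothesis \<open>i\<close> and let \<open>b = - ln B\<^sub>i\<^sub>j\<close> with \<open>j = j(i)\<close>, so that \<open>b \<longlonglongrightarrow> \<infinity>\<close> as the bounds tend to 0.
  Changing measure from \<open>Y\<^sub>n \<in> cls i\<close> to \<open>Y\<^sub>n \<in> cls j\<close> costs the factor \<open>exp (\<Lambda>\<^sub>n(i,j))\<close>, so an
  admissible strategy can stop before \<open>(1 - \<epsilon>) b / l(i)\<close> only if it has large risk or if \<open>\<Lambda>\<close> runs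
  ahead of its linear growth; both have small probability, uniformly in the strategy. On the other
  hand \<open>\<upsilon>\<^sub>B\<close> is at most \<open>(1 + \<epsilon>) b / l(i)\<close> outside an event whose contribution to the \<open>m\<close>-th moment is
  \<open>o(b^m)\<close>, by (UI) or (RQ). So both delays lie between the \<open>m\<close>-th moments of the costs accumulated up
  to two deterministic times that differ by \<open>O(\<epsilon> b)\<close>.

  These two moments are asymptotically equal by a dichotomy for finite chains: either the mean cost up
  to time \<open>n\<close> grows linearly, and the difference \<open>O(\<epsilon> b^m)\<close> is negligible, or the set of states from
  which a cost is still possible is left at a geometric rate, and the total cost has finite moments.
\<close>

subsection \<open>Finite stochastic matrices\<close>

text \<open>Nothing is known about \<open>c\<close> beyond \<open>c \<ge> 0\<close>: costs may occur
  only on transient states, or never. So the delay need not grow like \<open>b^m\<close>, and errors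
  are kept additive: \<open>o(b^m)\<close> if the \<open>m\<close>-th moment is of order
  \<open>b^m\<close>, and \<open>o(1)\<close> if the total cost has finite moments. The two bounding
  moments are compared with each other but never evaluated.

  The lower bound rests on one trade-off. The change of measure costs \<open>exp a\<close> and the
  risk is of order \<open>exp (-b)\<close>, so \<open>a = (1 - \<epsilon>/2) b\<close> leaves
  \<open>exp (-\<epsilon> b/2)\<close>; and up to time \<open>(1 - \<epsilon>) b / l(i)\<close> a
  path below the line of slope \<open>(1 + \<epsilon>/2) l(i)\<close> is still below
  \<open>a\<close>. The ratio bound \<open>\<beta>\<close> makes all bounds belonging to
  \<open>i\<close> comparable with \<open>exp (-b)\<close>, so that passing from one threshold to
  another shifts \<open>b\<close> by at most a constant.\<close>

locale stochastic_matrix =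
  fixes P :: "'y::finite \<Rightarrow> 'y \<Rightarrow> real"
  assumes entry_nonneg: "0 \<le> P x z"
    and row_sum: "(\<Sum>z\<in>UNIV. P x z) = 1"
begin

lemma first_passage_nonneg: "0 \<le> first_passage P z n x"
  by (induction n arbitrary: x) (auto intro!: sum_nonneg mult_nonneg_nonneg entry_nonneg)

lemma row_split: "P x z + (\<Sum>v\<in>UNIV - {z}. P x v) = 1"
  using row_sum[of x] by (subst (asm) sum.remove[of _ z]) auto

lemma first_passage_sum_Suc:
  "(\<Sum>k<Suc n. first_passage P z k x)
    = P x z + (\<Sum>v\<in>UNIV - {z}. P x v * (\<Sum>k<n. first_passage P z k v))"
proof -
  have "(\<Sum>k<Suc n. first_passage P z k x) = P x z + (\<Sum>k<n. first_passage P z (Suc k) x)"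
    by (simp only: sum.lessThan_Suc_shift) simp
  also have "(\<Sum>k<n. first_passage P z (Suc k) x)
      = (\<Sum>v\<in>UNIV - {z}. P x v * (\<Sum>k<n. first_passage P z k v))"
    by (simp add: sum_distrib_left sum.swap[of _ _ "{..<n}"])
  finally show ?thesis .
qed

lemma first_passage_sum_le_1: "(\<Sum>k<n. first_passage P z k x) \<le> 1"
proof (induction n arbitrary: x)
  case (Suc n)
  have "(\<Sum>v\<in>UNIV - {z}. P x v * (\<Sum>k<n. first_passage P z k v)) \<le> (\<Sum>v\<in>UNIV - {z}. P x v * 1)"
    by (intro sum_mono mult_left_mono Suc entry_nonneg)
  then show ?case using row_split[of x z] by (simp only: first_passage_sum_Suc) simp
qed simp

lemma summable_first_passage: "summable (\<lambda>n. first_passage P z n x)"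
  by (rule summableI_nonneg_bounded[of _ 1]) (auto intro: first_passage_nonneg first_passage_sum_le_1)

lemma hitting_prob_first_step:
  "(\<Sum>n. first_passage P z n x) = P x z + (\<Sum>v\<in>UNIV - {z}. P x v * (\<Sum>n. first_passage P z n v))"
proof (rule LIMSEQ_unique)
  show "(\<lambda>n. \<Sum>k<Suc n. first_passage P z k x) \<longlonglongrightarrow> (\<Sum>n. first_passage P z n x)"
    by (intro LIMSEQ_Suc summable_LIMSEQ summable_first_passage)
  show "(\<lambda>n. \<Sum>k<Suc n. first_passage P z k x)
    \<longlonglongrightarrow> P x z + (\<Sum>v\<in>UNIV - {z}. P x v * (\<Sum>n. first_passage P z n v))"
    unfolding first_passage_sum_Suc
    by (intro tendsto_intros summable_LIMSEQ summable_first_passage)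
qed

definition closed_set :: "'y set \<Rightarrow> bool" where
  "closed_set D \<longleftrightarrow> (\<forall>x\<in>D. \<forall>z. z \<notin> D \<longrightarrow> P x z = 0)"

text \<open>In a minimal closed set, the probability of never returning to a transient \<open>z\<close> would be
  maximal on a closed subset from which \<open>z\<close> cannot be entered, so that \<open>z\<close> could be removed.\<close>

lemma closed_set_contains_nontransient:
  assumes "closed_set C" "C \<noteq> {}"
  obtains x where "x \<in> C" "\<not> transient P x"
proof -
  let ?S = "{D. D \<noteq> {} \<and> D \<subseteq> C \<and> closed_set D}"
  have "C \<in> ?S" using assms by auto
  then have "\<exists>m\<in>?S. \<forall>b\<in>?S. b \<subseteq> m \<longrightarrow> m = b"
    by (intro finite_has_minimal) auto
  then obtain D where D: "D \<noteq> {}" "D \<subseteq> C" "closed_set D"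
    and min0: "\<forall>b\<in>?S. b \<subseteq> D \<longrightarrow> D = b"
    by blast
  have min: "D = b" if "b \<noteq> {}" "closed_set b" "b \<subseteq> D" for b
    using min0 that D(2) by blast
  obtain z where z: "z \<in> D" using D by auto
  have "\<not> transient P z"
  proof
    assume tr: "transient P z"
    \<comment> \<open>\<open>G u\<close> is the probability of never visiting \<open>z\<close> after
      time 0. The first-step equation makes it an average of its values off \<open>z\<close>, with
      the mass of \<open>z\<close> contributing 0.\<close>
    define G where "G u = 1 - (\<Sum>n. first_passage P z n u)" for u
    have G_step: "G u = (\<Sum>v\<in>UNIV - {z}. P u v * G v)" for u
      unfolding G_def hitting_prob_first_step[of z u] using row_split[of u z]
      by (simp add: right_diff_distrib sum_subtractf)
    define m where "m = Max (G ` D)"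
    have Gm: "G u \<le> m" if "u \<in> D" for u
      using that by (auto simp: m_def)
    have "0 < G z" using tr by (simp add: G_def transient_def)
    then have m0: "0 < m" using Gm[OF z] by simp
    define E where "E = {u\<in>D. G u = m}"
    have "m \<in> G ` D" unfolding m_def by (rule Max_in) (use D in auto)
    then have E_ne: "E \<noteq> {}" by (auto simp: E_def)
    \<comment> \<open>Maximum principle: where \<open>G\<close> attains its maximum
      \<open>m > 0\<close>, the defects \<open>m - G v\<close> and the mass lost at \<open>z\<close>
      are nonnegative and average to 0, so each of them vanishes.\<close>
    have E: "P u z = 0" "v \<noteq> z \<Longrightarrow> P u v * (m - G v) = 0" if u: "u \<in> E" for u v
    proof -
      have uD: "u \<in> D" using u by (simp add: E_def)
      have nn: "0 \<le> P u v * (m - G v)" for v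
        using D(3) uD Gm[of v] entry_nonneg[of u v] by (cases "v \<in> D") (auto simp: closed_set_def)
      have "m = P u z * m + (\<Sum>v\<in>UNIV - {z}. P u v) * m"
        using row_split[of u z] by (metis distrib_right mult_1)
      moreover have "m = (\<Sum>v\<in>UNIV - {z}. P u v * G v)"
        using G_step[of u] u by (simp add: E_def)
      ultimately have eq: "P u z * m + (\<Sum>v\<in>UNIV - {z}. P u v * (m - G v)) = 0"
        by (simp add: right_diff_distrib sum_subtractf sum_distrib_right)
      have s: "0 \<le> (\<Sum>v\<in>UNIV - {z}. P u v * (m - G v))" by (intro sum_nonneg nn)
      have p: "0 \<le> P u z * m" using m0 entry_nonneg by simp
      from eq s p have "P u z * m = 0" and s0: "(\<Sum>v\<in>UNIV - {z}. P u v * (m - G v)) = 0"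
        by linarith+
      then show "P u z = 0" using m0 by simp
      show "v \<noteq> z \<Longrightarrow> P u v * (m - G v) = 0"
        using s0 nn by (subst (asm) sum_nonneg_eq_0_iff) auto
    qed
    have "closed_set E"
      unfolding closed_set_def
    proof (intro ballI allI impI)
      fix u v assume u: "u \<in> E" and v: "v \<notin> E"
      show "P u v = 0"
        using E(1)[OF u] E(2)[OF u, of v] D(3) u v by (cases "v \<in> D") (auto simp: closed_set_def E_def)
    qed
    then have "D = E" using min E_ne by (auto simp: E_def)
    then have no_z: "P u z = 0" if "u \<in> D" for u using E(1) that by auto
    \<comment> \<open>\<open>z\<close> has a successor, which lies in \<open>D\<close> and is not
      \<open>z\<close>; so \<open>D - {z}\<close> is a nonempty closed set, against
      minimality.\<close>
    have "\<exists>v. P z v \<noteq> 0" using row_sum[of z] by (metis sum.neutral zero_neq_one)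
    then obtain v where v: "P z v \<noteq> 0" by auto
    then have "v \<in> D - {z}" using no_z[OF z] D(3) z by (auto simp: closed_set_def)
    moreover have "closed_set (D - {z})" using D(3) no_z by (auto simp: closed_set_def)
    ultimately have "D = D - {z}" by (intro min) auto
    then show False using z by auto
  qed
  then show thesis using z D that by auto
qed

section \<open>Survival in a set whose complement is closed\<close>

primrec expect_after :: "('y \<Rightarrow> real) \<Rightarrow> nat \<Rightarrow> 'y \<Rightarrow> real" where
  "expect_after f 0 x = f x"
| "expect_after f (Suc n) x = (\<Sum>z\<in>UNIV. P x z * expect_after f n z)"

lemma expect_after_nonneg: "(\<And>x. 0 \<le> f x) \<Longrightarrow> 0 \<le> expect_after f n x"
  by (induction n arbitrary: x) (auto intro!: sum_nonneg mult_nonneg_nonneg entry_nonneg)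

lemma outside_stays_0:
  assumes "closed_set (- W)" "x \<notin> W"
  shows "expect_after (indicator W) n x = 0"
  using assms(2)
proof (induction n arbitrary: x)
  case (Suc n)
  have "P x z * expect_after (indicator W) n z = 0" for z
    using Suc assms(1) by (cases "z \<in> W") (auto simp: closed_set_def)
  then show ?case by (simp only: expect_after.simps(2) sum.neutral_const)
qed auto

lemma expect_after_le_1: "expect_after (indicator W) n x \<le> 1"
proof (induction n arbitrary: x)
  case (Suc n)
  have "expect_after (indicator W) (Suc n) x \<le> (\<Sum>z\<in>UNIV. P x z * 1)"
    unfolding expect_after.simps by (intro sum_mono mult_left_mono Suc entry_nonneg)
  then show ?case by (simp add: row_sum)
qed (auto simp: indicator_def)

text \<open>\<open>expect_after (indicator W) n x\<close> is the probability of being in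
  \<open>W\<close> at time \<open>n\<close>. Since the complement of \<open>W\<close> cannot be
  left, this is the probability of not having left \<open>W\<close> so far, which can only
  decrease.\<close>

lemma survival_decseq:
  assumes "closed_set (- W)"
  shows "decseq (\<lambda>n. expect_after (indicator W) n x)"
proof -
  have "expect_after (indicator W) (Suc n) x \<le> expect_after (indicator W) n x" for n
  proof (induction n arbitrary: x)
    case 0
    show ?case using expect_after_le_1[of W "Suc 0" x] outside_stays_0[OF assms, of x "Suc 0"]
      by (cases "x \<in> W") auto
  next
    case (Suc n)
    have "(\<Sum>z\<in>UNIV. P x z * expect_after (indicator W) (Suc n) z)
        \<le> (\<Sum>z\<in>UNIV. P x z * expect_after (indicator W) n z)"
      by (rule sum_mono) (intro mult_left_mono Suc.IH entry_nonneg)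
    then show ?case by (simp only: expect_after.simps(2))
  qed
  then show ?thesis by (rule decseq_SucI)
qed

text \<open>Letting \<open>n\<close> tend to infinity in the one-step recursion makes the limit of
  the survival probabilities harmonic, ready for maximum arguments.\<close>

lemma survival_limit:
  assumes "closed_set (- W)"
  shows "\<exists>h. \<forall>x. (\<lambda>n. expect_after (indicator W) n x) \<longlonglongrightarrow> h x \<and>
    h x = (\<Sum>z\<in>UNIV. P x z * h z) \<and> 0 \<le> h x \<and> (x \<notin> W \<longrightarrow> h x = 0)"
proof -
  define h where "h x = lim (\<lambda>n. expect_after (indicator W) n x)" for x
  have h: "(\<lambda>n. expect_after (indicator W) n x) \<longlonglongrightarrow> h x" for x
    using decseq_convergent[OF survival_decseq[OF assms], of 0 x]
    by (metis expect_after_nonneg h_def indicator_pos_le limI)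
  have h_eq: "h x = (\<Sum>z\<in>UNIV. P x z * h z)" for x
  proof (rule LIMSEQ_unique)
    show "(\<lambda>n. expect_after (indicator W) (Suc n) x) \<longlonglongrightarrow> h x"
      using h by (rule LIMSEQ_Suc)
    show "(\<lambda>n. expect_after (indicator W) (Suc n) x) \<longlonglongrightarrow> (\<Sum>z\<in>UNIV. P x z * h z)"
      unfolding expect_after.simps by (intro tendsto_intros h)
  qed
  have "0 \<le> h x" for x
    using h by (rule LIMSEQ_le_const) (auto intro: expect_after_nonneg)
  moreover have "h x = 0" if "x \<notin> W" for x
    using h[of x] outside_stays_0[OF assms that] by (simp add: LIMSEQ_const_iff)
  ultimately show ?thesis using h h_eq by blast
qed

text \<open>If the harmonic limit \<open>h\<close> had a positive maximum, its maximum set would be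
  closed and hence contain a nontransient state. Such a state lies outside \<open>W\<close>, where
  \<open>h\<close> is 0.\<close>

lemma transient_set_left:
  assumes W: "closed_set (- W)" and tr: "\<And>x. x \<in> W \<Longrightarrow> transient P x"
  shows "(\<lambda>n. expect_after (indicator W) n x) \<longlonglongrightarrow> 0"
proof -
  obtain h where h: "\<And>x. (\<lambda>n. expect_after (indicator W) n x) \<longlonglongrightarrow> h x"
    "\<And>x. h x = (\<Sum>z\<in>UNIV. P x z * h z)" "\<And>x. 0 \<le> h x" "\<And>x. x \<notin> W \<Longrightarrow> h x = 0"
    using survival_limit[OF W] by blast
  define m where "m = Max (range h)"
  have hm: "h u \<le> m" for u by (auto simp: m_def)
  have "m \<in> range h" unfolding m_def by (rule Max_in) auto
  then obtain x0 where x0: "h x0 = m" by auto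
  have "m \<le> 0"
  proof (rule ccontr)
    assume m: "\<not> m \<le> 0"
    let ?C = "{u. h u = m}"
    have "closed_set ?C"
      unfolding closed_set_def
    proof (intro ballI allI impI)
      fix u v assume u: "u \<in> ?C" and v: "v \<notin> ?C"
      have "(\<Sum>z\<in>UNIV. P u z * (m - h z)) = (\<Sum>z\<in>UNIV. P u z) * m - h u"
        by (subst h(2)[of u]) (simp add: right_diff_distrib sum_subtractf sum_distrib_right)
      then have "(\<Sum>z\<in>UNIV. P u z * (m - h z)) = 0" using u by (simp add: row_sum)
      then have "P u v * (m - h v) = 0"
        by (subst (asm) sum_nonneg_eq_0_iff) (auto simp: hm entry_nonneg)
      then show "P u v = 0" using v by auto
    qed
    then obtain x where "x \<in> ?C" "\<not> transient P x"
      using closed_set_contains_nontransient x0 by blast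
    then show False using tr h(4)[of x] m by auto
  qed
  then have "h x = 0" using hm[of x] h(3)[of x] by simp
  then show ?thesis using h(1)[of x] by simp
qed

text \<open>Once the survival probability has dropped to 1/2 everywhere on the closed set where it
  tends to 0, it is halved in every further block of the same length.\<close>

lemma survival_geometric:
  assumes W: "closed_set (- W)"
  shows "\<exists>N>0. \<forall>x n. (\<lambda>n. expect_after (indicator W) n x) \<longlonglongrightarrow> 0 \<longrightarrow>
      expect_after (indicator W) (N * n) x \<le> (1/2) ^ n"
proof -
  let ?h = "\<lambda>n. expect_after (indicator W) n"
  obtain h where h: "\<And>x. (\<lambda>n. ?h n x) \<longlonglongrightarrow> h x"
    "\<And>x. h x = (\<Sum>z\<in>UNIV. P x z * h z)" "\<And>x. 0 \<le> h x"
    using survival_limit[OF W] by blast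
  let ?X = "{x. h x = 0}"
  have X: "x \<in> ?X \<longleftrightarrow> (\<lambda>n. ?h n x) \<longlonglongrightarrow> 0" for x
    using h(1)[of x] LIMSEQ_unique by auto
  \<comment> \<open>A nonnegative harmonic function that vanishes at \<open>x\<close> vanishes at
    all successors of \<open>x\<close>, so the halving argument never leaves
    \<open>?X\<close>.\<close>
  have X_closed: "P x z = 0" if "x \<in> ?X" "z \<notin> ?X" for x z
  proof -
    have "(\<Sum>z\<in>UNIV. P x z * h z) = 0" using h(2)[of x] that by simp
    then have "P x z * h z = 0"
      by (subst (asm) sum_nonneg_eq_0_iff) (auto simp: h(3) entry_nonneg)
    then show ?thesis using that by auto
  qed
  have "eventually (\<lambda>n. \<forall>x\<in>?X. ?h n x \<le> 1/2) sequentially"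
  proof (rule eventually_ball_finite)
    show "\<forall>x\<in>?X. \<forall>\<^sub>F n in sequentially. ?h n x \<le> 1/2"
    proof
      fix x assume "x \<in> ?X"
      then have "\<forall>\<^sub>F n in sequentially. ?h n x < 1/2"
        by (intro order_tendstoD(2)[of _ 0]) (use X in auto)
      then show "\<forall>\<^sub>F n in sequentially. ?h n x \<le> 1/2"
        by (rule eventually_mono) simp
    qed
  qed simp
  then obtain N0 where N0: "\<And>n. n \<ge> N0 \<Longrightarrow> \<forall>x\<in>?X. ?h n x \<le> 1/2"
    by (auto simp: eventually_sequentially)
  \<comment> \<open>\<open>Suc N0\<close> rather than \<open>N0\<close> keeps the block length
    positive.\<close>
  then have N: "?h (Suc N0) x \<le> 1/2" if "x \<in> ?X" for x
    using N0[of "Suc N0"] that by (simp del: expect_after.simps)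
  have half: "?h (Suc N0 + n) x \<le> 1/2 * ?h n x" if "x \<in> ?X" for n x
    using that
  proof (induction n arbitrary: x)
    case 0
    then show ?case using N[of x] outside_stays_0[OF W, of x "Suc N0"] by (cases "x \<in> W") auto
  next
    case (Suc n)
    have "?h (Suc N0 + Suc n) x = (\<Sum>z\<in>UNIV. P x z * ?h (Suc N0 + n) z)" by simp
    also have "\<dots> \<le> (\<Sum>z\<in>UNIV. P x z * (1/2 * ?h n z))"
    proof (rule sum_mono)
      fix z
      show "P x z * ?h (Suc N0 + n) z \<le> P x z * (1/2 * ?h n z)"
      proof (cases "z \<in> ?X")
        case True
        then show ?thesis by (intro mult_left_mono Suc.IH entry_nonneg)
      next
        case False
        then show ?thesis using X_closed[OF Suc.prems, of z] by simp
      qed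
    qed
    also have "\<dots> = 1/2 * ?h (Suc n) x" by (simp add: sum_distrib_left mult_ac)
    finally show ?case .
  qed
  have "?h (Suc N0 * n) x \<le> (1/2) ^ n" if "x \<in> ?X" for n x
  proof (induction n)
    case (Suc n)
    have "?h (Suc N0 * Suc n) x \<le> 1/2 * ?h (Suc N0 * n) x"
      using half[OF that, of "Suc N0 * n"] by (simp only: mult_Suc_right)
    also have "\<dots> \<le> 1/2 * (1/2) ^ n" using Suc by simp
    finally show ?case by simp
  qed (use expect_after_le_1 in auto)
  then show ?thesis using X by (intro exI[of _ "Suc N0"]) auto
qed

end

subsection \<open>Extended real auxiliaries and accumulated costs\<close>

lemma epowr_ennreal: "0 \<le> x \<Longrightarrow> epowr (ennreal x) r = ennreal (x powr r)"
  by (simp add: epowr_def)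

lemma epowr_top [simp]: "epowr top r = top"
  by (simp add: epowr_def infinity_ennreal_def)

lemma epowr_mono: "x \<le> y \<Longrightarrow> 0 \<le> r \<Longrightarrow> epowr x r \<le> epowr y r"
  by (cases x; cases y) (auto simp: epowr_ennreal top_unique intro!: ennreal_leI powr_mono2)

lemma epowr_measurable [measurable]: "(\<lambda>x. epowr x r) \<in> borel_measurable borel"
  unfolding epowr_def by measurable

lemma epowr_mult_ennreal: "0 < a \<Longrightarrow> epowr (ennreal a * x) r = ennreal (a powr r) * epowr x r"
  by (cases x) (auto simp: epowr_ennreal powr_mult ennreal_mult[symmetric] ennreal_mult_top)

text \<open>Finiteness of \<open>f\<close> is part of the criterion because
  \<open>\<infinity> / \<infinity>\<close> is 0 here. Where \<open>g\<close> vanishes, the upper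
  bound makes \<open>f\<close> vanish too, and the ratio is 1 by convention.\<close>

lemma ennreal_asymp_equivI:
  assumes le: "\<And>\<epsilon>. 0 < \<epsilon> \<Longrightarrow> \<forall>\<^sub>F x in F. f x \<le> ennreal (1 + \<epsilon>) * g x"
    and fin: "\<forall>\<^sub>F x in F. f x < \<infinity>" and ge: "\<forall>\<^sub>F x in F. g x \<le> f x"
  shows "ennreal_asymp_equiv F f g"
  unfolding ennreal_asymp_equiv_def
proof (rule order_tendstoI)
  fix a :: ennreal assume a: "a < 1"
  show "\<forall>\<^sub>F x in F. a < (if f x = 0 \<and> g x = 0 then 1 else f x / g x)"
    using fin ge
  proof eventually_elim
    case (elim x)
    have "1 \<le> f x / g x" if "g x \<noteq> 0"
    proof -
      have "g x / g x \<le> f x / g x" using elim by (intro divide_right_mono_ennreal)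
      moreover have "g x < top" using elim by (auto simp: infinity_ennreal_def)
      ultimately show ?thesis using that by (simp add: ennreal_divide_self less_top zero_less_iff_neq_zero)
    qed
    then show ?case using a elim
      by (cases "g x = 0") (auto simp: ennreal_divide_zero less_le_trans zero_less_iff_neq_zero[symmetric])
  qed
next
  fix a :: ennreal assume a: "1 < a"
  obtain \<epsilon> where \<epsilon>: "0 < \<epsilon>" "ennreal (1 + \<epsilon>) < a"
  proof (cases a)
    case (real r)
    then have "1 < r" using a by (simp add: ennreal_1[symmetric] ennreal_less_iff del: ennreal_1)
    then show ?thesis using that[of "(r - 1)/2"] real by (simp add: ennreal_less_iff field_simps)
  next
    case top
    then show ?thesis using that[of 1] by simp
  qed
  show "\<forall>\<^sub>F x in F. (if f x = 0 \<and> g x = 0 then 1 else f x / g x) < a"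
    using le[OF \<epsilon>(1)] fin ge
  proof eventually_elim
    case (elim x)
    have "f x / g x \<le> ennreal (1 + \<epsilon>)" if "g x \<noteq> 0"
    proof -
      have "f x / g x \<le> ennreal (1 + \<epsilon>) * g x / g x"
        using elim by (intro divide_right_mono_ennreal)
      moreover have "g x < top" using elim by (auto simp: infinity_ennreal_def)
      ultimately show ?thesis using that
        by (simp add: ennreal_times_divide[symmetric] ennreal_divide_self less_top zero_less_iff_neq_zero)
    qed
    moreover have "f x = 0" if "g x = 0" using elim that by simp
    ultimately show ?case using a \<epsilon> by (auto intro: le_less_trans)
  qed
qed

text \<open>\<open>w\<close> is the scale of the error. The second half of \<open>err\<close> says
  that \<open>g\<close> is at least of order \<open>w\<close>, so an error \<open>\<rho> * w\<close>
  is a small fraction of \<open>g\<close>. It is used with \<open>w = b^m\<close> when the mean cost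
  grows linearly and with \<open>w = 1\<close> when the total cost has finite moments.\<close>

lemma ennreal_asymp_equiv_additive_error:
  assumes \<kappa>: "0 < \<kappa>"
    and err: "\<And>\<rho>. 0 < \<rho> \<Longrightarrow> \<forall>\<^sub>F x in F. f x \<le> g x + ennreal (\<rho> * w x) \<and> ennreal (\<kappa> * w x) \<le> g x + ennreal (\<rho> * w x)"
    and fin: "\<forall>\<^sub>F x in F. f x < \<infinity>" and ge: "\<forall>\<^sub>F x in F. g x \<le> f x"
    and w: "\<forall>\<^sub>F x in F. 0 \<le> w x"
  shows "ennreal_asymp_equiv F f g"
proof (rule ennreal_asymp_equivI[OF _ fin ge])
  fix \<epsilon> :: real assume \<epsilon>: "0 < \<epsilon>"
  \<comment> \<open>With \<open>\<rho> \<le> \<kappa>/2\<close> the lower bound becomes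
    \<open>g \<ge> \<kappa>/2 * w\<close>; with \<open>\<rho> \<le> \<epsilon> * \<kappa>/2\<close>
    the error is then at most \<open>\<epsilon> * g\<close>.\<close>
  define \<rho> where "\<rho> = min (\<kappa>/2) (\<epsilon> * \<kappa>/2)"
  have "0 < \<rho>" using \<kappa> \<epsilon> by (simp add: \<rho>_def)
  show "\<forall>\<^sub>F x in F. f x \<le> ennreal (1 + \<epsilon>) * g x"
    using err[OF \<open>0 < \<rho>\<close>] fin ge w
  proof eventually_elim
    case (elim x)
    from elim have "g x < top" "f x < top" by (auto simp: infinity_ennreal_def)
    then obtain u v where uv: "g x = ennreal u" "f x = ennreal v" "0 \<le> u" "0 \<le> v"
      by (cases "g x"; cases "f x") auto
    have 1: "v \<le> u + \<rho> * w x" "\<kappa> * w x \<le> u + \<rho> * w x"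
      using elim uv \<open>0 < \<rho>\<close> \<kappa> by (auto simp: ennreal_plus[symmetric] ennreal_le_iff simp del: ennreal_plus)
    have "\<rho> \<le> \<kappa>/2" "\<rho> \<le> \<epsilon> * \<kappa>/2" by (simp_all add: \<rho>_def)
    then have 2: "\<rho> * w x \<le> \<kappa>/2 * w x" "\<rho> * w x \<le> \<epsilon> * \<kappa>/2 * w x"
      using elim by (intro mult_right_mono; simp)+
    from 1 2 have "\<kappa>/2 * w x \<le> u" by (simp add: field_simps)
    then have "\<epsilon> * (\<kappa>/2 * w x) \<le> \<epsilon> * u" using \<epsilon> by (intro mult_left_mono) auto
    then have "v \<le> (1 + \<epsilon>) * u" using 1(1) 2(2) by (simp add: field_simps)
    then have "ennreal v \<le> ennreal ((1 + \<epsilon>) * u)" by (rule ennreal_leI)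
    then show ?case using uv \<epsilon> by (simp only: ennreal_mult)
  qed
qed

text \<open>The base of the power in \<open>delay\<close>, as a function of the stopping value;
  \<open>e = \<infinity>\<close> gives the total cost. \<open>cost\<close> below is its real-valued
  version for finite times.\<close>

definition stopped_cost :: "('w, 'y, 'e) hmm \<Rightarrow> ('y \<Rightarrow> real) \<Rightarrow> enat \<Rightarrow> 'w \<Rightarrow> ennreal" where
  "stopped_cost H c e \<omega> = (\<Sum>t. ennreal (c (state H t \<omega>)) * (if enat t < e then 1 else 0))"

definition cost :: "('w, 'y, 'e) hmm \<Rightarrow> ('y \<Rightarrow> real) \<Rightarrow> nat \<Rightarrow> 'w \<Rightarrow> real" where
  "cost H c K \<omega> = (\<Sum>t<K. c (state H t \<omega>))"

lemma delay_eq: "delay H c m i \<tau> = (\<integral>\<^sup>+\<omega>. epowr (stopped_cost H c (\<tau> \<omega>) \<omega>) m \<partial>cond_law H i)"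
  by (simp add: delay_def stopped_cost_def)

lemma stopped_cost_mono: "e \<le> e' \<Longrightarrow> stopped_cost H c e \<omega> \<le> stopped_cost H c e' \<omega>"
  unfolding stopped_cost_def by (intro suminf_le) (auto simp: order.strict_trans2)

context
  fixes H :: "('w, 'y, 'e) hmm" and c :: "'y \<Rightarrow> real"
  assumes c_nonneg: "\<And>y. 0 \<le> c y"
begin

lemma cost_nonneg: "0 \<le> cost H c K \<omega>"
  unfolding cost_def by (intro sum_nonneg c_nonneg)

lemma stopped_cost_enat: "stopped_cost H c (enat K) \<omega> = ennreal (cost H c K \<omega>)"
proof -
  have "stopped_cost H c (enat K) \<omega>
      = (\<Sum>t<K. ennreal (c (state H t \<omega>)) * (if enat t < enat K then 1 else 0))"
    unfolding stopped_cost_def by (rule suminf_finite) auto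
  also have "\<dots> = (\<Sum>t<K. ennreal (c (state H t \<omega>)))" by (rule sum.cong) auto
  finally show ?thesis by (simp add: cost_def sum_ennreal c_nonneg)
qed

lemma cost_le:
  assumes C: "\<And>y. c y \<le> C" shows "cost H c K \<omega> \<le> C * real K"
proof -
  have "cost H c K \<omega> \<le> (\<Sum>t<K. C)" unfolding cost_def by (intro sum_mono C)
  then show ?thesis by (simp add: mult.commute)
qed

lemma stopped_cost_le:
  assumes C: "\<And>y. c y \<le> C" "0 < C"
  shows "stopped_cost H c e \<omega> \<le> ennreal C * ennreal_of_enat e"
proof (cases e)
  case (enat K)
  then show ?thesis using cost_le[OF C(1), of K \<omega>] C(2)
    by (simp add: stopped_cost_enat ennreal_of_nat_eq_real_of_nat ennreal_mult[symmetric] ennreal_leI)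
next
  case infinity
  then show ?thesis using C(2) by (simp add: ennreal_mult_top)
qed

text \<open>Up to time \<open>K\<close> the cost is bounded by monotonicity; after \<open>K\<close>
  the crude bound \<open>C * e\<close> suffices, since the tail moment of the stopping time is
  controlled separately.\<close>

lemma epowr_stopped_cost_split:
  assumes C: "\<And>y. c y \<le> C" "0 < C" and m: "0 \<le> m"
  shows "epowr (stopped_cost H c e \<omega>) m \<le> ennreal (cost H c K \<omega> powr m)
    + ennreal (C powr m) * (epowr (ennreal_of_enat e) m * (if enat K < e then 1 else 0))"
proof (cases "enat K < e")
  case True
  have "epowr (stopped_cost H c e \<omega>) m \<le> epowr (ennreal C * ennreal_of_enat e) m"
    by (intro epowr_mono stopped_cost_le C m)
  then show ?thesis using True C(2) by (simp add: epowr_mult_ennreal add_increasing)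
next
  case False
  then have "epowr (stopped_cost H c e \<omega>) m \<le> epowr (stopped_cost H c (enat K) \<omega>) m"
    by (intro epowr_mono stopped_cost_mono m) auto
  then show ?thesis using False by (simp add: stopped_cost_enat epowr_ennreal cost_nonneg)
qed

end

text \<open>Monotonicity fills the gaps between the multiples of \<open>N\<close>, so
  \<open>a\<close> decays exponentially and beats the polynomial factor.\<close>

lemma summable_moment_geometric:
  fixes C m :: real and a :: "nat \<Rightarrow> real"
  assumes "0 < N" and a: "\<And>n. 0 \<le> a n" "decseq a" "\<And>n. a (N * n) \<le> (1/2) ^ n" and C: "0 \<le> C"
  shows "summable (\<lambda>t. (C * real (t + 1)) powr m * a t)"
proof (rule summable_comparison_test')
  have "(\<lambda>t. real (t + 1) powr m * 2 powr (- real t / real N)) \<in> O(\<lambda>t. 1 / real t ^ 2)"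
    using \<open>0 < N\<close> by real_asymp
  then have "summable (\<lambda>t. real (t + 1) powr m * 2 powr (- real t / real N))"
    by (rule summable_comparison_test_bigo[rotated]) (simp add: inverse_power_summable[where 'a=real, of 2, unfolded inverse_eq_divide power_one_over])
  then show "summable (\<lambda>t. (C powr m * 2) * (real (t + 1) powr m * 2 powr (- real t / real N)))"
    by (rule summable_mult)
  fix t :: nat assume "t \<ge> 0"
  have "a t \<le> a (N * (t div N))" using a(2) by (auto simp: decseq_def)
  also have "\<dots> \<le> (1/2) ^ (t div N)" by (rule a)
  also have "\<dots> = 2 powr (- real (t div N))"
    by (simp add: powr_minus powr_realpow power_one_over inverse_eq_divide)
  \<comment> \<open>Rounding \<open>t / N\<close> down loses less than 1 in the exponent, hence a
    factor 2.\<close>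
  also have "\<dots> \<le> 2 powr (1 - real t / real N)"
  proof (rule powr_mono)
    have "real t = real N * real (t div N) + real (t mod N)"
      by (metis mult_div_mod_eq of_nat_add of_nat_mult)
    moreover have "real (t mod N) < real N" using \<open>0 < N\<close> by simp
    ultimately have "real t / real N < real (t div N) + 1"
      using \<open>0 < N\<close> by (simp add: field_simps)
    then show "- real (t div N) \<le> 1 - real t / real N" by simp
  qed simp
  also have "\<dots> = 2 * 2 powr (- real t / real N)"
    by (simp add: powr_diff powr_minus field_simps)
  finally have at: "a t \<le> 2 * 2 powr (- real t / real N)" .
  have "norm ((C * real (t + 1)) powr m * a t) = C powr m * real (t + 1) powr m * a t"
    using a(1) C by (simp add: powr_mult)
  also have "\<dots> \<le> C powr m * real (t + 1) powr m * (2 * 2 powr (- real t / real N))"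
    by (intro mult_left_mono at) simp
  finally show "norm ((C * real (t + 1)) powr m * a t)
      \<le> (C powr m * 2) * (real (t + 1) powr m * 2 powr (- real t / real N))"
    by (simp add: mult_ac)
qed

text \<open>The total cost is at most \<open>C\<close> times the last time at which a cost is possible.\<close>

lemma epowr_total_cost_le:
  assumes c: "\<And>y. 0 \<le> c y" "\<And>y. c y \<le> C" and m: "0 \<le> m"
    and W: "\<And>t. state H t \<omega> \<notin> W \<Longrightarrow> c (state H t \<omega>) = 0"
    and ev: "\<forall>\<^sub>F t in sequentially. state H t \<omega> \<notin> W"
  shows "epowr (stopped_cost H c \<infinity> \<omega>) m \<le> ennreal (cost H c K \<omega> powr m)
    + (\<Sum>t. ennreal ((C * real (t + K + 1)) powr m) * (if state H (t + K) \<omega> \<in> W then 1 else 0))"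
    (is "_ \<le> _ + (\<Sum>t. ?g t)")
proof -
  have C0: "0 \<le> C" using c(1)[of undefined] c(2)[of undefined] by simp
  have total: "stopped_cost H c \<infinity> \<omega> = ennreal (cost H c n \<omega>)" if "\<And>t. n \<le> t \<Longrightarrow> state H t \<omega> \<notin> W" for n
  proof -
    have "stopped_cost H c \<infinity> \<omega> = (\<Sum>t<n. ennreal (c (state H t \<omega>)))"
      unfolding stopped_cost_def using that W by (subst suminf_finite[of "{..<n}"]) (auto simp: not_less)
    then show ?thesis by (simp add: cost_def sum_ennreal c)
  qed
  obtain n0 where n0: "\<And>t. n0 \<le> t \<Longrightarrow> state H t \<omega> \<notin> W"
    using ev by (auto simp: eventually_sequentially)
  show ?thesis
  proof (cases "\<exists>t\<ge>K. state H t \<omega> \<in> W")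
    case False
    then show ?thesis using total[of K] epowr_ennreal[OF cost_nonneg[of c H K \<omega>, OF c(1)], of m]
      by (simp add: add_increasing2)
  next
    case True
    let ?T = "{t. K \<le> t \<and> state H t \<omega> \<in> W}"
    have fin: "finite ?T" using n0 by (intro finite_subset[of ?T "{..<n0}"]) (auto simp: not_le[symmetric])
    define T where "T = Max ?T"
    have T: "T \<in> ?T" unfolding T_def using fin True by (intro Max_in) auto
    have last: "state H t \<omega> \<notin> W" if "Suc T \<le> t" for t
    proof
      assume "state H t \<omega> \<in> W"
      then have "t \<le> T" unfolding T_def using fin T that by (intro Max_ge) auto
      then show False using that by simp
    qed
    have "epowr (stopped_cost H c \<infinity> \<omega>) m = ennreal (cost H c (Suc T) \<omega> powr m)"
      using total[of "Suc T", OF last] epowr_ennreal[OF cost_nonneg[of c H "Suc T" \<omega>, OF c(1)], of m] by simp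
    also have "\<dots> \<le> ennreal ((C * real (Suc T)) powr m)"
      using cost_le[of c C H "Suc T" \<omega>] c m by (intro ennreal_leI powr_mono2) (auto simp: cost_nonneg)
    \<comment> \<open>The single term of the series that belongs to the last visit \<open>T\<close>
      to \<open>W\<close> already dominates; its index is shifted by \<open>K\<close>.\<close>
    also have "\<dots> = ?g (T - K)" using T by simp
    also have "\<dots> \<le> (\<Sum>t. ?g t)"
      using sum_le_suminf[of ?g "{T - K}"] by simp
    finally show ?thesis by (simp add: add_increasing)
  qed
qed

text \<open>Mean value theorem: for \<open>m \<ge> 1\<close> the derivative of the power is
  increasing, so its value at the right end point bounds the increment.\<close>

lemma powr_add_le:
  fixes x h m :: real
  assumes x: "0 \<le> x" and h: "0 \<le> h" and m: "1 \<le> m"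
  shows "(x + h) powr m \<le> x powr m + m * h * (x + h) powr (m - 1)"
proof (cases "x = 0 \<or> h = 0")
  case True
  then show ?thesis
  proof
    assume "x = 0"
    have "h powr m = h * h powr (m - 1)"
      using h by (cases "h = 0") (auto simp: powr_diff)
    also have "\<dots> \<le> m * (h * h powr (m - 1))"
      using mult_right_mono[OF m, of "h * h powr (m - 1)"] h by simp
    finally show ?thesis using \<open>x = 0\<close> by (simp add: mult.assoc)
  qed simp
next
  case False
  then have xh: "0 < x" "x < x + h" using x h by auto
  have "\<exists>z>x. z < x + h \<and> (x + h) powr m - x powr m = (x + h - x) * (m * z powr (m - 1))"
    using xh by (intro MVT2) (auto intro!: derivative_eq_intros simp: powr_diff)
  then obtain z where z: "x < z" "z < x + h" "(x + h) powr m - x powr m = h * (m * z powr (m - 1))"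
    by auto
  have "z powr (m - 1) \<le> (x + h) powr (m - 1)" using z xh m by (intro powr_mono2) auto
  then have "h * (m * z powr (m - 1)) \<le> h * (m * (x + h) powr (m - 1))"
    using h m by (intro mult_left_mono) auto
  then show ?thesis using z(3) by (simp add: mult_ac)
qed

section \<open>First times in \<open>enat\<close> and the extended logarithm of a ratio\<close>

lemma Inf_enat_le_iff: "Inf {enat n | n. Q n} \<le> enat N \<longleftrightarrow> (\<exists>n\<le>N. Q n)"
proof
  assume "Inf {enat n | n. Q n} \<le> enat N"
  then have "Inf {enat n | n. Q n} < enat (Suc N)" by (simp add: le_less_trans)
  then show "\<exists>n\<le>N. Q n" by (auto simp: Inf_less_iff less_Suc_eq_le)
next
  assume "\<exists>n\<le>N. Q n"
  then obtain n where "n \<le> N" "Q n" by auto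
  then show "Inf {enat n | n. Q n} \<le> enat N"
    by (intro Inf_lower2[of "enat n"]) auto
qed

lemma Inf_enat_eqD: "Inf {enat n | n. Q n} = enat N \<Longrightarrow> Q N"
proof -
  assume eq: "Inf {enat n | n. Q n} = enat N"
  then obtain n where n: "n \<le> N" "Q n" using Inf_enat_le_iff[of Q N] by auto
  then have "enat N \<le> enat n" using eq Inf_enat_le_iff[of Q n] by auto
  then show "Q N" using n by simp
qed

lemma measurable_enat_count_space:
  fixes T :: "'a \<Rightarrow> enat"
  assumes [measurable]: "T \<in> borel_measurable M"
  shows "T \<in> measurable M (count_space UNIV)"
proof -
  have "{\<omega> \<in> space M. T \<omega> = e} \<in> sets M" for e by measurable
  moreover have "T -` {e} \<inter> space M = {\<omega> \<in> space M. T \<omega> = e}" for e by auto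
  ultimately show ?thesis
    by (subst measurable_count_space_eq_countable) auto
qed

lemma elog_ereal: "0 < r \<Longrightarrow> elog (ereal r) = ereal (ln r)"
  by (simp add: elog_def)

lemma elog_ratio: "0 < p \<Longrightarrow> 0 < q \<Longrightarrow> elog (ereal p / ereal q) = ereal (ln (p / q))"
  using elog_ereal[of "p / q"] by simp

lemma elog_ratio_0: "0 < p \<Longrightarrow> elog (ereal p / ereal 0) = \<infinity>"
  by (simp add: elog_def divide_ereal_def)

lemma elog_0_ratio: "elog (ereal 0 / x) = -\<infinity>"
  by (simp add: elog_def divide_ereal_def zero_ereal_def[symmetric])

text \<open>The multiplied-out inequality avoids dividing by a vanishing posterior:
  \<open>q = 0\<close> makes it trivial, and \<open>p = 0\<close> would make the logarithm
  \<open>-\<infinity>\<close>. The next lemma treats the reverse inequality in the same way.\<close>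

lemma elog_ratio_gtD:
  assumes "0 \<le> p" "0 \<le> q" "ereal x < elog (ereal p / ereal q)"
  shows "q \<le> exp (- x) * p"
proof -
  have p: "0 < p" using assms elog_0_ratio[of "ereal q"] by (cases "p = 0") auto
  show ?thesis
  proof (cases "q = 0")
    case False
    then have q: "0 < q" using assms by simp
    then have "x < ln (p / q)" using assms(3) elog_ratio[OF p q] by (simp only: less_ereal.simps)
    then have "exp x < exp (ln (p / q))" by simp
    then have "exp x < p / q" using p q by (simp only: exp_ln divide_pos_pos)
    then show ?thesis using q by (simp add: exp_minus field_simps)
  qed (use assms in simp)
qed

lemma elog_ratio_leD:
  assumes "0 \<le> p" "0 \<le> q" "elog (ereal p / ereal q) \<le> ereal a"
  shows "p \<le> exp a * q"
proof (cases "p = 0 \<or> q = 0")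
  case True
  then show ?thesis using assms elog_ratio_0[of p] by (cases "p = 0") auto
next
  case False
  then have pq: "0 < p" "0 < q" using assms by auto
  then have "ln (p / q) \<le> a" using assms(3) elog_ratio[OF pq] by (simp only: ereal_less_eq)
  then have "exp (ln (p / q)) \<le> exp a" by simp
  then have "p / q \<le> exp a" using pq by (simp only: exp_ln divide_pos_pos)
  then show ?thesis using pq by (simp add: field_simps)
qed

context hidden_markov
begin

interpretation prob_space "Prob H" by (rule prob_space_Prob)

interpretation tm: stochastic_matrix "tmat H"
  by unfold_locales (use tmat_stochastic in auto)

declare state_measurable [measurable]

subsection \<open>The law of the hidden chain\<close>

lemma measurable_state_pred [measurable]:
  "Measurable.pred (Prob H) (\<lambda>\<omega>. Q (state H n \<omega>))"
  using state_measurable[of n] by (rule measurable_compose) simp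

text \<open>All observation sets are taken to be the whole space, and every density integrates to
  1.\<close>

lemma path_law:
  "prob {\<omega> \<in> space (Prob H). \<forall>n\<le>t. state H n \<omega> = y n}
    = eta H (y 0) * (\<Prod>n=1..t. tmat H (y (n - 1)) (y n))"
proof -
  have dens_1: "(LINT x:space (Obs H)|Obs H. dens H z x) = 1" for z
  proof -
    have "(LINT x:space (Obs H)|Obs H. dens H z x) = (\<integral>x. dens H z x \<partial>Obs H)"
      unfolding set_lebesgue_integral_def by (intro Bochner_Integration.integral_cong) auto
    also have "\<dots> = enn2real (\<integral>\<^sup>+x. ennreal (dens H z x) \<partial>Obs H)"
      by (intro integral_eq_nn_integral dens_measurable) (simp add: dens_nonneg)
    finally show ?thesis by (simp add: dens_total)
  qed
  have "{\<omega> \<in> space (Prob H). \<forall>n\<le>t. state H n \<omega> = y n} = {\<omega> \<in> space (Prob H).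
      (\<forall>n\<le>t. state H n \<omega> = y n) \<and> (\<forall>n\<in>{1..t}. obs H n \<omega> \<in> space (Obs H))}"
    using measurable_space[OF obs_measurable] by auto
  then show ?thesis
    using joint_law[of t "\<lambda>_. space (Obs H)" y] by (simp add: dens_1)
qed

text \<open>Only laws of whole paths are given, so the one-step law is obtained by summing over all
  pasts that end in \<open>x\<close>.\<close>

lemma transition_law:
  "prob {\<omega> \<in> space (Prob H). state H n \<omega> = x \<and> state H (Suc n) \<omega> = z}
    = prob {\<omega> \<in> space (Prob H). state H n \<omega> = x} * tmat H x z"
proof -
  \<comment> \<open>Extensional functions represent each past up to \<open>n\<close> exactly once,
    which makes the index set finite and the path events disjoint.\<close>
  define S where "S = {f \<in> PiE {..n} (\<lambda>_. UNIV :: 'y set). f n = x}"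
  define E where "E k f = {\<omega> \<in> space (Prob H). \<forall>i\<le>k. state H i \<omega> = f i}" for k f
  have fin: "finite S"
    unfolding S_def by (rule finite_subset[OF _ finite_PiE[of "{..n}" "\<lambda>_. UNIV"]]) auto
  have E [measurable]: "E k f \<in> events" for k f
    unfolding E_def by measurable
  have restr: "restrict (\<lambda>i. state H i \<omega>) {..n} \<in> S" if "state H n \<omega> = x" for \<omega>
    using that by (auto simp: S_def)
  have disj: "f = g" if "f \<in> S" "g \<in> S" "\<omega> \<in> E n f" "\<omega> \<in> E n g" for f g \<omega>
    using that by (intro PiE_ext[of f "{..n}" "\<lambda>_. UNIV" g]) (auto simp: S_def E_def)
  have sub: "E (Suc n) (f(Suc n := z)) \<subseteq> E n f" for f
    unfolding E_def by (auto split: if_splits)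
  have "{\<omega> \<in> space (Prob H). state H n \<omega> = x} = (\<Union>f\<in>S. E n f)"
    using restr by (fastforce simp: E_def S_def)
  moreover have "disjoint_family_on (E n) S"
    using disj by (fastforce simp: disjoint_family_on_def)
  ultimately have 1: "prob {\<omega> \<in> space (Prob H). state H n \<omega> = x} = (\<Sum>f\<in>S. prob (E n f))"
    using finite_measure_finite_Union[OF fin, of "E n"] E by (simp add: image_subset_iff)
  have "{\<omega> \<in> space (Prob H). state H n \<omega> = x \<and> state H (Suc n) \<omega> = z}
      = (\<Union>f\<in>S. E (Suc n) (f(Suc n := z)))"
  proof (intro equalityI subsetI)
    fix \<omega> assume "\<omega> \<in> {\<omega> \<in> space (Prob H). state H n \<omega> = x \<and> state H (Suc n) \<omega> = z}"
    then show "\<omega> \<in> (\<Union>f\<in>S. E (Suc n) (f(Suc n := z)))"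
      using restr[of \<omega>] by (intro UN_I[of "restrict (\<lambda>i. state H i \<omega>) {..n}"]) (auto simp: E_def le_Suc_eq)
  next
    fix \<omega> assume "\<omega> \<in> (\<Union>f\<in>S. E (Suc n) (f(Suc n := z)))"
    then obtain f where f: "f \<in> S" "\<omega> \<in> E (Suc n) (f(Suc n := z))" by auto
    then have "state H n \<omega> = (f(Suc n := z)) n" "state H (Suc n) \<omega> = (f(Suc n := z)) (Suc n)"
      "\<omega> \<in> space (Prob H)" by (auto simp: E_def)
    then show "\<omega> \<in> {\<omega> \<in> space (Prob H). state H n \<omega> = x \<and> state H (Suc n) \<omega> = z}"
      using f(1) by (simp add: S_def)
  qed
  moreover have "disjoint_family_on (\<lambda>f. E (Suc n) (f(Suc n := z))) S"
    using disj sub unfolding disjoint_family_on_def by blast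
  ultimately have 2: "prob {\<omega> \<in> space (Prob H). state H n \<omega> = x \<and> state H (Suc n) \<omega> = z}
      = (\<Sum>f\<in>S. prob (E (Suc n) (f(Suc n := z))))"
    using finite_measure_finite_Union[OF fin, of "\<lambda>f. E (Suc n) (f(Suc n := z))"] E
    by (simp add: image_subset_iff)
  have "prob (E (Suc n) (f(Suc n := z))) = prob (E n f) * tmat H x z" if "f \<in> S" for f
  proof -
    have "(\<Prod>k=1..n. tmat H ((f(Suc n := z)) (k - 1)) ((f(Suc n := z)) k))
        = (\<Prod>k=1..n. tmat H (f (k - 1)) (f k))"
      by (rule prod.cong) auto
    then show ?thesis
      unfolding E_def path_law using that by (simp add: S_def prod.atLeast_Suc_atMost_Suc_shift[symmetric] mult.assoc)
  qed
  then show ?thesis unfolding 1 2 by (simp add: sum_distrib_right)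
qed

definition occ :: "nat \<Rightarrow> 'y \<Rightarrow> real" where
  "occ n y = prob {\<omega> \<in> space (Prob H). state H n \<omega> = y}"

lemma prob_state_in: "prob {\<omega> \<in> space (Prob H). state H n \<omega> \<in> W} = (\<Sum>y\<in>W. occ n y)"
proof -
  have "{\<omega> \<in> space (Prob H). state H n \<omega> \<in> W}
      = (\<Union>y\<in>W. {\<omega> \<in> space (Prob H). state H n \<omega> = y})" by auto
  then show ?thesis
    unfolding occ_def by (simp only:) (rule finite_measure_finite_Union, auto simp: disjoint_family_on_def)
qed

lemma occ_nonneg: "0 \<le> occ n y"
  by (simp add: occ_def)

lemma occ_Suc: "occ (Suc n) z = (\<Sum>x\<in>UNIV. occ n x * tmat H x z)"
proof -
  have "{\<omega> \<in> space (Prob H). state H (Suc n) \<omega> = z}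
      = (\<Union>x\<in>UNIV. {\<omega> \<in> space (Prob H). state H n \<omega> = x \<and> state H (Suc n) \<omega> = z})" by auto
  then have "occ (Suc n) z
      = (\<Sum>x\<in>UNIV. prob {\<omega> \<in> space (Prob H). state H n \<omega> = x \<and> state H (Suc n) \<omega> = z})"
    unfolding occ_def by (simp only:) (rule finite_measure_finite_Union, auto simp: disjoint_family_on_def)
  then show ?thesis by (simp add: transition_law occ_def)
qed

text \<open>The Markov property at time \<open>t\<close>, in the form needed for means: the future
  enters only through \<open>expect_after\<close>.\<close>

lemma occ_add: "(\<Sum>y\<in>UNIV. occ (t + n) y * f y) = (\<Sum>x\<in>UNIV. occ t x * tm.expect_after f n x)"
proof (induction n arbitrary: t)
  case (Suc n)
  have "(\<Sum>y\<in>UNIV. occ (t + Suc n) y * f y) = (\<Sum>x\<in>UNIV. occ (Suc t) x * tm.expect_after f n x)"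
    using Suc[of "Suc t"] by simp
  also have "\<dots> = (\<Sum>x\<in>UNIV. occ t x * tm.expect_after f (Suc n) x)"
    unfolding occ_Suc by (simp add: sum_distrib_left sum_distrib_right mult.assoc) (rule sum.swap)
  finally show ?case .
qed simp

text \<open>Almost surely every step taken has positive transition probability, because there are
  only countably many times and pairs of states; such steps cannot leave a closed set.\<close>

lemma AE_cls_absorbing:
  "AE \<omega> in Prob H. \<forall>k\<in>hyps H. \<forall>n q. n \<le> q \<longrightarrow> state H n \<omega> \<in> cls H k \<longrightarrow> state H q \<omega> \<in> cls H k"
proof -
  have "AE \<omega> in Prob H. tmat H (state H n \<omega>) (state H (Suc n) \<omega>) \<noteq> 0" for n
  proof -
    have "AE \<omega> in Prob H. \<forall>x z. tmat H x z = 0 \<longrightarrow> \<not> (state H n \<omega> = x \<and> state H (Suc n) \<omega> = z)"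
      unfolding AE_all_countable
    proof (intro allI AE_impI)
      fix x z assume "tmat H x z = 0"
      then have "prob {\<omega> \<in> space (Prob H). state H n \<omega> = x \<and> state H (Suc n) \<omega> = z} = 0"
        by (simp add: transition_law)
      then show "AE \<omega> in Prob H. \<not> (state H n \<omega> = x \<and> state H (Suc n) \<omega> = z)"
        by (subst (asm) prob_eq_0) (auto elim!: eventually_mono)
    qed
    then show ?thesis by (auto elim!: eventually_mono)
  qed
  then have "AE \<omega> in Prob H. \<forall>n. tmat H (state H n \<omega>) (state H (Suc n) \<omega>) \<noteq> 0"
    by (simp add: AE_all_countable)
  then show ?thesis
  proof (rule eventually_mono)
    fix \<omega> assume t: "\<forall>n. tmat H (state H n \<omega>) (state H (Suc n) \<omega>) \<noteq> 0"
    show "\<forall>k\<in>hyps H. \<forall>n q. n \<le> q \<longrightarrow> state H n \<omega> \<in> cls H k \<longrightarrow> state H q \<omega> \<in> cls H k"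
    proof (intro ballI allI impI)
      fix k n q assume k: "k \<in> hyps H" and nq: "n \<le> q" and n: "state H n \<omega> \<in> cls H k"
      from nq show "state H q \<omega> \<in> cls H k"
      proof (induction q rule: dec_induct)
        case (step q)
        then show ?case using cls_closed[OF k] t by blast
      qed (rule n)
    qed
  qed
qed

lemma cls_cases:
  obtains "y \<in> cls H 0" | k where "k \<in> hyps H" "y \<in> cls H k" "y \<notin> cls H 0"
  using cls_0 by auto

lemma cls_unique: "y \<in> cls H j \<Longrightarrow> y \<in> cls H k \<Longrightarrow> j \<in> {0..num H} \<Longrightarrow> k \<in> {0..num H} \<Longrightarrow> j = k"
  using disjoint_family_onD[OF cls_disjoint, of j k] cls_0
  by (cases "j = 0"; cases "k = 0") (auto simp: hyps_def)

lemma hyps_le: "i \<in> hyps H \<Longrightarrow> i \<in> {0..num H}" "i \<in> hyps H \<Longrightarrow> i \<noteq> 0"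
  by (auto simp: hyps_def)

text \<open>This removes the infimum and the definite description from \<open>mu\<close>. The
  default value 0 does no harm because \<open>i\<close> is at least 1.\<close>

lemma mu_eq_iff:
  assumes i: "i \<in> hyps H"
  shows "mu H \<omega> = i \<longleftrightarrow> (\<exists>t. state H t \<omega> \<in> cls H i \<and> (\<forall>s<t. state H s \<omega> \<in> cls H 0))"
proof (cases "\<exists>t. state H t \<omega> \<notin> cls H 0")
  case False
  then have "theta H \<omega> = \<infinity>" by (auto simp: theta_def top_enat_def[symmetric])
  then have "mu H \<omega> \<noteq> i" using hyps_le(2)[OF i] by (simp add: mu_def)
  moreover have "state H t \<omega> \<notin> cls H i" for t
    using False cls_unique[of "state H t \<omega>" i 0] hyps_le[OF i] by auto
  ultimately show ?thesis by auto
next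
  case True
  define t where "t = (LEAST t. state H t \<omega> \<notin> cls H 0)"
  have t: "state H t \<omega> \<notin> cls H 0" unfolding t_def using True by (rule LeastI_ex)
  have before: "state H s \<omega> \<in> cls H 0" if "s < t" for s
    using that not_less_Least unfolding t_def by blast
  have th: "theta H \<omega> = enat t"
    unfolding theta_def
  proof (rule antisym)
    show "Inf {enat t |t. state H t \<omega> \<notin> cls H 0} \<le> enat t" using t by (intro Inf_lower) auto
    show "enat t \<le> Inf {enat t |t. state H t \<omega> \<notin> cls H 0}"
    proof (rule Inf_greatest)
      fix e assume "e \<in> {enat t |t. state H t \<omega> \<notin> cls H 0}"
      then obtain s where s: "e = enat s" "state H s \<omega> \<notin> cls H 0" by auto
      then have "t \<le> s" using before[of s] by fastforce
      then show "enat t \<le> e" using s by simp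
    qed
  qed
  obtain k where k: "k \<in> hyps H" "state H t \<omega> \<in> cls H k" using t by (cases "state H t \<omega>" rule: cls_cases) auto
  have uniq: "j = k" if "j \<in> hyps H" "state H t \<omega> \<in> cls H j" for j
    using that k cls_unique hyps_le by blast
  have "(THE j. j \<in> hyps H \<and> state H t \<omega> \<in> cls H j) = k"
    by (rule the_equality) (use k uniq in blast)+
  then have mu: "mu H \<omega> = k" by (simp add: mu_def th)
  show ?thesis
  proof
    assume "mu H \<omega> = i" then show "\<exists>t. state H t \<omega> \<in> cls H i \<and> (\<forall>s<t. state H s \<omega> \<in> cls H 0)"
      using mu k before by auto
  next
    assume "\<exists>t. state H t \<omega> \<in> cls H i \<and> (\<forall>s<t. state H s \<omega> \<in> cls H 0)"
    then obtain s where s: "state H s \<omega> \<in> cls H i" "\<And>r. r < s \<Longrightarrow> state H r \<omega> \<in> cls H 0" by auto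
    have "state H s \<omega> \<notin> cls H 0" using s(1) i cls_0 by auto
    then have "s = t" using s(2)[of t] before[of s] t by (metis linorder_neqE_nat)
    then show "mu H \<omega> = i" using mu uniq[OF i] s by auto
  qed
qed

section \<open>The event that a hypothesis is true, and the law conditioned on it\<close>

definition true_hyp :: "nat \<Rightarrow> 'w set" where
  "true_hyp i = {\<omega> \<in> space (Prob H). mu H \<omega> = i}"

lemma true_hyp_event [measurable]:
  assumes "i \<in> hyps H" shows "true_hyp i \<in> events"
  unfolding true_hyp_def mu_eq_iff[OF assms] by measurable

text \<open>A visit to \<open>cls H i\<close> comes no earlier than the first exit from
  \<open>cls H 0\<close>. That exit leads into some closed class, which still contains the chain at
  the visit, so by disjointness it is \<open>cls H i\<close>.\<close>

lemma AE_in_cls_true_hyp: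
  "AE \<omega> in Prob H. \<forall>i\<in>hyps H. \<forall>n. state H n \<omega> \<in> cls H i \<longrightarrow> \<omega> \<in> true_hyp i"
  using AE_cls_absorbing AE_space
proof eventually_elim
  case (elim \<omega>)
  show ?case
  proof (intro ballI allI impI)
    fix i n assume i: "i \<in> hyps H" and n: "state H n \<omega> \<in> cls H i"
    then have ex: "state H n \<omega> \<notin> cls H 0" using cls_0 by auto
    define t where "t = (LEAST t. state H t \<omega> \<notin> cls H 0)"
    have t: "state H t \<omega> \<notin> cls H 0" unfolding t_def using ex by (rule LeastI)
    have tn: "t \<le> n" unfolding t_def using ex by (rule Least_le)
    obtain k where k: "k \<in> hyps H" "state H t \<omega> \<in> cls H k" using t by (cases "state H t \<omega>" rule: cls_cases) auto
    then have "state H n \<omega> \<in> cls H k" using elim(1) tn by blast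
    then have "k = i" using cls_unique n hyps_le k i by blast
    moreover have "state H s \<omega> \<in> cls H 0" if "s < t" for s
      using that not_less_Least unfolding t_def by blast
    ultimately show "\<omega> \<in> true_hyp i" using k elim(2) mu_eq_iff[OF i] by (auto simp: true_hyp_def)
  qed
qed

lemma AE_true_hyp_state:
  "AE \<omega> in Prob H. \<forall>i\<in>hyps H. \<omega> \<in> true_hyp i \<longrightarrow> (\<forall>n. state H n \<omega> \<in> cls H 0 \<union> cls H i)"
  using AE_in_cls_true_hyp
proof eventually_elim
  case (elim \<omega>)
  show ?case
  proof (intro ballI allI impI)
    fix i n assume i: "i \<in> hyps H" "\<omega> \<in> true_hyp i"
    show "state H n \<omega> \<in> cls H 0 \<union> cls H i"
    proof (cases "state H n \<omega>" rule: cls_cases)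
      case (2 k)
      then have "\<omega> \<in> true_hyp k" using elim by blast
      then show ?thesis using i 2 by (auto simp: true_hyp_def)
    qed auto
  qed
qed

lemma nu_eq: "nu H i = prob (true_hyp i)"
  by (simp add: nu_def true_hyp_def)

lemma cond_law_eq: "cond_law H i = uniform_measure (Prob H) (true_hyp i)"
  by (simp add: cond_law_def true_hyp_def)

lemma space_cond_law [simp]: "space (cond_law H i) = space (Prob H)"
  by (simp add: cond_law_eq)

lemma sets_cond_law [simp, measurable_cong]: "sets (cond_law H i) = events"
  by (simp add: cond_law_eq)

lemma emeasure_true_hyp: "emeasure (Prob H) (true_hyp i) = ennreal (nu H i)"
  by (simp add: nu_eq emeasure_eq_measure)

lemma AE_cond_law: "i \<in> hyps H \<Longrightarrow> (AE \<omega> in cond_law H i. Q \<omega>) \<longleftrightarrow> (AE \<omega> in Prob H. \<omega> \<in> true_hyp i \<longrightarrow> Q \<omega>)"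
  unfolding cond_law_eq using nu_pos[of i]
  by (intro AE_uniform_measure) (auto simp: emeasure_true_hyp)

lemma AE_cond_lawI: "i \<in> hyps H \<Longrightarrow> AE \<omega> in Prob H. Q \<omega> \<Longrightarrow> AE \<omega> in cond_law H i. Q \<omega>"
  by (auto simp: AE_cond_law elim!: eventually_mono)

lemma prob_space_cond_law: "i \<in> hyps H \<Longrightarrow> prob_space (cond_law H i)"
  unfolding cond_law_eq using nu_pos[of i]
  by (intro prob_space_uniform_measure) (auto simp: emeasure_true_hyp)

lemma emeasure_cond_law:
  "i \<in> hyps H \<Longrightarrow> A \<in> events \<Longrightarrow> emeasure (cond_law H i) A = ennreal (prob (true_hyp i \<inter> A) / nu H i)"
  using nu_pos[of i] unfolding cond_law_eq
  by (subst emeasure_uniform_measure) (auto simp: nu_eq emeasure_eq_measure divide_ennreal)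

lemma nn_integral_cond_law:
  assumes "i \<in> hyps H" "f \<in> borel_measurable (Prob H)"
  shows "(\<integral>\<^sup>+\<omega>. f \<omega> \<partial>cond_law H i) = (\<integral>\<^sup>+\<omega>. f \<omega> * indicator (true_hyp i) \<omega> \<partial>Prob H) / ennreal (nu H i)"
  unfolding cond_law_eq using assms
  by (subst nn_integral_uniform_measure) (auto simp: emeasure_true_hyp)

subsection \<open>The observation filtration and posterior probabilities\<close>

abbreviation \<F> :: "nat \<Rightarrow> 'w measure" where
  "\<F> n \<equiv> obs_filtration H (enat n)"

lemma filtration_generators:
  "{obs H n -` A \<inter> space (Prob H) | n A. 1 \<le> n \<and> enat n \<le> t \<and> A \<in> sets (Obs H)} \<subseteq> events"
  using measurable_sets[OF obs_measurable] by auto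

lemma space_filtration [simp]: "space (obs_filtration H t) = space (Prob H)"
  unfolding obs_filtration_def using filtration_generators[of t] sets.space_closed
  by (intro space_measure_of) (auto 0 3)

lemma sets_filtration:
  "sets (obs_filtration H t) = sigma_sets (space (Prob H))
    {obs H n -` A \<inter> space (Prob H) | n A. 1 \<le> n \<and> enat n \<le> t \<and> A \<in> sets (Obs H)}"
  unfolding obs_filtration_def using filtration_generators[of t] sets.space_closed
  by (intro sets_measure_of) (auto 0 3)

lemma subalgebra_filtration: "subalgebra (Prob H) (obs_filtration H t)"
  unfolding subalgebra_def sets_filtration
  using sets.sigma_sets_subset[OF filtration_generators] by auto

lemma filtration_obs: "filtration (space (Prob H)) (obs_filtration H)"
proof
  show "sets (obs_filtration H s) \<subseteq> sets (obs_filtration H t)" if "s \<le> t" for s t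
    unfolding sets_filtration by (rule sigma_sets_mono') (use that in \<open>auto intro: order_trans\<close>)
qed simp

interpretation flt: filtration "space (Prob H)" "obs_filtration H" by (rule filtration_obs)

lemma sets_filtration_mono: "n \<le> q \<Longrightarrow> A \<in> sets (\<F> n) \<Longrightarrow> A \<in> sets (\<F> q)"
  using filtration.sets_F_mono[OF filtration_obs, of "enat n" "enat q"] by auto

lemma filtration_event: "A \<in> sets (obs_filtration H t) \<Longrightarrow> A \<in> events"
  using subalgebra_filtration[of t] by (auto simp: subalgebra_def)

definition in_cls :: "nat \<Rightarrow> nat \<Rightarrow> 'w set" where
  "in_cls i n = {\<omega> \<in> space (Prob H). state H n \<omega> \<in> cls H i}"

lemma in_cls_event [measurable]: "in_cls i n \<in> events"
  unfolding in_cls_def by measurable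

lemma post_measurable_filtration: "post H i n \<in> borel_measurable (\<F> n)"
  by (simp add: post_def)

lemma post_measurable [measurable]: "post H i n \<in> borel_measurable (Prob H)"
  by (rule measurable_from_subalg[OF subalgebra_filtration post_measurable_filtration])

lemma fm_filtration: "finite_measure_subalgebra (Prob H) (obs_filtration H t)"
  by (simp add: finite_measure_subalgebra_axioms_def finite_measure_subalgebra_def
      finite_measure_axioms subalgebra_filtration)

lemma integrable_in_cls: "integrable (Prob H) (indicat_real (in_cls i n))"
  by (intro integrable_real_indicator) (auto simp: emeasure_eq_measure)

lemma post_eq: "post H i n = real_cond_exp (Prob H) (\<F> n) (indicat_real (in_cls i n))"
  by (simp add: post_def in_cls_def)

lemma post_nonneg: "AE \<omega> in Prob H. 0 \<le> post H i n \<omega>"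
proof -
  interpret s: finite_measure_subalgebra "Prob H" "\<F> n" by (rule fm_filtration)
  show ?thesis unfolding post_eq by (rule s.real_cond_exp_pos) auto
qed

lemma integrable_post: "integrable (Prob H) (post H i n)"
proof -
  interpret s: finite_measure_subalgebra "Prob H" "\<F> n" by (rule fm_filtration)
  show ?thesis unfolding post_eq by (rule s.real_cond_exp_int[OF integrable_in_cls])
qed

lemma prob_in_cls_post:
  assumes "A \<in> sets (\<F> n)"
  shows "prob (A \<inter> in_cls i n) = (\<integral>\<omega>\<in>A. post H i n \<omega> \<partial>Prob H)"
proof -
  interpret s: finite_measure_subalgebra "Prob H" "\<F> n" by (rule fm_filtration)
  have [measurable]: "A \<in> events" by (rule filtration_event[OF assms])
  have "(\<integral>\<omega>\<in>A. indicat_real (in_cls i n) \<omega> \<partial>Prob H) = prob (A \<inter> in_cls i n)"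
    unfolding set_lebesgue_integral_def by (simp add: indicator_inter_arith[symmetric])
  then show ?thesis
    unfolding post_eq using s.real_cond_exp_intA[OF integrable_in_cls assms] by simp
qed

text \<open>The change of measure in its elementary form: integrating a posterior over an event of
  the filtration gives the probability of the class, so a pointwise comparison of posteriors becomes
  a comparison of probabilities.\<close>

lemma prob_in_cls_mono_post:
  assumes A: "A \<in> sets (\<F> n)"
    and le: "AE \<omega> in Prob H. \<omega> \<in> A \<longrightarrow> post H i n \<omega> \<le> r * post H j n \<omega>"
  shows "prob (A \<inter> in_cls i n) \<le> r * prob (A \<inter> in_cls j n)"
proof -
  have [measurable]: "A \<in> events" by (rule filtration_event[OF A])
  have int: "integrable (Prob H) (\<lambda>\<omega>. indicator A \<omega> * post H k n \<omega>)" for k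
    using integrable_real_mult_indicator[OF \<open>A \<in> events\<close> integrable_post[of k n]]
    by (simp add: mult.commute)
  have "(\<integral>\<omega>. indicator A \<omega> * post H i n \<omega> \<partial>Prob H)
      \<le> (\<integral>\<omega>. r * (indicator A \<omega> * post H j n \<omega>) \<partial>Prob H)"
    by (intro integral_mono_AE int integrable_mult_right)
       (use le in \<open>auto elim!: eventually_mono split: split_indicator\<close>)
  then show ?thesis
    unfolding prob_in_cls_post[OF A] by (simp add: set_lebesgue_integral_def)
qed

lemma elog_measurable [measurable]: "elog \<in> borel_measurable borel"
  unfolding elog_def by measurable

lemma Lam_measurable_filtration: "Lam H i j n \<in> borel_measurable (\<F> n)"
proof -
  note [measurable] = post_measurable_filtration borel_measurable_ereal_divide
  show ?thesis unfolding Lam_def by measurable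
qed

lemma Lam_measurable [measurable]: "Lam H i j n \<in> borel_measurable (Prob H)"
  by (rule measurable_from_subalg[OF subalgebra_filtration Lam_measurable_filtration])

subsection \<open>Moments of the accumulated cost\<close>

lemma measurable_of_state:
  "(\<lambda>\<omega>. f (state H n \<omega>)) \<in> measurable (Prob H) borel" for f :: "'y \<Rightarrow> 'b::topological_space"
  by (rule measurable_compose[OF state_measurable]) simp

lemma cost_measurable [measurable]: "cost H c K \<in> borel_measurable (Prob H)"
  unfolding cost_def by (intro borel_measurable_sum measurable_of_state)

lemma stopped_cost_measurable [measurable]:
  assumes "\<tau> \<in> measurable (Prob H) (count_space UNIV)"
  shows "(\<lambda>\<omega>. stopped_cost H c (\<tau> \<omega>) \<omega>) \<in> borel_measurable (Prob H)"
proof -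
  have "(\<lambda>\<omega>. if enat t < \<tau> \<omega> then 1 else 0 :: ennreal) \<in> borel_measurable (Prob H)" for t
    by (rule measurable_compose[OF assms]) simp
  then show ?thesis
    unfolding stopped_cost_def
    by (intro borel_measurable_suminf_order borel_measurable_times_ennreal measurable_of_state)
qed

lemma nn_integral_of_state:
  assumes "\<And>y. 0 \<le> f y"
  shows "(\<integral>\<^sup>+\<omega>. ennreal (f (state H n \<omega>)) \<partial>Prob H) = ennreal (\<Sum>y\<in>UNIV. occ n y * f y)"
proof -
  have "ennreal (f (state H n \<omega>)) = (\<Sum>y\<in>UNIV. ennreal (f y) * indicator {\<omega> \<in> space (Prob H). state H n \<omega> = y} \<omega>)"
    if "\<omega> \<in> space (Prob H)" for \<omega>
  proof -
    have "(\<Sum>y\<in>UNIV. ennreal (f y) * indicator {\<omega> \<in> space (Prob H). state H n \<omega> = y} \<omega>)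
        = (\<Sum>y\<in>UNIV. if y = state H n \<omega> then ennreal (f y) else 0)"
      by (rule sum.cong) (use that in auto)
    then show ?thesis by simp
  qed
  then have "(\<integral>\<^sup>+\<omega>. ennreal (f (state H n \<omega>)) \<partial>Prob H)
      = (\<integral>\<^sup>+\<omega>. (\<Sum>y\<in>UNIV. ennreal (f y) * indicator {\<omega> \<in> space (Prob H). state H n \<omega> = y} \<omega>) \<partial>Prob H)"
    by (rule nn_integral_cong)
  also have "\<dots> = (\<Sum>y\<in>UNIV. ennreal (f y) * emeasure (Prob H) {\<omega> \<in> space (Prob H). state H n \<omega> = y})"
    by (subst nn_integral_sum) (auto simp: nn_integral_cmult_indicator)
  also have "\<dots> = (\<Sum>y\<in>UNIV. ennreal (occ n y * f y))"
    by (simp add: occ_def emeasure_eq_measure ennreal_mult assms mult.commute)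
  finally show ?thesis by (simp add: sum_ennreal assms occ_nonneg)
qed

text \<open>The tangent bound \<open>x powr m \<ge> x - 1\<close>, scaled, turns a linear lower bound on the mean into
  one on the \<open>m\<close>-th moment.\<close>

lemma moment_lower_bound:
  assumes N: "prob_space N" and X: "X \<in> borel_measurable N" "\<And>\<omega>. 0 \<le> X \<omega>"
    and m: "1 \<le> m" and a: "0 < a" and mean: "ennreal (2 * a) \<le> (\<integral>\<^sup>+\<omega>. ennreal (X \<omega>) \<partial>N)"
  shows "ennreal (a powr m) \<le> (\<integral>\<^sup>+\<omega>. ennreal (X \<omega> powr m) \<partial>N)"
proof -
  interpret N: prob_space N by fact
  note [measurable] = X(1)
  have pt: "a powr m / a * x \<le> x powr m + a powr m" if x: "0 \<le> x" for x
  proof (cases "x \<le> a")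
    case True
    then have "a powr m / a * x \<le> a powr m / a * a" using a by (intro mult_left_mono) auto
    then show ?thesis using a by (simp add: add_increasing)
  next
    case False
    then have x0: "0 < x" "a \<le> x" using a by auto
    have "a powr (m - 1) * x \<le> x powr (m - 1) * x"
      using m a x0 by (intro mult_right_mono powr_mono2) auto
    then have "a powr m / a * x \<le> x powr m"
      using a x0 by (simp add: powr_diff)
    then show ?thesis by (simp add: add_increasing2)
  qed
  \<comment> \<open>A mean of at least \<open>2 * a\<close> yields \<open>a powr m\<close> twice;
    one copy pays for the additive term of \<open>pt\<close>, the other remains.\<close>
  have "ennreal (2 * a powr m) = ennreal (a powr m / a) * ennreal (2 * a)"
    using a by (subst ennreal_mult[symmetric]) auto
  also have "\<dots> \<le> ennreal (a powr m / a) * (\<integral>\<^sup>+\<omega>. ennreal (X \<omega>) \<partial>N)"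
    by (intro mult_left_mono mean) auto
  also have "\<dots> = (\<integral>\<^sup>+\<omega>. ennreal (a powr m / a * X \<omega>) \<partial>N)"
    using a X(2)
    by (subst nn_integral_cmult[symmetric]) (auto simp: ennreal_mult[symmetric] intro!: nn_integral_cong)
  also have "\<dots> \<le> (\<integral>\<^sup>+\<omega>. ennreal (X \<omega> powr m) + ennreal (a powr m) \<partial>N)"
    using pt X(2) by (intro nn_integral_mono) (simp add: ennreal_plus[symmetric] ennreal_leI del: ennreal_plus)
  also have "\<dots> = (\<integral>\<^sup>+\<omega>. ennreal (X \<omega> powr m) \<partial>N) + ennreal (a powr m)"
    by (subst nn_integral_add) (auto simp: N.emeasure_space_1)
  finally have "ennreal (a powr m) + ennreal (a powr m) \<le> (\<integral>\<^sup>+\<omega>. ennreal (X \<omega> powr m) \<partial>N) + ennreal (a powr m)"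
    by (simp add: ennreal_plus[symmetric] del: ennreal_plus)
  then show ?thesis
    by (cases "\<integral>\<^sup>+\<omega>. ennreal (X \<omega> powr m) \<partial>N") (auto simp: ennreal_plus[symmetric] ennreal_le_iff simp del: ennreal_plus)
qed

lemma occ_sum_eq: "(\<Sum>y\<in>W. occ n y) = (\<Sum>x\<in>UNIV. occ 0 x * tm.expect_after (indicator W) n x)"
  using occ_add[of 0 n "indicator W"] by (simp add: indicator_def if_distrib sum.If_cases)

lemma occ_sum_decseq:
  assumes "tm.closed_set (- W)"
  shows "decseq (\<lambda>n. \<Sum>y\<in>W. occ n y)"
  using tm.survival_decseq[OF assms] unfolding decseq_def occ_sum_eq
  by (auto intro!: sum_mono mult_left_mono simp: occ_nonneg)

lemma occ_transient_0: "(\<lambda>n. \<Sum>y\<in>cls H 0. occ n y) \<longlonglongrightarrow> 0"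
proof -
  have "tm.closed_set (- cls H 0)"
    unfolding tm.closed_set_def cls_0 using cls_closed by auto
  then have "(\<lambda>n. \<Sum>x\<in>UNIV. occ 0 x * tm.expect_after (indicator (cls H 0)) n x) \<longlonglongrightarrow> (\<Sum>x\<in>(UNIV::'y set). occ 0 x * 0)"
    by (intro tendsto_intros tm.transient_set_left cls_0_transient)
  then show ?thesis by (simp add: occ_sum_eq)
qed

text \<open>States from which no cost can be incurred any more form a closed set; \<open>costly c i\<close> consists
  of the other states compatible with the hypothesis \<open>i\<close>.\<close>

definition costly :: "('y \<Rightarrow> real) \<Rightarrow> nat \<Rightarrow> 'y set" where
  "costly c i = cls H 0 \<union>
    {x \<in> cls H i. \<exists>n. tm.expect_after (\<lambda>y. c y * indicator (cls H i) y) n x \<noteq> 0}"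

lemma cost_0_outside_costly:
  "y \<in> cls H 0 \<union> cls H i \<Longrightarrow> y \<notin> costly c i \<Longrightarrow> c y = 0"
  unfolding costly_def by (auto dest: spec[of _ 0])

text \<open>A state \<open>x\<close> outside \<open>costly c i\<close> lies in some closed class
  \<open>cls H k\<close>, so a costly successor \<open>z\<close> would lie there too, which forces
  \<open>k = i\<close>. A positive expected cost seen from \<open>z\<close> after \<open>n\<close>
  steps would then be seen from \<open>x\<close> after \<open>n + 1\<close> steps.\<close>

lemma costly_complement_closed:
  assumes c: "\<And>y. 0 \<le> c y" and i: "i \<in> hyps H"
  shows "tm.closed_set (- costly c i)"
  unfolding tm.closed_set_def
proof (intro ballI allI impI)
  fix x z assume x: "x \<in> - costly c i" and z: "z \<notin> - costly c i"
  let ?f = "\<lambda>y. c y * indicator (cls H i) y"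
  obtain k where k: "k \<in> hyps H" "x \<in> cls H k"
    using x by (cases x rule: cls_cases) (auto simp: costly_def)
  show "tmat H x z = 0"
  proof (cases "z \<in> cls H k")
    case False
    then show ?thesis using cls_closed k by blast
  next
    case True
    have "z \<notin> cls H 0" using True cls_0 k by auto
    then have zi: "z \<in> cls H i" and "\<exists>n. tm.expect_after ?f n z \<noteq> 0"
      using z by (auto simp: costly_def)
    then obtain n where n: "tm.expect_after ?f n z \<noteq> 0" by auto
    have "k = i" using True zi cls_unique hyps_le i k by blast
    then have "tm.expect_after ?f (Suc n) x = 0" using x k by (auto simp: costly_def simp del: tm.expect_after.simps)
    then have "tmat H x z * tm.expect_after ?f n z = 0"
      by (simp, subst (asm) sum_nonneg_eq_0_iff)
         (auto intro!: mult_nonneg_nonneg tm.expect_after_nonneg tmat_stochastic c)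
    then show ?thesis using n by simp
  qed
qed

text \<open>Conditioning divides by \<open>nu H i \<le> 1\<close>, so lower bounds for the integral
  over \<open>true_hyp i\<close> carry over unchanged.\<close>

lemma nn_integral_cond_law_ge:
  assumes i: "i \<in> hyps H" and f [measurable]: "f \<in> borel_measurable (Prob H)"
    and le: "ennreal v \<le> (\<integral>\<^sup>+\<omega>. f \<omega> * indicator (true_hyp i) \<omega> \<partial>Prob H)" and "0 \<le> v"
  shows "ennreal v \<le> (\<integral>\<^sup>+\<omega>. f \<omega> \<partial>cond_law H i)"
proof -
  have "nu H i \<le> 1" by (simp add: nu_eq)
  then have "ennreal v \<le> ennreal v / ennreal (nu H i)"
    using nu_pos[OF i] \<open>0 \<le> v\<close> by (simp add: divide_ennreal ennreal_leI pos_le_divide_eq mult_left_le)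
  also have "\<dots> \<le> (\<integral>\<^sup>+\<omega>. f \<omega> * indicator (true_hyp i) \<omega> \<partial>Prob H) / ennreal (nu H i)"
    by (intro divide_right_mono_ennreal le)
  finally show ?thesis by (simp add: nn_integral_cond_law i)
qed

text \<open>Costs incurred inside \<open>cls H i\<close> are incurred on \<open>true_hyp i\<close>,
  so their unconditional mean can be computed from \<open>occ\<close> alone.\<close>

lemma mean_cost_ge:
  assumes c: "\<And>y. 0 \<le> c y" and i: "i \<in> hyps H"
  shows "ennreal (\<Sum>t<n. \<Sum>y\<in>UNIV. occ t y * (c y * indicator (cls H i) y))
    \<le> (\<integral>\<^sup>+\<omega>. ennreal (cost H c n \<omega>) \<partial>cond_law H i)"
proof (rule nn_integral_cond_law_ge[OF i])
  let ?f = "\<lambda>y. c y * indicator (cls H i) y"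
  show "0 \<le> (\<Sum>t<n. \<Sum>y\<in>UNIV. occ t y * ?f y)"
    by (intro sum_nonneg mult_nonneg_nonneg occ_nonneg c) auto
  show "(\<lambda>\<omega>. ennreal (cost H c n \<omega>)) \<in> borel_measurable (Prob H)" by measurable
  have "ennreal (\<Sum>t<n. \<Sum>y\<in>UNIV. occ t y * ?f y) = (\<Sum>t<n. ennreal (\<Sum>y\<in>UNIV. occ t y * ?f y))"
    by (intro sum_ennreal[symmetric] sum_nonneg mult_nonneg_nonneg occ_nonneg c) auto
  also have "\<dots> = (\<Sum>t<n. \<integral>\<^sup>+\<omega>. ennreal (?f (state H t \<omega>)) \<partial>Prob H)"
    using c by (subst nn_integral_of_state) auto
  also have "\<dots> = (\<integral>\<^sup>+\<omega>. (\<Sum>t<n. ennreal (?f (state H t \<omega>))) \<partial>Prob H)"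
    by (rule nn_integral_sum[symmetric]) (intro measurable_of_state)
  also have "\<dots> \<le> (\<integral>\<^sup>+\<omega>. ennreal (cost H c n \<omega>) * indicator (true_hyp i) \<omega> \<partial>Prob H)"
  proof (rule nn_integral_mono_AE)
    show "AE \<omega> in Prob H. (\<Sum>t<n. ennreal (?f (state H t \<omega>))) \<le> ennreal (cost H c n \<omega>) * indicator (true_hyp i) \<omega>"
      using AE_in_cls_true_hyp
    proof eventually_elim
      case (elim \<omega>)
      then have "?f (state H t \<omega>) \<le> c (state H t \<omega>) * indicator (true_hyp i) \<omega>" for t
        using i c by (auto split: split_indicator)
      then have "(\<Sum>t<n. ?f (state H t \<omega>)) \<le> cost H c n \<omega> * indicator (true_hyp i) \<omega>"
        unfolding cost_def sum_distrib_right by (intro sum_mono)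
      then have "ennreal (\<Sum>t<n. ?f (state H t \<omega>)) \<le> ennreal (cost H c n \<omega> * indicator (true_hyp i) \<omega>)"
        by (rule ennreal_leI)
      then show ?case by (subst sum_ennreal) (auto simp: c split: split_indicator)
    qed
  qed
  finally show "ennreal (\<Sum>t<n. \<Sum>y\<in>UNIV. occ t y * ?f y)
      \<le> (\<integral>\<^sup>+\<omega>. ennreal (cost H c n \<omega>) * indicator (true_hyp i) \<omega> \<partial>Prob H)" .
qed

text \<open>From some time on the chain is in \<open>costly c i - cls H 0\<close> with probability
  at least \<open>\<alpha>/2\<close>. Each of these finitely many states has positive expected cost
  within a common number \<open>N\<close> of steps. Adding up the windows of length \<open>N\<close>
  over all starting times counts every cost at most \<open>N\<close> times.\<close>

lemma mean_cost_linear: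
  assumes c: "\<And>y. 0 \<le> c y" and i: "i \<in> hyps H" and \<alpha>: "0 < \<alpha>" "\<And>n. \<alpha> \<le> (\<Sum>y\<in>costly c i. occ n y)"
  shows "\<exists>\<kappa>>0. \<exists>n0. \<forall>n\<ge>n0.
    ennreal (\<kappa> * real n) \<le> (\<integral>\<^sup>+\<omega>. ennreal (cost H c n \<omega>) \<partial>cond_law H i)"
proof -
  let ?f = "\<lambda>y. c y * indicator (cls H i) y"
  let ?D = "costly c i - cls H 0"
  have f0: "0 \<le> ?f y" for y using c by auto
  note ea_nn = tm.expect_after_nonneg[of ?f, OF f0]
  define e where "e t = (\<Sum>y\<in>UNIV. occ t y * ?f y)" for t
  have e0: "0 \<le> e t" for t unfolding e_def by (intro sum_nonneg mult_nonneg_nonneg occ_nonneg f0)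
  have "\<forall>\<^sub>F n in sequentially. (\<Sum>y\<in>cls H 0. occ n y) < \<alpha>/2"
    using \<alpha>(1) by (intro order_tendstoD(2)[OF occ_transient_0]) simp
  then obtain t0 where t0: "\<And>n. t0 \<le> n \<Longrightarrow> (\<Sum>y\<in>cls H 0. occ n y) < \<alpha>/2"
    by (auto simp: eventually_sequentially)
  have D: "\<alpha>/2 \<le> (\<Sum>y\<in>?D. occ n y)" if "t0 \<le> n" for n
  proof -
    have "(\<Sum>y\<in>costly c i. occ n y) = (\<Sum>y\<in>?D. occ n y) + (\<Sum>y\<in>cls H 0. occ n y)"
      by (rule sum.subset_diff) (auto simp: costly_def)
    then show ?thesis using t0[OF that] \<alpha>(2)[of n] by simp
  qed
  have "\<forall>x\<in>?D. \<exists>n. tm.expect_after ?f n x \<noteq> 0" by (auto simp: costly_def)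
  then obtain nx where nx: "\<And>x. x \<in> ?D \<Longrightarrow> tm.expect_after ?f (nx x) x \<noteq> 0" by metis
  define N where "N = Suc (Max (range nx))"
  have nxN: "nx x < N" for x by (auto simp: N_def less_Suc_eq_le)
  define U where "U x = (\<Sum>s<N. tm.expect_after ?f s x)" for x
  have U0: "0 \<le> U x" for x unfolding U_def by (intro sum_nonneg ea_nn)
  have UD: "0 < U x" if "x \<in> ?D" for x
  proof -
    have "tm.expect_after ?f (nx x) x \<le> U x"
      unfolding U_def using nxN ea_nn by (intro member_le_sum) auto
    then show ?thesis using nx[OF that] ea_nn[of "nx x" x] by linarith
  qed
  have Dne: "?D \<noteq> {}"
  proof
    assume e: "?D = {}"
    show False using D[OF order_refl] \<alpha>(1) unfolding e by simp
  qed
  define \<kappa>0 where "\<kappa>0 = Min (U ` ?D)"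
  have \<kappa>0: "0 < \<kappa>0" unfolding \<kappa>0_def using Dne UD by (subst Min_gr_iff) auto
  have U\<kappa>: "\<kappa>0 \<le> U x" if "x \<in> ?D" for x unfolding \<kappa>0_def using that by (intro Min_le) auto
  define \<kappa>1 where "\<kappa>1 = \<kappa>0 * (\<alpha>/2)"
  have block: "\<kappa>1 \<le> (\<Sum>s<N. e (t + s))" if "t0 \<le> t" for t
  proof -
    have "\<kappa>1 \<le> \<kappa>0 * (\<Sum>x\<in>?D. occ t x)"
      unfolding \<kappa>1_def using \<kappa>0 D[OF that] by (intro mult_left_mono) auto
    also have "\<dots> \<le> (\<Sum>x\<in>?D. occ t x * U x)"
      unfolding sum_distrib_left by (intro sum_mono) (simp add: mult.commute mult_right_mono occ_nonneg U\<kappa>)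
    also have "\<dots> \<le> (\<Sum>x\<in>UNIV. occ t x * U x)"
      by (intro sum_mono2) (auto intro!: mult_nonneg_nonneg occ_nonneg U0)
    also have "\<dots> = (\<Sum>s<N. e (t + s))"
      unfolding e_def occ_add U_def sum_distrib_left by (rule sum.swap)
    finally show ?thesis .
  qed
  have lin: "real (n - t0) * \<kappa>1 \<le> real N * (\<Sum>t<n + N. e t)" if "t0 \<le> n" for n
  proof -
    have "real (n - t0) * \<kappa>1 = (\<Sum>t\<in>{t0..<n}. \<kappa>1)" by simp
    also have "\<dots> \<le> (\<Sum>t\<in>{t0..<n}. \<Sum>s<N. e (t + s))" by (intro sum_mono block) auto
    also have "\<dots> = (\<Sum>s<N. \<Sum>t\<in>{t0..<n}. e (t + s))" by (rule sum.swap)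
    also have "\<dots> \<le> (\<Sum>s<N. \<Sum>t<n + N. e t)"
    proof (rule sum_mono)
      fix s assume s: "s \<in> {..<N}"
      have "(\<Sum>t\<in>{t0..<n}. e (t + s)) = (\<Sum>t\<in>{t0+s..<n+s}. e t)"
        by (rule sum.shift_bounds_nat_ivl[symmetric])
      also have "\<dots> \<le> (\<Sum>t<n + N. e t)" using s by (intro sum_mono2 e0) auto
      finally show "(\<Sum>t\<in>{t0..<n}. e (t + s)) \<le> (\<Sum>t<n + N. e t)" .
    qed
    finally show ?thesis by simp
  qed
  have N0: "0 < N" by (simp add: N_def)
  have \<kappa>1: "0 < \<kappa>1" using \<kappa>0 \<alpha> by (simp add: \<kappa>1_def)
  show ?thesis
  proof (intro exI[of _ "\<kappa>1 / (2 * real N)"] conjI exI[of _ "2 * (t0 + N)"] allI impI)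
    show "0 < \<kappa>1 / (2 * real N)" using \<kappa>1 N0 by simp
    fix n assume n: "2 * (t0 + N) \<le> n"
    \<comment> \<open>The requirement \<open>n \<ge> 2 * (t0 + N)\<close> leaves at least
      \<open>n / 2\<close> starting times.\<close>
    have "real n / 2 * \<kappa>1 \<le> real (n - N - t0) * \<kappa>1"
      using n \<kappa>1 by (intro mult_right_mono) auto
    also have "\<dots> \<le> real N * (\<Sum>t<n. e t)" using lin[of "n - N"] n by simp
    finally have "\<kappa>1 / (2 * real N) * real n \<le> (\<Sum>t<n. e t)" using N0 by (simp add: field_simps)
    then have "ennreal (\<kappa>1 / (2 * real N) * real n) \<le> ennreal (\<Sum>t<n. e t)" by (rule ennreal_leI)
    also have "\<dots> \<le> (\<integral>\<^sup>+\<omega>. ennreal (cost H c n \<omega>) \<partial>cond_law H i)"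
      unfolding e_def by (rule mean_cost_ge[OF c i])
    finally show "ennreal (\<kappa>1 / (2 * real N) * real n) \<le> (\<integral>\<^sup>+\<omega>. ennreal (cost H c n \<omega>) \<partial>cond_law H i)" .
  qed
qed

text \<open>If the probability of being in a costly state tends to 0, it does so geometrically.
  Summing over the possible last costly times after \<open>K\<close> then gives the remainder of a
  convergent series, uniformly bounding what the total cost adds to the cost up to
  \<open>K\<close>.\<close>

lemma total_cost_tail:
  assumes c: "\<And>y. 0 \<le> c y" and i: "i \<in> hyps H" and m: "1 \<le> m"
    and lim: "(\<lambda>n. \<Sum>y\<in>costly c i. occ n y) \<longlonglongrightarrow> 0"
  shows "\<exists>tail :: nat \<Rightarrow> real. tail \<longlonglongrightarrow> 0 \<and> (\<forall>K. 0 \<le> tail K \<and>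
    (\<integral>\<^sup>+\<omega>. epowr (stopped_cost H c \<infinity> \<omega>) m \<partial>cond_law H i)
      \<le> (\<integral>\<^sup>+\<omega>. ennreal (cost H c K \<omega> powr m) \<partial>cond_law H i) + ennreal (tail K))"
proof -
  let ?W = "costly c i"
  note closed = costly_complement_closed[of c i, OF c i]
  define a where "a n = (\<Sum>y\<in>?W. occ n y)" for n
  have a0: "0 \<le> a n" for n unfolding a_def by (intro sum_nonneg occ_nonneg)
  have a_dec: "decseq a" unfolding a_def by (rule occ_sum_decseq[OF closed])
  obtain N where N: "0 < N" "\<And>x n. (\<lambda>n. tm.expect_after (indicator ?W) n x) \<longlonglongrightarrow> 0 \<Longrightarrow>
      tm.expect_after (indicator ?W) (N * n) x \<le> (1/2) ^ n"
    using tm.survival_geometric[OF closed] by blast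
  have aN: "a (N * n) \<le> (1/2) ^ n" for n
  proof -
    \<comment> \<open>\<open>survival_geometric\<close> needs starting states whose survival
      probability tends to 0. Every state of positive initial probability is one, because the
      average \<open>a\<close> tends to 0; the others have weight 0.\<close>
    have "occ 0 x * tm.expect_after (indicator ?W) (N * n) x \<le> occ 0 x * (1/2) ^ n" for x
    proof (cases "occ 0 x = 0")
      case False
      then have pos: "0 < occ 0 x" using occ_nonneg[of 0 x] by simp
      have "(\<lambda>n. tm.expect_after (indicator ?W) n x) \<longlonglongrightarrow> 0"
      proof (rule tendsto_sandwich[OF _ _ tendsto_const])
        show "\<forall>\<^sub>F n in sequentially. 0 \<le> tm.expect_after (indicator ?W) n x"
          by (intro always_eventually allI tm.expect_after_nonneg) simp
        show "\<forall>\<^sub>F n in sequentially. tm.expect_after (indicator ?W) n x \<le> a n / occ 0 x"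
        proof (intro always_eventually allI)
          fix n
          have "occ 0 x * tm.expect_after (indicator ?W) n x \<le> a n"
            unfolding a_def occ_sum_eq
            by (rule member_le_sum) (auto intro!: mult_nonneg_nonneg occ_nonneg tm.expect_after_nonneg)
          then show "tm.expect_after (indicator ?W) n x \<le> a n / occ 0 x" using pos by (simp add: field_simps)
        qed
        show "(\<lambda>n. a n / occ 0 x) \<longlonglongrightarrow> 0"
          using tendsto_divide[OF lim tendsto_const[of "occ 0 x"]] pos by (simp add: a_def)
      qed
      then show ?thesis using N(2) by (intro mult_left_mono occ_nonneg)
    qed simp
    then have "a (N * n) \<le> (\<Sum>x\<in>(UNIV::'y set). occ 0 x * (1/2) ^ n)"
      unfolding a_def occ_sum_eq by (intro sum_mono)
    also have "\<dots> = (\<Sum>x\<in>UNIV. occ 0 x) * (1/2) ^ n"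
      by (rule sum_distrib_right[symmetric])
    also have "(\<Sum>x\<in>UNIV. occ 0 x) = 1" using prob_state_in[of 0 UNIV] by (simp add: prob_space)
    finally show ?thesis by simp
  qed
  define C where "C = Max (range c)"
  have C: "c y \<le> C" for y unfolding C_def by (rule Max_ge) auto
  have C0: "0 \<le> C" using C[of undefined] c[of undefined] by simp
  define g where "g t = (C * real (t + 1)) powr m * a t" for t
  have g: "summable g" unfolding g_def by (rule summable_moment_geometric[OF N(1) a0 a_dec aN C0])
  \<comment> \<open>The exponent 0 gives summability of \<open>a\<close> itself, as Borel-Cantelli
    requires.\<close>
  have "summable (\<lambda>t. (1 * real (t + 1)) powr 0 * a t)"
    by (rule summable_moment_geometric[OF N(1) a0 a_dec aN]) simp
  then have a_sum: "summable a" by simp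
  have g0: "0 \<le> g t" for t by (simp add: g_def a0)
  have nu: "0 < nu H i" by (rule nu_pos[OF i])
  \<comment> \<open>The division by \<open>nu H i\<close> comes from replacing the conditional law
    by \<open>Prob H\<close>.\<close>
  define tail where "tail K = (\<Sum>t. g (t + K)) / nu H i" for K
  have ev: "AE \<omega> in Prob H. \<forall>\<^sub>F t in sequentially. state H t \<omega> \<notin> ?W"
  proof -
    have "AE \<omega> in Prob H. \<forall>\<^sub>F n in sequentially. \<omega> \<in> space (Prob H) - {\<omega> \<in> space (Prob H). state H n \<omega> \<in> ?W}"
    proof (rule borel_cantelli_AE1)
      show "summable (\<lambda>n. prob {\<omega> \<in> space (Prob H). state H n \<omega> \<in> ?W})"
        using a_sum by (simp add: prob_state_in a_def[abs_def])
    qed (auto simp: emeasure_eq_measure)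
    then show ?thesis using AE_space
      by eventually_elim (auto elim!: eventually_mono)
  qed
  let ?h = "\<lambda>K t \<omega>. ennreal ((C * real (t + K + 1)) powr m) * (if state H (t + K) \<omega> \<in> ?W then 1 else 0)"
  have pt: "AE \<omega> in cond_law H i. epowr (stopped_cost H c \<infinity> \<omega>) m
      \<le> ennreal (cost H c K \<omega> powr m) + (\<Sum>t. ?h K t \<omega>)" for K
    unfolding AE_cond_law[OF i] using ev AE_true_hyp_state
  proof eventually_elim
    case (elim \<omega>)
    show ?case
    proof
      assume "\<omega> \<in> true_hyp i"
      then have "state H t \<omega> \<notin> ?W \<Longrightarrow> c (state H t \<omega>) = 0" for t
        using elim(2) i cost_0_outside_costly[of "state H t \<omega>" i c] by blast
      then show "epowr (stopped_cost H c \<infinity> \<omega>) m \<le> ennreal (cost H c K \<omega> powr m) + (\<Sum>t. ?h K t \<omega>)"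
        using elim(1) c C m by (intro epowr_total_cost_le) auto
    qed
  qed
  have h_meas [measurable]: "?h K t \<in> borel_measurable (Prob H)" for K t by measurable
  have h_int: "(\<integral>\<^sup>+\<omega>. ?h K t \<omega> \<partial>cond_law H i) \<le> ennreal (g (t + K) / nu H i)" for K t
  proof -
    have "(\<integral>\<^sup>+\<omega>. ?h K t \<omega> \<partial>cond_law H i) \<le> (\<integral>\<^sup>+\<omega>. ?h K t \<omega> \<partial>Prob H) / ennreal (nu H i)"
      unfolding nn_integral_cond_law[OF i h_meas]
      by (intro divide_right_mono_ennreal nn_integral_mono) (auto split: split_indicator)
    also have "(\<integral>\<^sup>+\<omega>. ?h K t \<omega> \<partial>Prob H)
        = (\<integral>\<^sup>+\<omega>. ennreal ((C * real (t + K + 1)) powr m) * indicator {\<omega> \<in> space (Prob H). state H (t + K) \<omega> \<in> ?W} \<omega> \<partial>Prob H)"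
      by (intro nn_integral_cong) auto
    also have "\<dots> = ennreal ((C * real (t + K + 1)) powr m) * ennreal (a (t + K))"
      by (subst nn_integral_cmult_indicator) (auto simp: emeasure_eq_measure prob_state_in a_def)
    also have "\<dots> = ennreal (g (t + K))" by (simp add: g_def ennreal_mult a0)
    finally show ?thesis using nu by (simp add: divide_ennreal g0)
  qed
  show ?thesis
  proof (intro exI[of _ tail] conjI allI)
    have "(\<lambda>K. (suminf g - (\<Sum>t<K. g t)) / nu H i) \<longlonglongrightarrow> (suminf g - suminf g) / nu H i"
      using nu by (intro tendsto_intros summable_LIMSEQ g) auto
    then show "tail \<longlonglongrightarrow> 0"
      unfolding tail_def using suminf_minus_initial_segment[OF g] by simp
    show "0 \<le> tail K" for K unfolding tail_def using nu
      by (intro divide_nonneg_pos suminf_nonneg summable_ignore_initial_segment g g0)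
    fix K
    have "(\<integral>\<^sup>+\<omega>. epowr (stopped_cost H c \<infinity> \<omega>) m \<partial>cond_law H i)
        \<le> (\<integral>\<^sup>+\<omega>. ennreal (cost H c K \<omega> powr m) + (\<Sum>t. ?h K t \<omega>) \<partial>cond_law H i)"
      by (rule nn_integral_mono_AE[OF pt])
    also have "\<dots> = (\<integral>\<^sup>+\<omega>. ennreal (cost H c K \<omega> powr m) \<partial>cond_law H i) + (\<Sum>t. \<integral>\<^sup>+\<omega>. ?h K t \<omega> \<partial>cond_law H i)"
      by (subst nn_integral_add) (auto simp: nn_integral_suminf)
    also have "(\<Sum>t. \<integral>\<^sup>+\<omega>. ?h K t \<omega> \<partial>cond_law H i) \<le> (\<Sum>t. ennreal (g (t + K) / nu H i))"
      by (intro suminf_le h_int) auto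
    also have "(\<Sum>t. ennreal (g (t + K) / nu H i)) = ennreal (tail K)"
      unfolding tail_def using nu summable_ignore_initial_segment[OF g, of K]
      by (subst suminf_ennreal2) (auto simp: g0 summable_divide suminf_divide)
    finally show "(\<integral>\<^sup>+\<omega>. epowr (stopped_cost H c \<infinity> \<omega>) m \<partial>cond_law H i)
      \<le> (\<integral>\<^sup>+\<omega>. ennreal (cost H c K \<omega> powr m) \<partial>cond_law H i) + ennreal (tail K)"
      by (simp add: add_left_mono)
  qed
qed

text \<open>The probability of being in a costly state decreases to some \<open>\<alpha>\<close>. A
  positive \<open>\<alpha>\<close> forces linear growth of the mean cost, and hence growth of its
  \<open>m\<close>-th moment like \<open>n^m\<close>; \<open>\<alpha> = 0\<close> gives a total cost
  with a vanishing remainder.\<close>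

lemma cost_dichotomy:
  assumes c: "\<And>y. 0 \<le> c y" and i: "i \<in> hyps H" and m: "1 \<le> m"
  obtains
    (linear) \<kappa> n0 where "0 < \<kappa>" "\<And>n. n0 \<le> n \<Longrightarrow>
      ennreal (\<kappa> * real n powr m) \<le> (\<integral>\<^sup>+\<omega>. ennreal (cost H c n \<omega> powr m) \<partial>cond_law H i)"
  | (bounded) tail :: "nat \<Rightarrow> real" where "tail \<longlonglongrightarrow> 0" "\<And>K. 0 \<le> tail K"
    "\<And>K. (\<integral>\<^sup>+\<omega>. epowr (stopped_cost H c \<infinity> \<omega>) m \<partial>cond_law H i)
      \<le> (\<integral>\<^sup>+\<omega>. ennreal (cost H c K \<omega> powr m) \<partial>cond_law H i) + ennreal (tail K)"
proof -
  let ?a = "\<lambda>n. \<Sum>y\<in>costly c i. occ n y"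
  have dec: "decseq ?a" by (rule occ_sum_decseq[OF costly_complement_closed[of c i, OF c i]])
  have a0: "0 \<le> ?a n" for n by (intro sum_nonneg occ_nonneg)
  obtain \<alpha> where \<alpha>: "?a \<longlonglongrightarrow> \<alpha>" "\<And>n. \<alpha> \<le> ?a n"
    using decseq_convergent[OF dec, of 0] a0 by auto
  have "0 \<le> \<alpha>" using \<alpha>(1) a0 by (intro LIMSEQ_le_const) auto
  then consider "\<alpha> = 0" | "0 < \<alpha>" by linarith
  then show thesis
  proof cases
    case 1
    then have "?a \<longlonglongrightarrow> 0" using \<alpha>(1) by simp
    from total_cost_tail[of c i m, OF c i m this] show thesis using bounded by blast
  next
    case 2
    obtain \<kappa> n0 where \<kappa>: "0 < \<kappa>" and n0: "\<And>n. n0 \<le> n \<Longrightarrow>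
        ennreal (\<kappa> * real n) \<le> (\<integral>\<^sup>+\<omega>. ennreal (cost H c n \<omega>) \<partial>cond_law H i)"
      using mean_cost_linear[of c i \<alpha>, OF c i 2 \<alpha>(2)] by blast
    show thesis
    proof (rule linear[of "(\<kappa>/2) powr m" "Suc n0"])
      show "0 < (\<kappa>/2) powr m" using \<kappa> by simp
      \<comment> \<open>\<open>Suc n0\<close> makes \<open>n\<close> positive, so that
        \<open>moment_lower_bound\<close> applies with \<open>a = \<kappa>/2 * n\<close>, half of
        the bound on the mean.\<close>
      fix n assume n: "Suc n0 \<le> n"
      have "ennreal ((\<kappa>/2 * real n) powr m) \<le> (\<integral>\<^sup>+\<omega>. ennreal (cost H c n \<omega> powr m) \<partial>cond_law H i)"
        using n0[of n] n \<kappa> m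
        by (intro moment_lower_bound prob_space_cond_law i) (auto simp: cost_nonneg c)
      moreover have "(\<kappa>/2 * real n) powr m = (\<kappa>/2) powr m * real n powr m"
        by (rule powr_mult)
      ultimately show "ennreal ((\<kappa>/2) powr m * real n powr m)
          \<le> (\<integral>\<^sup>+\<omega>. ennreal (cost H c n \<omega> powr m) \<partial>cond_law H i)"
        by (simp only:)
    qed
  qed
qed

subsection \<open>Decision risks\<close>

lemma finite_hyps [simp]: "finite (hyps H)" by (simp add: hyps_def)

lemma finite_others [simp]: "finite (others H i)" by (simp add: others_def)

lemma upsilon1_le_iff:
  "upsilon1 H i b \<omega> \<le> enat N \<longleftrightarrow> (\<exists>n\<in>{1..N}. \<forall>j\<in>others H i. Lam H i j n \<omega> > ereal (- ln (b j)))"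
  unfolding upsilon1_def Inf_enat_le_iff by auto

lemma upsilon1_eqD:
  "upsilon1 H i b \<omega> = enat n \<Longrightarrow> 1 \<le> n \<and> (\<forall>j\<in>others H i. Lam H i j n \<omega> > ereal (- ln (b j)))"
  unfolding upsilon1_def by (rule Inf_enat_eqD)

lemma upsilon1_stopping: "stopping_time (obs_filtration H) (upsilon1 H i b)"
proof
  fix t
  show "Measurable.pred (obs_filtration H t) (\<lambda>\<omega>. upsilon1 H i b \<omega> \<le> t)"
  proof (cases t)
    case (enat N)
    have [measurable]: "Lam H i j n \<in> borel_measurable (\<F> N)" if "n \<in> {1..N}" for n j
      by (rule measurable_from_subalg[OF _ Lam_measurable_filtration])
         (use that in \<open>auto simp: subalgebra_def intro: sets_filtration_mono\<close>)
    show ?thesis unfolding enat upsilon1_le_iff by measurable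
  qed simp
qed

lemma upsilon_le_iff:
  assumes "hyps H \<noteq> {}"
  shows "upsilon H B \<omega> \<le> t \<longleftrightarrow> (\<exists>i\<in>hyps H. upsilon1 H i (B i) \<omega> \<le> t)"
  unfolding upsilon_def using assms by (subst Min_le_iff) auto

lemma upsilon_stopping:
  assumes "hyps H \<noteq> {}" shows "stopping_time (obs_filtration H) (upsilon H B)"
proof
  fix t
  note [measurable] = stopping_timeD[OF upsilon1_stopping]
  show "Measurable.pred (obs_filtration H t) (\<lambda>\<omega>. upsilon H B \<omega> \<le> t)"
    unfolding upsilon_le_iff[OF assms] by measurable
qed

text \<open>On \<open>T \<le> t\<close>, equality of the two times means that they agree on which
  levels \<open>s \<le> t\<close> have been reached; this involves countably many events known at
  time \<open>t\<close>.\<close>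

lemma pred_pre_sigma_eq:
  assumes S: "stopping_time (obs_filtration H) S" and T: "stopping_time (obs_filtration H) T"
  shows "Measurable.pred (flt.pre_sigma T) (\<lambda>\<omega>. S \<omega> = T \<omega>)"
proof (rule flt.pred_pre_sigmaI[OF T])
  fix t
  have eq: "(S \<omega> = T \<omega> \<and> T \<omega> \<le> t) = ((\<forall>s. s \<le> t \<longrightarrow> (S \<omega> \<le> s \<longleftrightarrow> T \<omega> \<le> s)) \<and> T \<omega> \<le> t)" for \<omega>
    by (metis order.refl order.antisym)
  have "Measurable.pred (obs_filtration H t) (\<lambda>\<omega>. \<forall>s. s \<le> t \<longrightarrow> (S \<omega> \<le> s \<longleftrightarrow> T \<omega> \<le> s))"
  proof (rule pred_intros_countable(1))
    fix s
    show "Measurable.pred (obs_filtration H t) (\<lambda>\<omega>. s \<le> t \<longrightarrow> (S \<omega> \<le> s \<longleftrightarrow> T \<omega> \<le> s))"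
    proof (cases "s \<le> t")
      case True
      note [measurable] = flt.stopping_time_le_const[OF S True] flt.stopping_time_le_const[OF T True]
      show ?thesis by measurable
    qed simp
  qed
  then show "Measurable.pred (obs_filtration H t) (\<lambda>\<omega>. S \<omega> = T \<omega> \<and> T \<omega> \<le> t)"
    unfolding eq by (intro pred_intros_logic stopping_timeD[OF T])
qed

text \<open>The decision rule of the theorem is an arbitrary pointwise minimizer, with no
  measurability stated. Since the delay depends only on the stopping time, admissibility is shown
  with this minimizer instead, whose measurability can be checked.\<close>

definition least_decision :: "(nat \<Rightarrow> nat \<Rightarrow> real) \<Rightarrow> 'w \<Rightarrow> nat" where
  "least_decision B \<omega> = (LEAST i. i \<in> hyps H \<and> upsilon1 H i (B i) \<omega> = upsilon H B \<omega>)"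

lemma least_decision:
  assumes "hyps H \<noteq> {}"
  shows "least_decision B \<omega> \<in> hyps H"
    and "upsilon1 H (least_decision B \<omega>) (B (least_decision B \<omega>)) \<omega> = upsilon H B \<omega>"
proof -
  have "upsilon H B \<omega> \<in> (\<lambda>i. upsilon1 H i (B i) \<omega>) ` hyps H"
    unfolding upsilon_def using assms by (intro Min_in) auto
  then have "\<exists>i. i \<in> hyps H \<and> upsilon1 H i (B i) \<omega> = upsilon H B \<omega>" by auto
  from LeastI_ex[OF this] show "least_decision B \<omega> \<in> hyps H"
    "upsilon1 H (least_decision B \<omega>) (B (least_decision B \<omega>)) \<omega> = upsilon H B \<omega>"
    unfolding least_decision_def by auto
qed

lemma least_decision_strategy:
  assumes ne: "hyps H \<noteq> {}"
  shows "(upsilon H B, least_decision B) \<in> strategies H"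
proof -
  note st = upsilon_stopping[OF ne, of B]
  \<comment> \<open>Being the least minimizer is a finite Boolean combination of equalities of
    stopping times, each measurable by \<open>pred_pre_sigma_eq\<close>.\<close>
  have iff: "least_decision B \<omega> = a \<longleftrightarrow> a \<in> hyps H \<and> upsilon1 H a (B a) \<omega> = upsilon H B \<omega> \<and>
      (\<forall>k\<in>hyps H. k < a \<longrightarrow> upsilon1 H k (B k) \<omega> \<noteq> upsilon H B \<omega>)" (is "_ \<longleftrightarrow> ?R") for a \<omega>
  proof
    assume "least_decision B \<omega> = a"
    then show ?R using least_decision[OF ne, of B \<omega>] not_less_Least
      unfolding least_decision_def by blast
  next
    assume ?R
    then show "least_decision B \<omega> = a"
      unfolding least_decision_def by (intro Least_equality) (auto simp: not_less[symmetric])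
  qed
  have [measurable]: "Measurable.pred (flt.pre_sigma (upsilon H B)) (\<lambda>\<omega>. upsilon1 H k (B k) \<omega> = upsilon H B \<omega>)" for k
    by (rule pred_pre_sigma_eq[OF upsilon1_stopping st])
  have "Measurable.pred (flt.pre_sigma (upsilon H B)) (\<lambda>\<omega>. least_decision B \<omega> = a)" for a
    unfolding iff by measurable
  then have "{\<omega> \<in> space (flt.pre_sigma (upsilon H B)). least_decision B \<omega> = a} \<in> sets (flt.pre_sigma (upsilon H B))" for a
    by (simp add: pred_def)
  moreover have "least_decision B -` {a} \<inter> X = {\<omega>\<in>X. least_decision B \<omega> = a}" for a X by auto
  ultimately have "least_decision B \<in> measurable (flt.pre_sigma (upsilon H B)) (count_space (hyps H))"
    using least_decision[OF ne] by (subst measurable_count_space_eq2) auto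
  then show ?thesis using st by (simp add: strategies_def)
qed

section \<open>Risks of a strategy, split by stopping time and decision\<close>

definition decided :: "('w \<Rightarrow> enat) \<times> ('w \<Rightarrow> nat) \<Rightarrow> nat \<Rightarrow> nat \<Rightarrow> 'w set" where
  "decided s k n = {\<omega> \<in> space (Prob H). fst s \<omega> = enat n \<and> snd s \<omega> = k}"

lemma decided_filtration:
  assumes s: "s \<in> strategies H" and k: "k \<in> hyps H"
  shows "decided s k n \<in> sets (\<F> n)"
proof -
  obtain \<tau> d where sd: "s = (\<tau>, d)" by (cases s)
  have \<tau>: "stopping_time (obs_filtration H) \<tau>"
    and d: "d \<in> measurable (flt.pre_sigma \<tau>) (count_space (hyps H))"
    using s by (auto simp: sd strategies_def)
  have "d -` {k} \<inter> space (flt.pre_sigma \<tau>) \<in> sets (flt.pre_sigma \<tau>)"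
    using k by (intro measurable_sets[OF d]) auto
  from flt.sets_pre_sigmaD[OF \<tau> this, of "enat n"]
  have "{\<omega> \<in> d -` {k} \<inter> space (Prob H). \<tau> \<omega> \<le> enat n} \<in> sets (\<F> n)"
    unfolding flt.space_pre_sigma .
  moreover have "{\<omega> \<in> space (Prob H). \<tau> \<omega> < enat n} \<in> sets (\<F> n)"
    using flt.stopping_time_less_const[OF \<tau>, of "enat n"] by (simp add: pred_def)
  ultimately have "{\<omega> \<in> d -` {k} \<inter> space (Prob H). \<tau> \<omega> \<le> enat n} - {\<omega> \<in> space (Prob H). \<tau> \<omega> < enat n} \<in> sets (\<F> n)"
    by blast
  also have "{\<omega> \<in> d -` {k} \<inter> space (Prob H). \<tau> \<omega> \<le> enat n} - {\<omega> \<in> space (Prob H). \<tau> \<omega> < enat n} = decided s k n"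
    by (auto simp: decided_def sd)
  finally show ?thesis .
qed

lemma strategy_decision: "s \<in> strategies H \<Longrightarrow> \<omega> \<in> space (Prob H) \<Longrightarrow> snd s \<omega> \<in> hyps H"
  by (cases s) (auto simp: strategies_def flt.space_pre_sigma dest!: measurable_space)

lemma strategy_time_measurable:
  assumes "s \<in> strategies H" shows "fst s \<in> measurable (Prob H) (count_space UNIV)"
proof -
  have \<tau>: "stopping_time (obs_filtration H) (fst s)" using assms by (cases s) (auto simp: strategies_def)
  have "fst s \<in> borel_measurable (Prob H)"
    by (rule measurable_stopping_time[OF \<tau>]) (auto intro: filtration_event)
  then show ?thesis by (rule measurable_enat_count_space)
qed

lemma strategy_stops_by_event:
  "s \<in> strategies H \<Longrightarrow> {\<omega> \<in> space (Prob H). fst s \<omega> \<le> enat K} \<in> events"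
  using measurable_sets[OF strategy_time_measurable, of s "{..enat K}"]
  by (simp add: vimage_def Int_def conj_commute)

text \<open>The union over finite stopping values excludes \<open>\<tau> = \<infinity>\<close> by
  itself and evaluates the state at a fixed time in each piece, where the posterior at that time can
  be used.\<close>

definition risk_event :: "('w \<Rightarrow> enat) \<times> ('w \<Rightarrow> nat) \<Rightarrow> nat \<Rightarrow> 'y set \<Rightarrow> 'w set" where
  "risk_event s k W = (\<Union>n. decided s k n \<inter> {\<omega> \<in> space (Prob H). state H n \<omega> \<in> W})"

lemma decided_event: "s \<in> strategies H \<Longrightarrow> k \<in> hyps H \<Longrightarrow> decided s k n \<in> events"
  by (rule filtration_event[OF decided_filtration])

lemma state_in_event: "{\<omega> \<in> space (Prob H). state H n \<omega> \<in> W} \<in> events"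
  by measurable

lemma risk_event_sums:
  assumes "s \<in> strategies H" "k \<in> hyps H"
  shows "(\<lambda>n. prob (decided s k n \<inter> {\<omega> \<in> space (Prob H). state H n \<omega> \<in> W})) sums prob (risk_event s k W)"
  unfolding risk_event_def
  by (rule finite_measure_UNION)
     (use decided_event[OF assms] state_in_event in \<open>auto simp: disjoint_family_on_def decided_def\<close>)

lemma risk_event_measurable:
  assumes "s \<in> strategies H" "k \<in> hyps H" shows "risk_event s k W \<in> events"
  unfolding risk_event_def using decided_event[OF assms] state_in_event by auto

lemma risk_eq: "risk H y k s = prob (risk_event s k {y})"
proof -
  have "{\<omega> \<in> space (Prob H). snd s \<omega> = k \<and> fst s \<omega> < \<infinity> \<and> state H (the_enat (fst s \<omega>)) \<omega> = y} = risk_event s k {y}"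
    by (auto simp: risk_event_def decided_def less_infinityE)
  then show ?thesis by (simp add: risk_def case_prod_beta)
qed

lemma risk_event_sum_risk:
  assumes "s \<in> strategies H" "k \<in> hyps H"
  shows "prob (risk_event s k W) = (\<Sum>y\<in>W. risk H y k s)"
proof -
  have eq: "risk_event s k W = (\<Union>y\<in>W. risk_event s k {y})" by (auto simp: risk_event_def)
  show ?thesis
    unfolding risk_eq eq
  proof (rule finite_measure_finite_Union)
    show "(\<lambda>y. risk_event s k {y}) ` W \<subseteq> events"
      using risk_event_measurable[OF assms] by blast
    show "disjoint_family_on (\<lambda>y. risk_event s k {y}) W"
      by (auto simp: disjoint_family_on_def risk_event_def decided_def)
  qed simp
qed

lemma risk_event_cls_le_nu:
  assumes s: "s \<in> strategies H" and i: "i \<in> hyps H"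
  shows "prob (risk_event s i (cls H i)) \<le> nu H i"
  unfolding nu_eq
proof (rule finite_measure_mono_AE)
  show "AE \<omega> in Prob H. \<omega> \<in> risk_event s i (cls H i) \<longrightarrow> \<omega> \<in> true_hyp i"
    using AE_in_cls_true_hyp by eventually_elim (use i in \<open>auto simp: risk_event_def\<close>)
qed (rule true_hyp_event[OF i])

text \<open>When the rule stops for \<open>i\<close> at \<open>n\<close>, the posterior of
  \<open>cls H j\<close> is at most \<open>B i j\<close> times that of \<open>cls H i\<close>.
  Changing measure turns the risk into \<open>B i j\<close> times the probability of a correct
  decision for \<open>i\<close>, which is at most \<open>nu H i\<close>. This is why the thresholds
  divide the bounds by \<open>nu H i\<close>.\<close>

lemma least_decision_risk:
  assumes i: "i \<in> hyps H" and j: "j \<in> others H i" and pos: "0 < B i j" and y: "y \<in> cls H j"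
  shows "risk H y i (upsilon H B, least_decision B) \<le> B i j * nu H i"
proof -
  have ne: "hyps H \<noteq> {}" using i by auto
  let ?s = "(upsilon H B, least_decision B)"
  note s = least_decision_strategy[OF ne, of B]
  have step: "prob (decided ?s i n \<inter> {\<omega> \<in> space (Prob H). state H n \<omega> \<in> {y}})
      \<le> B i j * prob (decided ?s i n \<inter> {\<omega> \<in> space (Prob H). state H n \<omega> \<in> cls H i})" for n
  proof -
    have "prob (decided ?s i n \<inter> {\<omega> \<in> space (Prob H). state H n \<omega> \<in> {y}})
        \<le> prob (decided ?s i n \<inter> in_cls j n)"
      using y decided_event[OF s i] by (intro finite_measure_mono) (auto simp: in_cls_def)
    also have "\<dots> \<le> B i j * prob (decided ?s i n \<inter> in_cls i n)"
    proof (rule prob_in_cls_mono_post[OF decided_filtration[OF s i]])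
      show "AE \<omega> in Prob H. \<omega> \<in> decided ?s i n \<longrightarrow> post H j n \<omega> \<le> B i j * post H i n \<omega>"
        using post_nonneg[of i n] post_nonneg[of j n]
      proof eventually_elim
        case (elim \<omega>)
        show ?case
        proof
          assume "\<omega> \<in> decided ?s i n"
          then have "upsilon H B \<omega> = enat n" "least_decision B \<omega> = i" by (auto simp: decided_def)
          then have "upsilon1 H i (B i) \<omega> = enat n" using least_decision(2)[OF ne, of B \<omega>] by simp
          then have "ereal (- ln (B i j)) < elog (ereal (post H i n \<omega>) / ereal (post H j n \<omega>))"
            using upsilon1_eqD j unfolding Lam_def by blast
          from elog_ratio_gtD[OF elim this] show "post H j n \<omega> \<le> B i j * post H i n \<omega>"
            using pos by simp
        qed
      qed
    qed
    finally show ?thesis by (simp add: in_cls_def)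
  qed
  have "risk H y i ?s \<le> B i j * prob (risk_event ?s i (cls H i))"
    unfolding risk_eq
    by (rule sums_le[OF step risk_event_sums[OF s i] sums_mult[OF risk_event_sums[OF s i]]])
  also have "\<dots> \<le> B i j * nu H i"
    using pos risk_event_cls_le_nu[OF s i] by (intro mult_left_mono) auto
  finally show ?thesis .
qed

text \<open>The posterior ratio is only controlled at times \<open>n \<ge> 1\<close>. A decision at time 0 is compared
  at time 1 instead, which is possible since \<open>cls H i\<close> cannot be left.\<close>

lemma early_stopping_bound:
  assumes s: "s \<in> strategies H" and i: "i \<in> hyps H" and j: "j \<in> others H i"
  shows "prob (true_hyp i \<inter> {\<omega> \<in> space (Prob H). fst s \<omega> \<le> enat K})
    \<le> (\<Sum>k\<in>hyps H. prob (risk_event s k (- cls H k))) + exp a * prob (risk_event s i (- cls H i))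
      + prob (true_hyp i \<inter> {\<omega> \<in> space (Prob H). \<exists>n\<in>{1..max 1 K}. ereal a < Lam H i j n \<omega>})"
proof -
  let ?R = "\<lambda>k. risk_event s k (- cls H k)"
  let ?bad = "true_hyp i \<inter> {\<omega> \<in> space (Prob H). \<exists>n\<in>{1..max 1 K}. ereal a < Lam H i j n \<omega>}"
  \<comment> \<open>The part of the decisions for \<open>i\<close> on which the change of measure
    costs at most \<open>exp a\<close>.\<close>
  define G where "G n = decided s i n \<inter> {\<omega> \<in> space (Prob H). Lam H i j (max 1 n) \<omega> \<le> ereal a}" for n
  let ?main = "\<lambda>n. G n \<inter> in_cls i (max 1 n)"
  have bad_event: "?bad \<in> events"
    using true_hyp_event[OF i] by measurable
  have G: "G n \<in> sets (\<F> (max 1 n))" for n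
  proof -
    note [measurable] = Lam_measurable_filtration[of i j "max 1 n"]
    have "{\<omega> \<in> space (\<F> (max 1 n)). Lam H i j (max 1 n) \<omega> \<le> ereal a} \<in> sets (\<F> (max 1 n))" by measurable
    moreover have "decided s i n \<in> sets (\<F> (max 1 n))"
      using decided_filtration[OF s i] by (rule sets_filtration_mono[rotated]) simp
    ultimately show ?thesis unfolding G_def by auto
  qed
  have main_event: "?main n \<in> events" for n
    using filtration_event[OF G, of n] in_cls_event by auto
  have ij: "i \<noteq> j" "j \<in> {0..num H}" using j by (auto simp: others_def)
  \<comment> \<open>Under hypothesis \<open>i\<close>, stopping by \<open>K\<close> is either a
    decision outside the class of the current state, or a decision for \<open>i\<close> with
    \<open>Lam\<close> at most \<open>a\<close>, or comes with \<open>Lam\<close> above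
    \<open>a\<close>. A decision for another \<open>k\<close> cannot be correct, as the chain stays
    in \<open>cls H 0\<close> or \<open>cls H i\<close>.\<close>
  have cover: "AE \<omega> in Prob H. \<omega> \<in> true_hyp i \<inter> {\<omega> \<in> space (Prob H). fst s \<omega> \<le> enat K}
      \<longrightarrow> \<omega> \<in> (\<Union>k\<in>hyps H. ?R k) \<union> (\<Union>n\<le>K. ?main n) \<union> ?bad"
    using AE_true_hyp_state AE_cls_absorbing AE_space
  proof eventually_elim
    case (elim \<omega>)
    show ?case
    proof
      assume "\<omega> \<in> true_hyp i \<inter> {\<omega> \<in> space (Prob H). fst s \<omega> \<le> enat K}"
      then have \<omega>: "\<omega> \<in> true_hyp i" "fst s \<omega> \<le> enat K" by auto
      then obtain n where n: "fst s \<omega> = enat n" "n \<le> K" by (cases "fst s \<omega>") auto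
      define k where "k = snd s \<omega>"
      have k: "k \<in> hyps H" unfolding k_def using strategy_decision[OF s] elim by blast
      have dec: "\<omega> \<in> decided s k n" using n elim by (simp add: decided_def k_def)
      show "\<omega> \<in> (\<Union>k\<in>hyps H. ?R k) \<union> (\<Union>n\<le>K. ?main n) \<union> ?bad"
      proof (cases "state H n \<omega> \<in> cls H k")
        case False
        then have "\<omega> \<in> ?R k" using dec elim by (auto simp: risk_event_def)
        then show ?thesis using k by auto
      next
        case True
        have "state H n \<omega> \<in> cls H 0 \<union> cls H i" using elim(1) i \<omega>(1) by blast
        then have ki: "k = i"
          using True cls_unique hyps_le k i by (metis Un_iff cls_0 DiffD2 UN_I)
        then have "state H (max 1 n) \<omega> \<in> cls H i" 
          using True elim(2) i max.cobounded2[of n 1] by blast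
        then have in_i: "\<omega> \<in> in_cls i (max 1 n)" using elim by (simp add: in_cls_def)
        show ?thesis
        proof (cases "Lam H i j (max 1 n) \<omega> \<le> ereal a")
          case True
          then have "\<omega> \<in> ?main n" using in_i dec ki elim by (simp add: G_def)
          then show ?thesis using n by auto
        next
          case False
          then have "\<omega> \<in> ?bad" using \<omega> n elim by (auto intro!: bexI[of _ "max 1 n"] simp: not_le)
          then show ?thesis by blast
        qed
      qed
    qed
  qed
  \<comment> \<open>After the passage from class \<open>i\<close> to class \<open>j\<close>, the
    state at time \<open>max 1 n\<close> lies outside the closed set \<open>cls H i\<close>, so the
    state at time \<open>n\<close> was outside it as well and the decision for \<open>i\<close> was
    wrong.\<close>
  have main_le: "prob (?main n) \<le> exp a * prob (decided s i n \<inter> {\<omega> \<in> space (Prob H). state H n \<omega> \<in> - cls H i})" for n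
  proof -
    have "prob (?main n) \<le> exp a * prob (G n \<inter> in_cls j (max 1 n))"
    proof (rule prob_in_cls_mono_post[OF G])
      show "AE \<omega> in Prob H. \<omega> \<in> G n \<longrightarrow> post H i (max 1 n) \<omega> \<le> exp a * post H j (max 1 n) \<omega>"
        using post_nonneg[of i "max 1 n"] post_nonneg[of j "max 1 n"]
        by eventually_elim (intro impI elog_ratio_leD, simp_all only: G_def Lam_def Int_iff mem_Collect_eq)
    qed
    also have "prob (G n \<inter> in_cls j (max 1 n)) \<le> prob (decided s i n \<inter> {\<omega> \<in> space (Prob H). state H n \<omega> \<in> - cls H i})"
    proof (rule finite_measure_mono_AE)
      show "AE \<omega> in Prob H. \<omega> \<in> G n \<inter> in_cls j (max 1 n) \<longrightarrow>
          \<omega> \<in> decided s i n \<inter> {\<omega> \<in> space (Prob H). state H n \<omega> \<in> - cls H i}"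
        using AE_cls_absorbing
      proof eventually_elim
        case (elim \<omega>)
        have "state H n \<omega> \<notin> cls H i" if "state H (max 1 n) \<omega> \<in> cls H j"
          using elim i ij cls_unique[of "state H (max 1 n) \<omega>" i j] hyps_le(1)[OF i] that
          by (meson max.cobounded2)
        then show ?case by (auto simp: G_def in_cls_def)
      qed
    qed (use decided_event[OF s i] state_in_event in auto)
    finally show ?thesis by simp
  qed
  have "(\<Sum>n\<le>K. prob (?main n)) \<le> (\<Sum>n\<le>K. exp a * prob (decided s i n \<inter> {\<omega> \<in> space (Prob H). state H n \<omega> \<in> - cls H i}))"
    by (intro sum_mono main_le)
  also have "\<dots> \<le> exp a * prob (?R i)"
    unfolding sum_distrib_left[symmetric] sums_unique[OF risk_event_sums[OF s i, of "- cls H i"]]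
    by (intro mult_left_mono sum_le_suminf sums_summable[OF risk_event_sums[OF s i]]) auto
  finally have sum_main: "(\<Sum>n\<le>K. prob (?main n)) \<le> exp a * prob (?R i)" .
  have R_event: "?R k \<in> events" if "k \<in> hyps H" for k by (rule risk_event_measurable[OF s that])
  have "prob (true_hyp i \<inter> {\<omega> \<in> space (Prob H). fst s \<omega> \<le> enat K})
      \<le> prob ((\<Union>k\<in>hyps H. ?R k) \<union> (\<Union>n\<le>K. ?main n) \<union> ?bad)"
    by (rule finite_measure_mono_AE[OF cover]) (use R_event main_event bad_event in auto)
  also have "\<dots> \<le> prob (\<Union>k\<in>hyps H. ?R k) + prob (\<Union>n\<le>K. ?main n) + prob ?bad"
    using R_event main_event bad_event
    by (intro order_trans[OF measure_Un_le] add_mono order.refl) auto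
  also have "prob (\<Union>k\<in>hyps H. ?R k) \<le> (\<Sum>k\<in>hyps H. prob (?R k))"
    using R_event by (intro finite_measure_subadditive_finite) auto
  also have "prob (\<Union>n\<le>K. ?main n) \<le> (\<Sum>n\<le>K. prob (?main n))"
    using main_event by (intro finite_measure_subadditive_finite) auto
  finally show ?thesis using sum_main by simp
qed

subsection \<open>Log-likelihood ratios\<close>

lemma post_pos:
  assumes "nondegenerate_likelihoods H" "i \<in> hyps H"
  shows "AE \<omega> in Prob H. \<forall>n\<ge>1. 0 < post H i n \<omega>"
  using assms unfolding nondegenerate_likelihoods_def AE_all_countable
  by (auto elim!: eventually_mono)

lemma post_eq_0:
  assumes A: "A \<in> sets (\<F> n)" and 0: "prob (A \<inter> in_cls k n) = 0"
  shows "AE \<omega> in Prob H. \<omega> \<in> A \<longrightarrow> post H k n \<omega> = 0"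
proof -
  have [measurable]: "A \<in> events" by (rule filtration_event[OF A])
  have int: "integrable (Prob H) (\<lambda>\<omega>. indicator A \<omega> * post H k n \<omega>)"
    using integrable_real_mult_indicator[OF \<open>A \<in> events\<close> integrable_post[of k n]]
    by (simp add: mult.commute)
  have nn: "AE \<omega> in Prob H. 0 \<le> indicator A \<omega> * post H k n \<omega>"
    using post_nonneg[of k n] by eventually_elim auto
  have "(\<integral>\<omega>. indicator A \<omega> * post H k n \<omega> \<partial>Prob H) = 0"
    using prob_in_cls_post[OF A, of k] 0 by (simp add: set_lebesgue_integral_def)
  then have "AE \<omega> in Prob H. indicator A \<omega> * post H k n \<omega> = 0"
    using integral_nonneg_eq_0_iff_AE[OF int nn] by simp
  then show ?thesis by eventually_elim auto
qed

lemma Lam_eq_top: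
  assumes "0 < post H i n \<omega>" "post H j n \<omega> = 0" shows "Lam H i j n \<omega> = \<infinity>"
  using elog_ratio_0[OF assms(1)] assms(2) by (simp only: Lam_def)

lemma Lam_ne_top:
  assumes "0 < post H i n \<omega>" "0 < post H j n \<omega>" shows "Lam H i j n \<omega> \<noteq> \<infinity>"
  unfolding Lam_def elog_ratio[OF assms] by simp

text \<open>The transient set is not re-entered, so on the event that its posterior vanishes at
  \<open>n\<close> it almost surely does not contain the state at any \<open>q \<ge> n\<close>.
  Where \<open>post H i\<close> is positive, \<open>Lam H i 0\<close> therefore stays infinite once
  it is infinite.\<close>

lemma post_transient_stays_0:
  "AE \<omega> in Prob H. \<forall>n q. n \<le> q \<longrightarrow> post H 0 n \<omega> \<le> 0 \<longrightarrow> post H 0 q \<omega> = 0"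
  unfolding AE_all_countable
proof (intro allI)
  fix n q
  show "AE \<omega> in Prob H. n \<le> q \<longrightarrow> post H 0 n \<omega> \<le> 0 \<longrightarrow> post H 0 q \<omega> = 0"
  proof (cases "n \<le> q")
    case True
    define A where "A = {\<omega> \<in> space (Prob H). post H 0 n \<omega> \<le> 0}"
    note [measurable] = post_measurable_filtration[of 0 n]
    have "{\<omega> \<in> space (\<F> n). post H 0 n \<omega> \<le> 0} \<in> sets (\<F> n)" by measurable
    then have A: "A \<in> sets (\<F> n)" by (simp add: A_def)
    have "prob (A \<inter> in_cls 0 n) \<le> 0 * prob (A \<inter> in_cls 0 n)"
      by (rule prob_in_cls_mono_post[OF A]) (auto simp: A_def)
    moreover have "prob (A \<inter> in_cls 0 q) \<le> prob (A \<inter> in_cls 0 n)"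
    proof (rule finite_measure_mono_AE)
      show "AE \<omega> in Prob H. \<omega> \<in> A \<inter> in_cls 0 q \<longrightarrow> \<omega> \<in> A \<inter> in_cls 0 n"
        using AE_cls_absorbing
      proof eventually_elim
        case (elim \<omega>)
        have "state H n \<omega> \<in> cls H 0" if "state H q \<omega> \<in> cls H 0"
        proof (cases "state H n \<omega>" rule: cls_cases)
          case (2 k)
          then have "state H q \<omega> \<in> cls H k" using elim True by blast
          then show ?thesis using that 2 cls_0 by auto
        qed
        then show ?case by (auto simp: in_cls_def)
      qed
    qed (use filtration_event[OF A] in_cls_event in auto)
    ultimately have "prob (A \<inter> in_cls 0 q) = 0" using measure_nonneg[of "Prob H" "A \<inter> in_cls 0 q"] by linarith
    from post_eq_0[OF sets_filtration_mono[OF True A] this] AE_space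
    show ?thesis by eventually_elim (auto simp: A_def)
  qed simp
qed

lemma post_transient_empty:
  assumes "cls H 0 = {}" shows "AE \<omega> in Prob H. \<forall>n. post H 0 n \<omega> = 0"
  unfolding AE_all_countable
proof
  fix n
  have "AE \<omega> in Prob H. \<omega> \<in> space (Prob H) \<longrightarrow> post H 0 n \<omega> = 0"
    using sets.top[of "\<F> n"] by (intro post_eq_0) (auto simp: in_cls_def assms)
  then show "AE \<omega> in Prob H. post H 0 n \<omega> = 0" using AE_space by eventually_elim auto
qed

lemma Lam_transient_empty:
  assumes nd: "nondegenerate_likelihoods H" and i: "i \<in> hyps H" and e: "cls H 0 = {}"
  shows "AE \<omega> in Prob H. \<forall>n\<ge>1. Lam H i 0 n \<omega> = \<infinity>"
  using post_pos[OF nd i] post_transient_empty[OF e]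
  by eventually_elim (auto intro: Lam_eq_top)

lemma AE_true_hyp_False:
  assumes "i \<in> hyps H" "AE \<omega> in Prob H. \<omega> \<in> true_hyp i \<longrightarrow> False" shows False
proof -
  have "prob (true_hyp i) = 0"
    using assms true_hyp_event[OF assms(1)] by (subst prob_eq_0) auto
  then show False using nu_pos[OF assms(1)] by (simp add: nu_eq)
qed

lemma tendsto_top_divide:
  assumes "\<And>n. N \<le> n \<Longrightarrow> X n = (\<infinity>::ereal)"
  shows "(\<lambda>n. X n / ereal (real n)) \<longlonglongrightarrow> \<infinity>"
proof (rule tendsto_eventually)
  show "\<forall>\<^sub>F n in sequentially. X n / ereal (real n) = \<infinity>"
    using eventually_ge_at_top[of "max 1 N"]
    by eventually_elim (auto simp: assms)
qed

text \<open>Posteriors of the closed classes are positive, so only \<open>j = 0\<close> matters.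
  There an infinite value would persist for ever, against the finite rate
  \<open>\<gamma>\<close>.\<close>

lemma Lam_AE_finite:
  assumes nd: "nondegenerate_likelihoods H" and i: "i \<in> hyps H" and j: "j \<in> others H i"
    and lim: "AE \<omega> in Prob H. \<omega> \<in> true_hyp i \<longrightarrow> (\<lambda>n. Lam H i j n \<omega> / ereal (real n)) \<longlonglongrightarrow> ereal \<gamma>"
  shows "AE \<omega> in Prob H. \<omega> \<in> true_hyp i \<longrightarrow> (\<forall>n\<ge>1. Lam H i j n \<omega> \<noteq> \<infinity>)"
proof (cases "j = 0")
  case False
  then have "j \<in> hyps H" using j by (auto simp: others_def hyps_def)
  from post_pos[OF nd i] post_pos[OF nd this] show ?thesis
    by eventually_elim (simp add: Lam_ne_top)
next
  case True
  show ?thesis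
    using post_pos[OF nd i] post_transient_stays_0 lim
  proof eventually_elim
    case (elim \<omega>)
    show ?case
    proof (intro impI allI notI)
      fix n assume "\<omega> \<in> true_hyp i" and n: "1 \<le> n" "Lam H i j n \<omega> = \<infinity>"
      then have lim: "(\<lambda>n. Lam H i j n \<omega> / ereal (real n)) \<longlonglongrightarrow> ereal \<gamma>" using elim by auto
      have "post H 0 n \<omega> \<le> 0" using Lam_ne_top[of i n \<omega> 0] n elim(1) True by force
      then have "post H 0 q \<omega> = 0" if "n \<le> q" for q using elim(2) that by blast
      then have "(\<lambda>q. Lam H i j q \<omega> / ereal (real q)) \<longlonglongrightarrow> \<infinity>"
        using elim(1) n True by (intro tendsto_top_divide[of n]) (auto intro!: Lam_eq_top)
      from LIMSEQ_unique[OF lim this] show False by simp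
    qed
  qed
qed

lemma hyp_class_nonempty:
  assumes "k \<in> hyps H" shows "cls H k \<noteq> {}"
proof
  assume "cls H k = {}"
  then have "AE \<omega> in Prob H. \<omega> \<in> true_hyp k \<longrightarrow> False"
    by (intro AE_I2) (auto simp: true_hyp_def mu_eq_iff[OF assms])
  then show False by (rule AE_true_hyp_False[OF assms])
qed

text \<open>The threshold for \<open>j(i)\<close> is a minimum over \<open>cls H j\<close>. An empty
  \<open>cls H 0\<close> would make \<open>Lam H i 0\<close> infinite, so the index attaining a
  finite rate belongs to a nonempty class.\<close>

lemma limit_class_nonempty:
  assumes nd: "nondegenerate_likelihoods H" and i: "i \<in> hyps H" and j: "j \<in> others H i"
    and lim: "AE \<omega> in Prob H. \<omega> \<in> true_hyp i \<longrightarrow> (\<lambda>n. Lam H i j n \<omega> / ereal (real n)) \<longlonglongrightarrow> ereal \<gamma>"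
  shows "cls H j \<noteq> {}"
proof
  assume e: "cls H j = {}"
  show False
  proof (cases "j = 0")
    case True
    have "AE \<omega> in Prob H. \<omega> \<in> true_hyp i \<longrightarrow> False"
      using Lam_AE_finite[OF assms] Lam_transient_empty[OF nd i, unfolded True[symmetric], OF e]
      by eventually_elim auto
    then show False by (rule AE_true_hyp_False[OF i])
  next
    case False
    then have jh: "j \<in> hyps H" using j by (auto simp: others_def hyps_def)
    show False using hyp_class_nonempty[OF jh] e by contradiction
  qed
qed

text \<open>Convergence of \<open>Lam / n\<close> allows only finitely many exceedances of the
  steeper line, but their probability need not be small. Demanding also the level \<open>k\<close>
  makes it small: finitely many finite values have a finite maximum.\<close>

lemma Lam_rarely_above_line:
  assumes i: "i \<in> hyps H" and \<gamma>: "0 < \<gamma>" and \<delta>: "0 < \<delta>"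
    and fin: "AE \<omega> in Prob H. \<omega> \<in> true_hyp i \<longrightarrow> (\<forall>n\<ge>1. Lam H i j n \<omega> \<noteq> \<infinity>)"
    and lim: "AE \<omega> in Prob H. \<omega> \<in> true_hyp i \<longrightarrow> (\<lambda>n. Lam H i j n \<omega> / ereal (real n)) \<longlonglongrightarrow> ereal \<gamma>"
  shows "(\<lambda>k::nat. prob (true_hyp i \<inter> {\<omega> \<in> space (Prob H).
      \<exists>n\<ge>1. ereal ((1 + \<delta>) * \<gamma> * real n) < Lam H i j n \<omega> \<and> ereal (real k) < Lam H i j n \<omega>})) \<longlonglongrightarrow> 0"
proof -
  define E where "E k = true_hyp i \<inter> {\<omega> \<in> space (Prob H).
      \<exists>n\<ge>1. ereal ((1 + \<delta>) * \<gamma> * real n) < Lam H i j n \<omega> \<and> ereal (real k) < Lam H i j n \<omega>}" for k :: nat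
  have E_event: "E k \<in> events" for k
    unfolding E_def using true_hyp_event[OF i] by measurable
  have "decseq E"
  proof (rule decseq_SucI)
    have "ereal (real k) < x" if "ereal (real (Suc k)) < x" for k x
      by (rule le_less_trans[OF _ that]) simp
    then show "E (Suc k) \<subseteq> E k" for k unfolding E_def by blast
  qed
  then have "(\<lambda>k. prob (E k)) \<longlonglongrightarrow> prob (\<Inter>k. E k)"
    using E_event by (intro finite_Lim_measure_decseq) auto
  moreover have "prob (\<Inter>k. E k) = 0"
  proof (subst prob_eq_0)
    show "AE \<omega> in Prob H. \<omega> \<notin> (\<Inter>k. E k)"
      using fin lim
    proof eventually_elim
      case (elim \<omega>)
      show ?case
      proof
        assume "\<omega> \<in> (\<Inter>k. E k)"
        then have in_E: "\<omega> \<in> E k" for k by auto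
        then have th: "\<omega> \<in> true_hyp i" by (auto simp: E_def)
        have "\<forall>\<^sub>F n in sequentially. Lam H i j n \<omega> / ereal (real n) < ereal ((1 + \<delta>) * \<gamma>)"
          using elim(2) th \<delta> \<gamma> by (intro order_tendstoD(2)[of _ "ereal \<gamma>"]) auto
        then obtain N where N: "\<And>n. N \<le> n \<Longrightarrow> Lam H i j n \<omega> / ereal (real n) < ereal ((1 + \<delta>) * \<gamma>)"
          by (auto simp: eventually_sequentially)
        have le: "Lam H i j n \<omega> \<le> ereal ((1 + \<delta>) * \<gamma> * real n)" if "N \<le> n" "1 \<le> n" for n
          using N[OF that(1)] that(2) by (simp add: ereal_divide_less_pos mult.commute)
        define M where "M = Max (insert 0 ((\<lambda>n. real_of_ereal (Lam H i j n \<omega>)) ` {1..N}))"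
        obtain k :: nat where k: "M < real k" using reals_Archimedean2 by blast
        obtain n where n: "1 \<le> n" "ereal ((1 + \<delta>) * \<gamma> * real n) < Lam H i j n \<omega>" "ereal (real k) < Lam H i j n \<omega>"
          using in_E[of k] by (auto simp: E_def)
        have "n < N" using le[of n] n by (meson leI not_less)
        then have "real_of_ereal (Lam H i j n \<omega>) \<le> M" unfolding M_def using n(1) by (intro Max_ge) auto
        moreover have "Lam H i j n \<omega> \<noteq> \<infinity>" using elim(1) th n(1) by auto
        ultimately show False using n(3) k by (cases "Lam H i j n \<omega>") auto
      qed
    qed
  qed (use E_event in auto)
  ultimately show ?thesis by (simp add: E_def)
qed

section \<open>The time after which \<open>Psi\<close> keeps up with its linear growth\<close>

abbreviation llr_time :: "ereal \<Rightarrow> nat \<Rightarrow> real \<Rightarrow> 'w \<Rightarrow> enat" where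
  "llr_time k i \<delta> \<equiv> quick_time (\<lambda>n \<omega>. Psi H i n \<omega> / ereal (real n)) k \<delta>"

lemma Psi_measurable:
  assumes "others H i \<noteq> {}" shows "Psi H i n \<in> borel_measurable (Prob H)"
proof -
  have "Psi H i n \<omega> = (INF j\<in>others H i. Lam H i j n \<omega>)" for \<omega>
    unfolding Psi_def using assms by (intro Min_Inf) auto
  then have "Psi H i n = (\<lambda>\<omega>. INF j\<in>others H i. Lam H i j n \<omega>)" by auto
  then show ?thesis by simp measurable
qed

lemma llr_time_le_iff:
  "llr_time k i \<delta> \<omega> \<le> enat K \<longleftrightarrow>
    (\<exists>n\<in>{1..K}. k - ereal \<delta> < (INF q\<in>{n..}. Psi H i q \<omega> / ereal (real q)))"
  unfolding quick_time_def Inf_enat_le_iff by auto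

lemma llr_time_measurable:
  assumes "others H i \<noteq> {}" shows "llr_time k i \<delta> \<in> measurable (Prob H) (count_space UNIV)"
proof -
  note [measurable] = Psi_measurable[OF assms] borel_measurable_ereal_divide
  have le: "{\<omega> \<in> space (Prob H). llr_time k i \<delta> \<omega> \<le> enat K} \<in> events" for K
    unfolding llr_time_le_iff by measurable
  have "{\<omega> \<in> space (Prob H). llr_time k i \<delta> \<omega> \<le> e} \<in> events" for e
    using le by (cases e) auto
  then have "llr_time k i \<delta> \<in> borel_measurable (Prob H)"
    by (rule borel_measurableI_le)
  then show ?thesis by (rule measurable_enat_count_space)
qed

lemma llr_time_finite:
  assumes i: "i \<in> hyps H" and ne: "others H i \<noteq> {}" and \<delta>: "0 < \<delta>" and \<gamma>: "lmin H l i = ereal \<gamma>"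
    and lim: "\<And>j. j \<in> others H i \<Longrightarrow> AE \<omega> in cond_law H i. (\<lambda>n. Lam H i j n \<omega> / ereal (real n)) \<longlonglongrightarrow> l i j"
  shows "AE \<omega> in cond_law H i. llr_time (lmin H l i) i \<delta> \<omega> \<noteq> \<infinity>"
proof -
  have "AE \<omega> in cond_law H i. \<forall>j\<in>others H i. (\<lambda>n. Lam H i j n \<omega> / ereal (real n)) \<longlonglongrightarrow> l i j"
    by (intro AE_finite_allI lim) auto
  then show ?thesis
  proof eventually_elim
    case (elim \<omega>)
    \<comment> \<open>The margin \<open>\<delta>/2\<close> compensates for the strictness lost when
      the infimum over all later times is taken.\<close>
    have "\<forall>\<^sub>F n in sequentially. \<forall>j\<in>others H i. ereal (\<gamma> - \<delta>/2) < Lam H i j n \<omega> / ereal (real n)"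
    proof (intro eventually_ball_finite ballI)
      fix j assume j: "j \<in> others H i"
      have "lmin H l i \<le> l i j" unfolding lmin_def using j by (intro Min_le) auto
      moreover have "ereal (\<gamma> - \<delta>/2) < ereal \<gamma>" using \<delta> by simp
      ultimately have "ereal (\<gamma> - \<delta>/2) < l i j" unfolding \<gamma> by (rule less_le_trans[rotated])
      then show "\<forall>\<^sub>F n in sequentially. ereal (\<gamma> - \<delta>/2) < Lam H i j n \<omega> / ereal (real n)"
        using elim j by (intro order_tendstoD(1)[of _ "l i j"]) auto
    qed simp
    then obtain N where N: "\<And>n j. N \<le> n \<Longrightarrow> j \<in> others H i \<Longrightarrow> ereal (\<gamma> - \<delta>/2) < Lam H i j n \<omega> / ereal (real n)"
      by (auto simp: eventually_sequentially)
    have "ereal (\<gamma> - \<delta>/2) \<le> Psi H i q \<omega> / ereal (real q)" if "N \<le> q" for q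
    proof -
      have "Psi H i q \<omega> \<in> (\<lambda>j. Lam H i j q \<omega>) ` others H i"
        unfolding Psi_def using ne by (intro Min_in) auto
      then show ?thesis using N[OF that] by (auto intro: less_imp_le)
    qed
    then have "ereal (\<gamma> - \<delta>/2) \<le> (INF q\<in>{max 1 N..}. Psi H i q \<omega> / ereal (real q))"
      by (intro INF_greatest) auto
    moreover have "lmin H l i - ereal \<delta> < ereal (\<gamma> - \<delta>/2)" using \<delta> by (simp add: \<gamma>)
    ultimately have "lmin H l i - ereal \<delta> < (INF q\<in>{max 1 N..}. Psi H i q \<omega> / ereal (real q))"
      by (rule less_le_trans[rotated])
    then have "llr_time (lmin H l i) i \<delta> \<omega> \<le> enat (max 1 N)"
      unfolding llr_time_le_iff by (intro bexI[of _ "max 1 N"]) auto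
    then show ?case by (cases "llr_time (lmin H l i) i \<delta> \<omega>") auto
  qed
qed

text \<open>From that time on \<open>Psi\<close> exceeds \<open>(\<gamma> - \<delta>)\<close> times
  the index, so at \<open>K\<close> every single ratio has passed its threshold.\<close>

lemma upsilon1_le_llr_time:
  assumes t: "llr_time (ereal \<gamma>) i \<delta> \<omega> \<le> enat K"
    and b: "\<And>j. j \<in> others H i \<Longrightarrow> - ln (b j) \<le> (\<gamma> - \<delta>) * real K"
  shows "upsilon1 H i b \<omega> \<le> enat K"
proof -
  obtain n where n: "1 \<le> n" "n \<le> K" "ereal \<gamma> - ereal \<delta> < (INF q\<in>{n..}. Psi H i q \<omega> / ereal (real q))"
    using t unfolding llr_time_le_iff by auto
  note n(3)
  also have "(INF q\<in>{n..}. Psi H i q \<omega> / ereal (real q)) \<le> Psi H i K \<omega> / ereal (real K)"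
    using n(2) by (intro INF_lower) auto
  finally have "ereal (\<gamma> - \<delta>) < Psi H i K \<omega> / ereal (real K)" by simp
  then have P: "ereal ((\<gamma> - \<delta>) * real K) < Psi H i K \<omega>"
    using n by (simp add: ereal_less_divide_pos mult.commute)
  have "ereal (- ln (b j)) < Lam H i j K \<omega>" if j: "j \<in> others H i" for j
  proof -
    have "ereal (- ln (b j)) \<le> ereal ((\<gamma> - \<delta>) * real K)" using b[OF j] by simp
    also note P
    also have "Psi H i K \<omega> \<le> Lam H i j K \<omega>" unfolding Psi_def using j by (intro Min_le) auto
    finally show ?thesis .
  qed
  then show ?thesis unfolding upsilon1_le_iff using n by (intro bexI[of _ K]) auto
qed

lemma upsilon1_measurable: "upsilon1 H i b \<in> measurable (Prob H) (count_space UNIV)"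
proof -
  have "upsilon1 H i b \<in> borel_measurable (Prob H)"
    by (rule measurable_stopping_time[OF upsilon1_stopping]) (auto intro: filtration_event)
  then show ?thesis by (rule measurable_enat_count_space)
qed

lemma measurable_of_time:
  fixes f :: "enat \<Rightarrow> ennreal"
  assumes "T \<in> measurable (Prob H) (count_space UNIV)"
  shows "(\<lambda>\<omega>. f (T \<omega>)) \<in> borel_measurable (Prob H)"
  by (rule measurable_compose[OF assms]) simp

lemma tail_integral_vanishes:
  assumes i: "i \<in> hyps H" and T: "T \<in> measurable (Prob H) (count_space UNIV)"
    and fin: "AE \<omega> in cond_law H i. T \<omega> \<noteq> \<infinity>"
    and int: "(\<integral>\<^sup>+\<omega>. f (T \<omega>) \<partial>cond_law H i) < \<infinity>"
  shows "(\<lambda>K. \<integral>\<^sup>+\<omega>. f (T \<omega>) * (if enat K < T \<omega> then 1 else 0) \<partial>cond_law H i) \<longlonglongrightarrow> 0"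
proof -
  have meas: "(\<lambda>\<omega>. g (T \<omega>)) \<in> borel_measurable (cond_law H i)" for g :: "enat \<Rightarrow> ennreal"
    using measurable_of_time[OF T, of g] by measurable
  have "(\<lambda>K. \<integral>\<^sup>+\<omega>. f (T \<omega>) * (if enat K < T \<omega> then 1 else 0) \<partial>cond_law H i)
      \<longlonglongrightarrow> (\<integral>\<^sup>+\<omega>. 0 \<partial>cond_law H i)"
  proof (rule nn_integral_dominated_convergence[OF meas[of "\<lambda>t. f t * (if enat _ < t then 1 else 0)"] _ meas[of f]])
    show "AE \<omega> in cond_law H i. (\<lambda>K. f (T \<omega>) * (if enat K < T \<omega> then 1 else 0)) \<longlonglongrightarrow> 0"
      using fin
    proof eventually_elim
      case (elim \<omega>)
      then obtain N where N: "T \<omega> = enat N" by auto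
      show ?case
      proof (rule tendsto_eventually)
        show "\<forall>\<^sub>F K in sequentially. f (T \<omega>) * (if enat K < T \<omega> then 1 else 0) = 0"
          using eventually_ge_at_top[of N] by eventually_elim (simp add: N)
      qed
    qed
  qed (use int in auto)
  then show ?thesis by simp
qed

end

subsection \<open>Asymptotics of the delay\<close>

text \<open>One hypothesis \<open>i\<close> is fixed together with \<open>j = j(i)\<close>;
  \<open>\<gamma>\<close> is \<open>l(i)\<close> as a real number, possible because
  \<open>l(i)\<close> is positive and finite.\<close>

locale llr_model = hidden_markov H for H :: "('w, 'y::finite, 'e) hmm" +
  fixes l :: "nat \<Rightarrow> nat \<Rightarrow> ereal" and \<beta> :: "nat \<Rightarrow> real" and i j :: nat and \<gamma> :: real
  assumes nd: "nondegenerate_likelihoods H" and rates: "llr_rates H l"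
    and i: "i \<in> hyps H" and j: "j \<in> others H i" and l_ij: "l i j = lmin H l i"
    and \<gamma>: "lmin H l i = ereal \<gamma>" and \<beta>: "\<And>k. k \<in> hyps H \<Longrightarrow> 0 < \<beta> k"
begin

interpretation prob_space "Prob H" by (rule prob_space_Prob)

lemma lim_l: "k \<in> others H i \<Longrightarrow> AE \<omega> in cond_law H i. (\<lambda>n. Lam H i k n \<omega> / ereal (real n)) \<longlonglongrightarrow> l i k"
  using rates i by (auto simp: llr_rates_def)

lemma \<gamma>_pos: "0 < \<gamma>"
proof -
  have "0 < l i j" using rates i j by (auto simp: llr_rates_def)
  then show ?thesis using l_ij \<gamma> by simp
qed

lemma lim_ij: "AE \<omega> in Prob H. \<omega> \<in> true_hyp i \<longrightarrow> (\<lambda>n. Lam H i j n \<omega> / ereal (real n)) \<longlonglongrightarrow> ereal \<gamma>"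
  using lim_l[OF j] unfolding AE_cond_law[OF i] l_ij \<gamma> .

lemma cls_j: "cls H j \<noteq> {}"
  by (rule limit_class_nonempty[OF nd i j lim_ij])

lemma Lam_ij_finite: "AE \<omega> in Prob H. \<omega> \<in> true_hyp i \<longrightarrow> (\<forall>n\<ge>1. Lam H i j n \<omega> \<noteq> \<infinity>)"
  by (rule Lam_AE_finite[OF nd i j lim_ij])

lemma nu_i: "0 < nu H i"
  by (rule nu_pos[OF i])

text \<open>This is where (UI) or (RQ) enters. If the stopping time exceeds a sufficiently large
  \<open>K\<close>, then so does \<open>llr_time\<close>, which does not depend on the thresholds.
  Under (RQ) it also dominates the stopping time and has a small tail moment. Under (UI) the large
  values are handled by uniform integrability, the others by the small probability of a late
  \<open>llr_time\<close>.\<close>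

lemma excess_moment:
  assumes \<delta>: "0 < \<delta>" "\<delta> < \<gamma>" and m: "1 \<le> m" and \<rho>: "0 < \<rho>"
    and js: "js i = j" and cond: "cond_UI H js \<beta> m \<or> cond_RQ H l m"
  shows "\<exists>K0. \<exists>\<epsilon>>0. \<forall>b K. b \<in> small_thresholds H i (\<beta> i) \<epsilon> \<longrightarrow> K0 \<le> K \<longrightarrow>
    (\<forall>k\<in>others H i. - ln (b k) \<le> (\<gamma> - \<delta>) * real K) \<longrightarrow>
    (\<integral>\<^sup>+\<omega>. epowr (ennreal_of_enat (upsilon1 H i b \<omega>)) m * (if enat K < upsilon1 H i b \<omega> then 1 else 0) \<partial>cond_law H i)
      \<le> ennreal (\<rho> * (- ln (b j)) powr m)"
proof -
  let ?T = "llr_time (lmin H l i) i \<delta>"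
  have ne: "others H i \<noteq> {}" using j by auto
  have T_meas: "?T \<in> measurable (Prob H) (count_space UNIV)" by (rule llr_time_measurable[OF ne])
  have T_fin: "AE \<omega> in cond_law H i. ?T \<omega> \<noteq> \<infinity>"
    by (rule llr_time_finite[OF i ne \<delta>(1) \<gamma> lim_l])
  have late: "enat K < ?T \<omega>" "upsilon1 H i b \<omega> \<le> ?T \<omega>"
    if K: "\<forall>k\<in>others H i. - ln (b k) \<le> (\<gamma> - \<delta>) * real K" and u: "enat K < upsilon1 H i b \<omega>" for b K \<omega>
  proof -
    show lt: "enat K < ?T \<omega>"
    proof (rule ccontr)
      assume "\<not> enat K < ?T \<omega>"
      then have "upsilon1 H i b \<omega> \<le> enat K"
        using K by (intro upsilon1_le_llr_time[where \<gamma>=\<gamma> and \<delta>=\<delta>]) (auto simp: \<gamma>)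
      then show False using u by simp
    qed
    show "upsilon1 H i b \<omega> \<le> ?T \<omega>"
    proof (cases "?T \<omega>")
      case (enat N)
      have "- ln (b k) \<le> (\<gamma> - \<delta>) * real N" if "k \<in> others H i" for k
      proof -
        have "- ln (b k) \<le> (\<gamma> - \<delta>) * real K" using K that by auto
        also have "\<dots> \<le> (\<gamma> - \<delta>) * real N" using lt enat \<delta> by (intro mult_left_mono) auto
        finally show ?thesis .
      qed
      then show ?thesis
        using enat upsilon1_le_llr_time[where \<gamma>=\<gamma> and i=i and \<delta>=\<delta> and \<omega>=\<omega> and K=N and b=b] by (simp add: \<gamma>)
    qed simp
  qed
  show ?thesis
    using cond
  proof
    assume "cond_RQ H l m"
    then have int: "(\<integral>\<^sup>+\<omega>. epowr (ennreal_of_enat (?T \<omega>)) m \<partial>cond_law H i) < \<infinity>"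
      using i \<delta> by (auto simp: cond_RQ_def quick_liminf_ge_def)
    have "\<forall>\<^sub>F K in sequentially. (\<integral>\<^sup>+\<omega>. epowr (ennreal_of_enat (?T \<omega>)) m * (if enat K < ?T \<omega> then 1 else 0) \<partial>cond_law H i) < ennreal \<rho>"
      by (rule order_tendstoD(2)[OF tail_integral_vanishes[OF i T_meas T_fin, of "\<lambda>t. epowr (ennreal_of_enat t) m", OF int]])
         (use \<rho> in simp)
    then obtain K0 where K0: "\<And>K. K0 \<le> K \<Longrightarrow>
        (\<integral>\<^sup>+\<omega>. epowr (ennreal_of_enat (?T \<omega>)) m * (if enat K < ?T \<omega> then 1 else 0) \<partial>cond_law H i) < ennreal \<rho>"
      by (auto simp: eventually_sequentially)
    show ?thesis
    proof (intro exI[of _ K0] exI[of _ "exp (- 1)"] conjI allI impI)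
      fix b K assume b: "b \<in> small_thresholds H i (\<beta> i) (exp (- 1))" and K: "K0 \<le> K"
        "\<forall>k\<in>others H i. - ln (b k) \<le> (\<gamma> - \<delta>) * real K"
      have "(\<integral>\<^sup>+\<omega>. epowr (ennreal_of_enat (upsilon1 H i b \<omega>)) m * (if enat K < upsilon1 H i b \<omega> then 1 else 0) \<partial>cond_law H i)
        \<le> (\<integral>\<^sup>+\<omega>. epowr (ennreal_of_enat (?T \<omega>)) m * (if enat K < ?T \<omega> then 1 else 0) \<partial>cond_law H i)"
      proof (rule nn_integral_mono)
        fix \<omega>
        show "epowr (ennreal_of_enat (upsilon1 H i b \<omega>)) m * (if enat K < upsilon1 H i b \<omega> then 1 else 0)
            \<le> epowr (ennreal_of_enat (?T \<omega>)) m * (if enat K < ?T \<omega> then 1 else 0)"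
          using late[OF K(2), of \<omega>] m by (cases "enat K < upsilon1 H i b \<omega>") (auto intro!: epowr_mono)
      qed
      also have "\<dots> \<le> ennreal \<rho>" using K0[OF K(1)] by simp
      \<comment> \<open>Here the error does not grow at all; thresholds below
        \<open>exp (- 1)\<close> have \<open>- ln (b j) \<ge> 1\<close>, so the growing bound covers
        it.\<close>
      also have "\<dots> \<le> ennreal (\<rho> * (- ln (b j)) powr m)"
      proof (rule ennreal_leI)
        have "0 < b j" "b j < exp (- 1)" using b j by (auto simp: small_thresholds_def)
        then have "1 \<le> - ln (b j)" using ln_less_cancel_iff[of "b j" "exp (- 1)"] by simp
        then have "1 \<le> (- ln (b j)) powr m" using m by (intro ge_one_powr_ge_zero) auto
        then show "\<rho> \<le> \<rho> * (- ln (b j)) powr m" using \<rho> by simp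
      qed
      finally show "(\<integral>\<^sup>+\<omega>. epowr (ennreal_of_enat (upsilon1 H i b \<omega>)) m * (if enat K < upsilon1 H i b \<omega> then 1 else 0) \<partial>cond_law H i)
        \<le> ennreal (\<rho> * (- ln (b j)) powr m)" .
    qed simp
  next
    let ?Z = "\<lambda>b \<omega>. epowr (ennreal_of_enat (upsilon1 H i b \<omega>) / ennreal (- ln (b j))) m"
    assume "cond_UI H js \<beta> m"
    then obtain \<epsilon> where \<epsilon>: "0 < \<epsilon>" "\<epsilon> \<le> 1"
      and ui: "uniformly_integrable (cond_law H i) (small_thresholds H i (\<beta> i) \<epsilon>) ?Z"
      using i js by (auto simp: cond_UI_def)
    let ?tail = "\<lambda>k b. \<integral>\<^sup>+\<omega>. ?Z b \<omega> * indicator {\<omega>. ennreal k < ?Z b \<omega>} \<omega> \<partial>cond_law H i"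
    have "((\<lambda>k::real. SUP b\<in>small_thresholds H i (\<beta> i) \<epsilon>. ?tail k b) \<longlongrightarrow> 0) at_top"
      using ui by (simp add: uniformly_integrable_def)
    then have "\<forall>\<^sub>F k in at_top. (SUP b\<in>small_thresholds H i (\<beta> i) \<epsilon>. ?tail k b) < ennreal (\<rho>/2)"
      by (rule order_tendstoD(2)) (use \<rho> in simp)
    then have "\<forall>\<^sub>F k in at_top. 0 < k \<and> (SUP b\<in>small_thresholds H i (\<beta> i) \<epsilon>. ?tail k b) < ennreal (\<rho>/2)"
      using eventually_gt_at_top[of "0::real"] by eventually_elim simp
    then obtain k0 :: real where k0: "0 < k0" "(SUP b\<in>small_thresholds H i (\<beta> i) \<epsilon>. ?tail k0 b) < ennreal (\<rho>/2)"
      by (metis (no_types, lifting) eventually_at_top_linorder order.refl)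
    let ?PT = "\<lambda>K. \<integral>\<^sup>+\<omega>. 1 * (if enat K < ?T \<omega> then 1 else 0) \<partial>cond_law H i"
    interpret P: prob_space "cond_law H i" by (rule prob_space_cond_law[OF i])
    have "\<forall>\<^sub>F K in sequentially. ?PT K < ennreal (\<rho>/(2 * k0))"
      by (rule order_tendstoD(2)[OF tail_integral_vanishes[OF i T_meas T_fin, of "\<lambda>_. 1"]])
         (use \<rho> k0 P.emeasure_space_1 in simp_all)
    then obtain K0 where K0: "\<And>K. K0 \<le> K \<Longrightarrow> ?PT K < ennreal (\<rho>/(2 * k0))"
      by (auto simp: eventually_sequentially)
    show ?thesis
    proof (intro exI[of _ K0] exI[of _ \<epsilon>] conjI allI impI \<epsilon>)
      fix b K assume b: "b \<in> small_thresholds H i (\<beta> i) \<epsilon>" and K: "K0 \<le> K"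
        "\<forall>k\<in>others H i. - ln (b k) \<le> (\<gamma> - \<delta>) * real K"
      let ?U = "\<lambda>\<omega>. ennreal_of_enat (upsilon1 H i b \<omega>)"
      define L where "L = - ln (b j)"
      have "0 < b j" "b j < 1" using b j \<epsilon> by (fastforce simp: small_thresholds_def)+
      then have L: "0 < L" by (simp add: L_def)
      have Z_meas: "(\<lambda>\<omega>. ?Z b \<omega> * indicator {\<omega>. ennreal k0 < ?Z b \<omega>} \<omega>) \<in> borel_measurable (cond_law H i)"
      proof -
        have [measurable]: "?Z b \<in> borel_measurable (cond_law H i)"
          using ui b by (simp add: uniformly_integrable_def)
        have "(\<lambda>\<omega>. ?Z b \<omega> * (if ennreal k0 < ?Z b \<omega> then 1 else 0)) \<in> borel_measurable (cond_law H i)"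
          by measurable
        then show ?thesis by (rule measurable_cong[THEN iffD1, rotated]) auto
      qed
      have T_ind: "(\<lambda>\<omega>. if enat K < ?T \<omega> then 1 else 0 :: ennreal) \<in> borel_measurable (cond_law H i)"
        using measurable_of_time[OF T_meas, of "\<lambda>t. if enat K < t then 1 else 0"] by measurable
      have U: "epowr (?U \<omega>) m = ennreal (L powr m) * ?Z b \<omega>" for \<omega>
      proof -
        have "ennreal L * (?U \<omega> / ennreal L) = ?U \<omega>"
          using L by (simp add: ennreal_times_divide mult.commute[of "ennreal L"] ennreal_mult_divide_eq)
        then show ?thesis
          using epowr_mult_ennreal[OF L, of "?U \<omega> / ennreal L" m] by (simp add: L_def)
      qed
      have "(\<integral>\<^sup>+\<omega>. epowr (?U \<omega>) m * (if enat K < upsilon1 H i b \<omega> then 1 else 0) \<partial>cond_law H i)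
        \<le> (\<integral>\<^sup>+\<omega>. ennreal (L powr m) * (?Z b \<omega> * indicator {\<omega>. ennreal k0 < ?Z b \<omega>} \<omega>
            + ennreal k0 * (if enat K < ?T \<omega> then 1 else 0)) \<partial>cond_law H i)"
      proof (rule nn_integral_mono)
        fix \<omega>
        \<comment> \<open>Either \<open>?Z\<close> is above \<open>k0\<close> and counted in the
          uniformly integrable tail, or it is at most \<open>k0\<close> on an event contained in
          \<open>K < ?T\<close>.\<close>
        have "?Z b \<omega> * (if enat K < upsilon1 H i b \<omega> then 1 else 0)
            \<le> ?Z b \<omega> * indicator {\<omega>. ennreal k0 < ?Z b \<omega>} \<omega> + ennreal k0 * (if enat K < ?T \<omega> then 1 else 0)"
          using late(1)[OF K(2), of \<omega>]
          by (cases "enat K < upsilon1 H i b \<omega>"; cases "ennreal k0 < ?Z b \<omega>") (auto simp: add_increasing2)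
        then show "epowr (?U \<omega>) m * (if enat K < upsilon1 H i b \<omega> then 1 else 0)
            \<le> ennreal (L powr m) * (?Z b \<omega> * indicator {\<omega>. ennreal k0 < ?Z b \<omega>} \<omega>
              + ennreal k0 * (if enat K < ?T \<omega> then 1 else 0))"
          unfolding U mult.assoc by (rule mult_left_mono) simp
      qed
      also have "\<dots> = ennreal (L powr m) * (?tail k0 b + ennreal k0 * ?PT K)"
        using Z_meas T_ind by (simp add: nn_integral_cmult nn_integral_add)
      also have "\<dots> \<le> ennreal (L powr m) * (ennreal (\<rho>/2) + ennreal k0 * ennreal (\<rho>/(2 * k0)))"
      proof (intro mult_left_mono add_mono)
        show "?tail k0 b \<le> ennreal (\<rho>/2)"
          using k0(2) SUP_upper[OF b, of "?tail k0"] by (meson less_imp_le order_trans)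
        show "?PT K \<le> ennreal (\<rho>/(2 * k0))" using K0[OF K(1)] by simp
      qed auto
      also have "\<dots> = ennreal (L powr m * (\<rho>/2 + k0 * (\<rho>/(2 * k0))))"
        using \<rho> k0 by (simp add: ennreal_mult[symmetric] ennreal_plus[symmetric] del: ennreal_plus)
      also have "L powr m * (\<rho>/2 + k0 * (\<rho>/(2 * k0))) = \<rho> * (- ln (b j)) powr m"
        using k0 by (simp add: L_def)
      finally show "(\<integral>\<^sup>+\<omega>. epowr (?U \<omega>) m * (if enat K < upsilon1 H i b \<omega> then 1 else 0) \<partial>cond_law H i)
          \<le> ennreal (\<rho> * (- ln (b j)) powr m)" .
    qed
  qed
qed

section \<open>The bounds belonging to the fixed hypothesis and their thresholds\<close>

definition good_bounds :: "('y \<Rightarrow> nat \<Rightarrow> real) \<Rightarrow> bool" where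
  "good_bounds R \<longleftrightarrow> (\<forall>k\<in>hyps H. (\<forall>y\<in>UNIV - cls H k. 0 < R y k) \<and>
     Min ((\<lambda>y. R y k) ` (UNIV - cls H k)) / Max ((\<lambda>y. R y k) ` (UNIV - cls H k)) > \<beta> k)"

lemma eventually_bounds_to_0I:
  assumes "0 < \<eta>" and "\<And>R. good_bounds R \<Longrightarrow> bound_norm H R < \<eta> \<Longrightarrow> Q R"
  shows "eventually Q (bounds_to_0 H \<beta>)"
proof -
  have "\<forall>\<^sub>F x in at_right 0. x < \<eta>" by (rule order_tendstoD(2)[OF tendsto_ident_at assms(1)])
  then have "\<forall>\<^sub>F R in filtercomap (bound_norm H) (at_right 0). bound_norm H R < \<eta>"
    by (rule eventually_filtercomapI)
  then show ?thesis
    unfolding bounds_to_0_def eventually_inf_principal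
    by (rule eventually_mono) (use assms(2) in \<open>auto simp: good_bounds_def\<close>)
qed

lemma eventually_good: "eventually good_bounds (bounds_to_0 H \<beta>)"
  by (rule eventually_bounds_to_0I[of 1]) auto

definition row_min :: "('y \<Rightarrow> nat \<Rightarrow> real) \<Rightarrow> real" where
  "row_min R = Min ((\<lambda>y. R y i) ` (UNIV - cls H i))"

definition row_max :: "('y \<Rightarrow> nat \<Rightarrow> real) \<Rightarrow> real" where
  "row_max R = Max ((\<lambda>y. R y i) ` (UNIV - cls H i))"

lemma other_cls: "k \<in> others H i \<Longrightarrow> y \<in> cls H k \<Longrightarrow> y \<in> UNIV - cls H i"
  using cls_unique[of y k i] hyps_le(1)[OF i] by (auto simp: others_def)

lemma row_nonempty: "UNIV - cls H i \<noteq> {}"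
  using other_cls[OF j] cls_j by blast

lemma row_min_pos: "good_bounds R \<Longrightarrow> 0 < row_min R"
  unfolding row_min_def good_bounds_def using i row_nonempty by (subst Min_gr_iff) auto

lemma row_min_le: "y \<in> UNIV - cls H i \<Longrightarrow> row_min R \<le> R y i"
  unfolding row_min_def by (rule Min_le) auto

lemma le_row_max: "y \<in> UNIV - cls H i \<Longrightarrow> R y i \<le> row_max R"
  unfolding row_max_def by (rule Max_ge) auto

lemma row_max_pos: "good_bounds R \<Longrightarrow> 0 < row_max R"
  using row_min_pos row_min_le le_row_max row_nonempty by (metis ex_in_conv order.strict_trans2)

lemma row_ratio: "good_bounds R \<Longrightarrow> \<beta> i * row_max R < row_min R"
proof -
  assume R: "good_bounds R"
  then have "\<beta> i < row_min R / row_max R"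
    unfolding good_bounds_def row_min_def row_max_def using i by blast
  then show ?thesis using row_max_pos[OF R] by (simp add: pos_less_divide_eq)
qed

lemma le_bound_norm: "k \<in> hyps H \<Longrightarrow> y \<in> UNIV - cls H k \<Longrightarrow> R y k \<le> bound_norm H R"
  unfolding bound_norm_def
proof (rule Max_ge)
  have "{R y k |y k. k \<in> hyps H \<and> y \<in> UNIV - cls H k} \<subseteq> (\<lambda>(y, k). R y k) ` (UNIV \<times> hyps H)" by auto
  then show "finite {R y k |y k. k \<in> hyps H \<and> y \<in> UNIV - cls H k}"
    by (rule finite_subset) auto
qed auto

lemma row_max_le_norm: "row_max R \<le> bound_norm H R"
  unfolding row_max_def using row_nonempty le_bound_norm[OF i] by (subst Max_le_iff) auto

lemma threshold_bounds:
  assumes "k \<in> others H i" "cls H k \<noteq> {}"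
  shows "row_min R / nu H i \<le> thresholds H R i k" "thresholds H R i k \<le> row_max R / nu H i"
proof -
  have "Min ((\<lambda>y. R y i) ` cls H k) \<in> (\<lambda>y. R y i) ` cls H k"
    using assms(2) by (intro Min_in) auto
  then obtain y where "y \<in> cls H k" "Min ((\<lambda>y. R y i) ` cls H k) = R y i" by auto
  then show "row_min R / nu H i \<le> thresholds H R i k" "thresholds H R i k \<le> row_max R / nu H i"
    using row_min_le[OF other_cls[OF assms(1)]] le_row_max[OF other_cls[OF assms(1)]] nu_i
    by (auto simp: thresholds_def divide_le_cancel)
qed

text \<open>\<open>small_thresholds\<close> constrains every index in \<open>others H i\<close>, so
  the index of an empty class needs a genuine value; that of \<open>j\<close> is available by
  \<open>cls_j\<close>.\<close>

definition thr :: "('y \<Rightarrow> nat \<Rightarrow> real) \<Rightarrow> nat \<Rightarrow> real" where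
  "thr R k = thresholds H R i (if cls H k = {} then j else k)"

definition log_thr :: "('y \<Rightarrow> nat \<Rightarrow> real) \<Rightarrow> real" where
  "log_thr R = - ln (thr R j)"

lemma thr_bounds:
  assumes "k \<in> others H i"
  shows "row_min R / nu H i \<le> thr R k" "thr R k \<le> row_max R / nu H i"
  unfolding thr_def using threshold_bounds assms j cls_j by auto

lemma thr_pos: "good_bounds R \<Longrightarrow> k \<in> others H i \<Longrightarrow> 0 < thr R k"
  using thr_bounds(1) row_min_pos nu_i by (metis divide_pos_pos order.strict_trans2)

text \<open>Every threshold lies between the extreme bounds of the row divided by
  \<open>nu H i\<close>, so the ratio condition with \<open>\<beta> i\<close> passes from the bounds
  to the thresholds.\<close>

lemma thr_small:
  assumes R: "good_bounds R" and small: "bound_norm H R < \<epsilon> * nu H i"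
  shows "thr R \<in> small_thresholds H i (\<beta> i) \<epsilon>"
proof -
  have ne: "others H i \<noteq> {}" using j by auto
  have "thr R k < \<epsilon>" if "k \<in> others H i" for k
  proof -
    have "row_max R / nu H i < \<epsilon>"
      using small row_max_le_norm[of R] nu_i by (simp add: pos_divide_less_eq)
    then show ?thesis using thr_bounds(2)[OF that, of R] by simp
  qed
  moreover have "\<beta> i < Min (thr R ` others H i) / Max (thr R ` others H i)"
  proof -
    have "row_min R / nu H i \<le> Min (thr R ` others H i)"
      using ne thr_bounds(1) by (subst Min_ge_iff) auto
    moreover have "Max (thr R ` others H i) \<le> row_max R / nu H i"
      using ne thr_bounds(2) by (subst Max_le_iff) auto
    moreover have "0 < Max (thr R ` others H i)"
      using ne thr_pos[OF R] by (subst Max_gr_iff) auto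
    ultimately have "(row_min R / nu H i) / (row_max R / nu H i) \<le> Min (thr R ` others H i) / Max (thr R ` others H i)"
      using row_min_pos[OF R] nu_i by (intro frac_le) (auto intro: less_imp_le order_trans[rotated])
    moreover have "\<beta> i < row_min R / row_max R"
      using row_ratio[OF R] row_max_pos[OF R] by (simp add: pos_less_divide_eq)
    ultimately show ?thesis using nu_i by simp
  qed
  ultimately show ?thesis using thr_pos[OF R] by (simp add: small_thresholds_def)
qed

text \<open>Comparability by the factor \<open>\<beta> i\<close> becomes an additive constant after
  taking logarithms, negligible against \<open>log_thr R\<close>.\<close>

lemma thr_log_le:
  assumes R: "good_bounds R" and k: "k \<in> others H i"
  shows "- ln (thr R k) \<le> log_thr R - ln (\<beta> i)"
proof -
  have "\<beta> i * thr R j \<le> \<beta> i * (row_max R / nu H i)"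
    using thr_bounds(2)[OF j, of R] \<beta>[OF i] by (intro mult_left_mono) auto
  also have "\<dots> \<le> row_min R / nu H i"
    using row_ratio[OF R] nu_i by (simp add: divide_right_mono)
  also have "\<dots> \<le> thr R k" by (rule thr_bounds(1)[OF k])
  finally have "ln (\<beta> i * thr R j) \<le> ln (thr R k)"
    using \<beta>[OF i] thr_pos[OF R] j k by (subst ln_le_cancel_iff) auto
  then show ?thesis using \<beta>[OF i] thr_pos[OF R j] by (simp add: log_thr_def ln_mult)
qed

lemma log_thr_at_top: "\<forall>\<^sub>F R in bounds_to_0 H \<beta>. b0 \<le> log_thr R"
proof (rule eventually_bounds_to_0I)
  show "0 < exp (- b0) * nu H i" using nu_i by simp
  fix R assume R: "good_bounds R" "bound_norm H R < exp (- b0) * nu H i"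
  have "thr R j < exp (- b0)"
    using thr_small[OF R] j by (simp add: small_thresholds_def)
  then have "ln (thr R j) < ln (exp (- b0))"
    using thr_pos[OF R(1) j] by (subst ln_less_cancel_iff) auto
  then show "b0 \<le> log_thr R" by (simp add: log_thr_def)
qed

text \<open>If \<open>cls H 0\<close> is empty, its unspecified threshold may be replaced by the one of \<open>j\<close>.\<close>

lemma upsilon1_thr: "AE \<omega> in cond_law H i. upsilon1 H i (thresholds H R i) \<omega> = upsilon1 H i (thr R) \<omega>"
proof (cases "cls H 0 = {}")
  case True
  have "AE \<omega> in cond_law H i. \<forall>n\<ge>1. Lam H i 0 n \<omega> = \<infinity>"
    by (rule AE_cond_lawI[OF i Lam_transient_empty[OF nd i True]])
  then show ?thesis
  proof eventually_elim
    case (elim \<omega>)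
    have "ereal (- ln (thresholds H R i k)) < Lam H i k n \<omega> \<longleftrightarrow> ereal (- ln (thr R k)) < Lam H i k n \<omega>"
      if k: "k \<in> others H i" and n: "1 \<le> n" for n k
    proof (cases "k = 0")
      case False
      then have "k \<in> hyps H" using k by (auto simp: others_def hyps_def)
      then have "cls H k \<noteq> {}"
        using hyp_class_nonempty by blast
      then show ?thesis by (simp add: thr_def)
    qed (use elim n in auto)
    then show ?case unfolding upsilon1_def by (intro arg_cong[of _ _ Inf]) blast
  qed
next
  case False
  have "thresholds H R i k = thr R k" if k: "k \<in> others H i" for k
  proof (cases "k = 0")
    case 0: False
    then have "k \<in> hyps H" using k by (auto simp: others_def hyps_def)
    then show ?thesis using hyp_class_nonempty by (simp add: thr_def)
  qed (use False in \<open>simp add: thr_def\<close>)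
  then have "upsilon1 H i (thresholds H R i) \<omega> = upsilon1 H i (thr R) \<omega>" for \<omega>
    unfolding upsilon1_def by simp
  then show ?thesis by simp
qed

lemma risk_sum_le:
  assumes s: "s \<in> admissible H R" and k: "k \<in> hyps H" and x: "\<And>y. y \<in> - cls H k \<Longrightarrow> R y k \<le> x" and "0 \<le> x"
  shows "prob (risk_event s k (- cls H k)) \<le> real CARD('y) * x"
proof -
  have "s \<in> strategies H" using s by (simp add: admissible_def)
  then have "prob (risk_event s k (- cls H k)) = (\<Sum>y\<in>- cls H k. risk H y k s)"
    by (rule risk_event_sum_risk[OF _ k])
  also have "\<dots> \<le> (\<Sum>y\<in>- cls H k. x)"
    using s k x by (intro sum_mono) (force simp: admissible_def)
  also have "\<dots> \<le> (\<Sum>y\<in>(UNIV::'y set). x)" by (rule sum_mono2) (use \<open>0 \<le> x\<close> in auto)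
  finally show ?thesis by simp
qed

text \<open>The three terms of \<open>early_stopping_bound\<close> each get a third of
  \<open>\<rho> * nu H i\<close>. None of the estimates depends on the strategy beyond its
  admissibility, so the bound is uniform.\<close>

lemma early_stopping_rare:
  assumes \<epsilon>: "0 < \<epsilon>" "\<epsilon> < 1" and \<rho>: "0 < \<rho>"
  shows "\<forall>\<^sub>F R in bounds_to_0 H \<beta>. \<forall>s\<in>admissible H R.
    emeasure (cond_law H i) {\<omega> \<in> space (Prob H). fst s \<omega> \<le> enat (nat \<lfloor>(1 - \<epsilon>) * log_thr R / \<gamma>\<rfloor>)} \<le> ennreal \<rho>"
proof -
  define N where "N = real (card (hyps H)) * real CARD('y)"
  \<comment> \<open>The risk of a wrong decision for \<open>i\<close> is at most
    \<open>C * exp (- b)\<close>: there are at most \<open>CARD('y)\<close> states, every bound is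
    at most \<open>row_min R / \<beta> i\<close>, and
    \<open>row_min R \<le> nu H i * exp (- b)\<close>.\<close>
  define C where "C = real CARD('y) * nu H i / \<beta> i"
  define \<rho>' where "\<rho>' = \<rho> * nu H i / 3"
  have \<rho>': "0 < \<rho>'" using \<rho> nu_i by (simp add: \<rho>'_def)
  let ?E = "\<lambda>k::nat. true_hyp i \<inter> {\<omega> \<in> space (Prob H).
      \<exists>n\<ge>1. ereal ((1 + \<epsilon>/2) * \<gamma> * real n) < Lam H i j n \<omega> \<and> ereal (real k) < Lam H i j n \<omega>}"
  have "(\<lambda>k. prob (?E k)) \<longlonglongrightarrow> 0"
    by (rule Lam_rarely_above_line[OF i \<gamma>_pos _ Lam_ij_finite lim_ij]) (use \<epsilon> in simp)
  then have "\<forall>\<^sub>F k in sequentially. prob (?E k) < \<rho>'"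
    by (rule order_tendstoD(2)) (rule \<rho>')
  then obtain k where k: "prob (?E k) < \<rho>'" by (auto simp: eventually_sequentially)
  have "((\<lambda>b. C * exp (- (\<epsilon>/2) * b)) \<longlongrightarrow> 0) at_top"
    using \<epsilon>(1) by real_asymp
  then have "\<forall>\<^sub>F b in at_top. C * exp (- (\<epsilon>/2) * b) < \<rho>'"
    by (rule order_tendstoD(2)) (rule \<rho>')
  then obtain b1 where b1: "\<And>b. b1 \<le> b \<Longrightarrow> C * exp (- (\<epsilon>/2) * b) < \<rho>'"
    by (auto simp: eventually_at_top_linorder)
  \<comment> \<open>The last two entries ensure that \<open>a\<close> exceeds the level
    \<open>k\<close> and the line at \<open>n = 1\<close>; the latter matters if
    \<open>K = 0\<close>, where time 1 is still examined.\<close>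
  define b0 where "b0 = max (max 0 b1) (max (real k / (1 - \<epsilon>/2)) ((1 + \<epsilon>/2) * \<gamma> / (1 - \<epsilon>/2)))"
  have "\<forall>\<^sub>F R in bounds_to_0 H \<beta>. bound_norm H R < \<rho>' / (N + 1)"
    by (rule eventually_bounds_to_0I[of "\<rho>' / (N + 1)"]) (use \<rho>' in \<open>simp_all add: N_def add_nonneg_pos\<close>)
  then show ?thesis
    using eventually_good log_thr_at_top[of b0]
  proof eventually_elim
    case (elim R)
    define b where "b = log_thr R"
    define K where "K = nat \<lfloor>(1 - \<epsilon>) * b / \<gamma>\<rfloor>"
    define a where "a = (1 - \<epsilon>/2) * b"
    have b: "0 \<le> b" "b1 \<le> b" "real k / (1 - \<epsilon>/2) \<le> b" "(1 + \<epsilon>/2) * \<gamma> / (1 - \<epsilon>/2) \<le> b"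
      using elim(3) by (auto simp: b_def b0_def)
    have a: "real k \<le> a" "(1 + \<epsilon>/2) * \<gamma> \<le> a"
      using b(3,4) \<epsilon> by (auto simp: a_def field_simps)
    have K: "real K \<le> (1 - \<epsilon>) * b / \<gamma>" using b(1) \<epsilon> \<gamma>_pos by (simp add: K_def)
    have line: "(1 + \<epsilon>/2) * \<gamma> * real n \<le> a" if n: "n \<in> {1..max 1 K}" for n
    proof (cases "n \<le> 1")
      case True
      then have "n = 1" using n by simp
      then show ?thesis using a by simp
    next
      case False
      then have "real n \<le> (1 - \<epsilon>) * b / \<gamma>" using n K by (auto simp: max_def split: if_splits)
      then have "(1 + \<epsilon>/2) * \<gamma> * real n \<le> (1 + \<epsilon>/2) * \<gamma> * ((1 - \<epsilon>) * b / \<gamma>)"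
        using \<epsilon> \<gamma>_pos by (intro mult_left_mono) auto
      also have "\<dots> = (1 - \<epsilon>/2 - \<epsilon> * \<epsilon> / 2) * b" using \<gamma>_pos by (simp add: field_simps)
      also have "\<dots> \<le> a" unfolding a_def using b(1) by (intro mult_right_mono) auto
      finally show ?thesis .
    qed
    show ?case
    proof
      fix s assume s: "s \<in> admissible H R"
      then have st: "s \<in> strategies H" by (simp add: admissible_def)
      have norm0: "0 \<le> bound_norm H R"
        using row_max_le_norm[of R] row_max_pos[OF elim(2)] by simp
      have "(\<Sum>k\<in>hyps H. prob (risk_event s k (- cls H k))) \<le> (\<Sum>k\<in>hyps H. real CARD('y) * bound_norm H R)"
        by (intro sum_mono risk_sum_le[OF s] le_bound_norm norm0) auto
      also have "\<dots> = N * bound_norm H R" by (simp add: N_def)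
      also have "\<dots> \<le> (N + 1) * bound_norm H R" using norm0 by (intro mult_right_mono) auto
      also have "\<dots> \<le> \<rho>'" using elim(1) by (simp add: N_def add_nonneg_pos pos_less_divide_eq mult.commute less_imp_le)
      finally have 1: "(\<Sum>k\<in>hyps H. prob (risk_event s k (- cls H k))) \<le> \<rho>'" .
      have "prob (risk_event s i (- cls H i)) \<le> real CARD('y) * row_max R"
      proof (rule risk_sum_le[OF s i])
        show "R y i \<le> row_max R" if "y \<in> - cls H i" for y
          using that by (intro le_row_max) auto
      qed (use row_max_pos[OF elim(2)] in simp)
      also have "row_max R \<le> row_min R / \<beta> i"
        using row_ratio[OF elim(2)] \<beta>[OF i] by (simp add: field_simps)
      also have "row_min R \<le> nu H i * exp (- b)"
        using thr_bounds(1)[OF j, of R] nu_i thr_pos[OF elim(2) j]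
        by (simp add: b_def log_thr_def pos_divide_le_eq mult.commute)
      finally have "prob (risk_event s i (- cls H i)) \<le> C * exp (- b)"
        using \<beta>[OF i] by (simp add: C_def divide_right_mono mult_left_mono mult.assoc)
      then have "exp a * prob (risk_event s i (- cls H i)) \<le> exp a * (C * exp (- b))"
        by (intro mult_left_mono) auto
      also have "\<dots> = C * exp (- (\<epsilon>/2) * b)"
        by (simp add: exp_add[symmetric] a_def algebra_simps)
      also have "\<dots> \<le> \<rho>'" using b1[OF b(2)] by simp
      finally have 2: "exp a * prob (risk_event s i (- cls H i)) \<le> \<rho>'" .
      have E_event: "?E k \<in> events" using true_hyp_event[OF i] by measurable
      have "true_hyp i \<inter> {\<omega> \<in> space (Prob H). \<exists>n\<in>{1..max 1 K}. ereal a < Lam H i j n \<omega>} \<subseteq> ?E k"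
      proof (intro subsetI, elim IntE CollectE conjE bexE, intro IntI CollectI conjI)
        fix \<omega> n assume n: "n \<in> {1..max 1 K}" and L: "ereal a < Lam H i j n \<omega>"
        have "ereal ((1 + \<epsilon>/2) * \<gamma> * real n) < Lam H i j n \<omega>"
          by (rule le_less_trans[OF _ L]) (simp only: ereal_less_eq line[OF n])
        moreover have "ereal (real k) < Lam H i j n \<omega>"
          by (rule le_less_trans[OF _ L]) (simp add: a)
        ultimately show "\<exists>n\<ge>1. ereal ((1 + \<epsilon>/2) * \<gamma> * real n) < Lam H i j n \<omega> \<and> ereal (real k) < Lam H i j n \<omega>"
          using n by auto
      qed
      then have "prob (true_hyp i \<inter> {\<omega> \<in> space (Prob H). \<exists>n\<in>{1..max 1 K}. ereal a < Lam H i j n \<omega>}) \<le> prob (?E k)"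
        using E_event by (rule finite_measure_mono)
      with k have 3: "prob (true_hyp i \<inter> {\<omega> \<in> space (Prob H). \<exists>n\<in>{1..max 1 K}. ereal a < Lam H i j n \<omega>}) \<le> \<rho>'"
        by simp
      have "prob (true_hyp i \<inter> {\<omega> \<in> space (Prob H). fst s \<omega> \<le> enat K}) \<le> \<rho>' + \<rho>' + \<rho>'"
        using early_stopping_bound[OF st i j, of K a] 1 2 3 by linarith
      then have "prob (true_hyp i \<inter> {\<omega> \<in> space (Prob H). fst s \<omega> \<le> enat K}) / nu H i \<le> \<rho>"
        using nu_i by (simp add: \<rho>'_def field_simps)
      moreover have "{\<omega> \<in> space (Prob H). fst s \<omega> \<le> enat K} \<in> events"
        by (rule strategy_stops_by_event[OF st])
      ultimately show "emeasure (cond_law H i) {\<omega> \<in> space (Prob H). fst s \<omega> \<le> enat (nat \<lfloor>(1 - \<epsilon>) * log_thr R / \<gamma>\<rfloor>)} \<le> ennreal \<rho>"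
        unfolding b_def[symmetric] K_def[symmetric] by (simp add: emeasure_cond_law[OF i] ennreal_leI)
    qed
  qed
qed

text \<open>Each state outside \<open>cls H k\<close> lies in some other class, whose threshold is
  the smallest bound there divided by \<open>nu H k\<close>; the factor \<open>nu H k\<close> from
  \<open>least_decision_risk\<close> cancels.\<close>

lemma least_decision_admissible:
  assumes R: "good_bounds R"
  shows "(upsilon H (thresholds H R), least_decision (thresholds H R)) \<in> admissible H R"
proof -
  have ne: "hyps H \<noteq> {}" using i by auto
  have "risk H y k (upsilon H (thresholds H R), least_decision (thresholds H R)) \<le> R y k"
    if k: "k \<in> hyps H" and y: "y \<in> UNIV - cls H k" for k y
  proof -
    obtain k' where k': "k' \<in> others H k" "y \<in> cls H k'"
    proof (cases y rule: cls_cases)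
      case 1
      then show thesis using that[of 0] k by (auto simp: others_def hyps_def)
    next
      case (2 k')
      then show thesis using that[of k'] k y by (auto simp: others_def hyps_def)
    qed
    have "0 < R z k" if z: "z \<in> cls H k'" for z
    proof -
      have "z \<notin> cls H k" using cls_unique[of z k k'] z k' k by (auto simp: others_def hyps_def)
      then show ?thesis using R k by (auto simp: good_bounds_def)
    qed
    then have "0 < Min ((\<lambda>y. R y k) ` cls H k')" using k'(2) by (subst Min_gr_iff) auto
    then have "risk H y k (upsilon H (thresholds H R), least_decision (thresholds H R)) \<le> thresholds H R k k' * nu H k"
      using nu_pos[OF k] by (intro least_decision_risk k k') (auto simp: thresholds_def)
    also have "\<dots> = Min ((\<lambda>y. R y k) ` cls H k')" using nu_pos[OF k] by (simp add: thresholds_def)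
    also have "\<dots> \<le> R y k" using k'(2) by (intro Min_le) auto
    finally show ?thesis .
  qed
  then show ?thesis using least_decision_strategy[OF ne] by (simp add: admissible_def)
qed

section \<open>The delays enclosed between moments at deterministic times\<close>

context
  fixes c :: "'y \<Rightarrow> real" and m C :: real
  assumes c: "\<And>y. 0 \<le> c y" "\<And>y. c y \<le> C" and C: "0 < C" and m: "1 \<le> m"
begin

definition moment :: "nat \<Rightarrow> ennreal" where
  "moment K = (\<integral>\<^sup>+\<omega>. ennreal (cost H c K \<omega> powr m) \<partial>cond_law H i)"

definition strategy_delay :: "('y \<Rightarrow> nat \<Rightarrow> real) \<Rightarrow> ennreal" where
  "strategy_delay R = delay H c m i (upsilon H (thresholds H R))"

definition best_delay :: "('y \<Rightarrow> nat \<Rightarrow> real) \<Rightarrow> ennreal" where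
  "best_delay R = (INF s\<in>admissible H R. delay H c m i (fst s))"

lemma best_le_strategy: "good_bounds R \<Longrightarrow> best_delay R \<le> strategy_delay R"
  unfolding best_delay_def strategy_delay_def
  by (rule INF_lower2[OF least_decision_admissible]) auto

lemma emeasure_cond_law_space: "emeasure (cond_law H i) (space (Prob H)) = 1"
  using prob_space.emeasure_space_1[OF prob_space_cond_law[OF i]] by simp

lemma moment_finite: "moment K < \<infinity>"
proof -
  have "moment K \<le> (\<integral>\<^sup>+\<omega>. ennreal ((C * real K) powr m) \<partial>cond_law H i)"
    unfolding moment_def using c m
    by (intro nn_integral_mono ennreal_leI powr_mono2 cost_le cost_nonneg) auto
  then show ?thesis by (simp add: emeasure_cond_law_space le_less_trans[OF _ ennreal_less_top])
qed

lemma cost_mono: "K \<le> K' \<Longrightarrow> cost H c K \<omega> \<le> cost H c K' \<omega>"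
  unfolding cost_def by (rule sum_mono2) (auto simp: c)

lemma moment_mono: "K \<le> K' \<Longrightarrow> moment K \<le> moment K'"
  unfolding moment_def using m c
  by (intro nn_integral_mono ennreal_leI powr_mono2 cost_mono cost_nonneg) auto

lemma strategy_le_total: "strategy_delay R \<le> (\<integral>\<^sup>+\<omega>. epowr (stopped_cost H c \<infinity> \<omega>) m \<partial>cond_law H i)"
  unfolding strategy_delay_def delay_eq using m
  by (intro nn_integral_mono epowr_mono stopped_cost_mono) auto

lemma strategy_delay_upper:
  "strategy_delay R \<le> moment K + ennreal (C powr m) *
    (\<integral>\<^sup>+\<omega>. epowr (ennreal_of_enat (upsilon1 H i (thr R) \<omega>)) m
      * (if enat K < upsilon1 H i (thr R) \<omega> then 1 else 0) \<partial>cond_law H i)"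
proof -
  let ?h = "\<lambda>\<omega>. epowr (ennreal_of_enat (upsilon1 H i (thr R) \<omega>)) m
      * (if enat K < upsilon1 H i (thr R) \<omega> then 1 else 0)"
  have h: "?h \<in> borel_measurable (cond_law H i)"
    using measurable_of_time[OF upsilon1_measurable[of i "thr R"],
        of "\<lambda>t. epowr (ennreal_of_enat t) m * (if enat K < t then 1 else 0)"] by measurable
  have cm: "(\<lambda>\<omega>. ennreal (cost H c K \<omega> powr m)) \<in> borel_measurable (cond_law H i)" by measurable
  have "strategy_delay R \<le> (\<integral>\<^sup>+\<omega>. ennreal (cost H c K \<omega> powr m) + ennreal (C powr m) * ?h \<omega> \<partial>cond_law H i)"
    unfolding strategy_delay_def delay_eq
  proof (rule nn_integral_mono_AE)
    show "AE \<omega> in cond_law H i. epowr (stopped_cost H c (upsilon H (thresholds H R) \<omega>) \<omega>) m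
        \<le> ennreal (cost H c K \<omega> powr m) + ennreal (C powr m) * ?h \<omega>"
      using upsilon1_thr[of R]
    proof eventually_elim
      case (elim \<omega>)
      have "upsilon H (thresholds H R) \<omega> \<le> upsilon1 H i (thr R) \<omega>"
        unfolding upsilon_def elim[symmetric] using i by (intro Min_le) auto
      then have "epowr (stopped_cost H c (upsilon H (thresholds H R) \<omega>) \<omega>) m
          \<le> epowr (stopped_cost H c (upsilon1 H i (thr R) \<omega>) \<omega>) m"
        using m by (intro epowr_mono stopped_cost_mono) auto
      also have "\<dots> \<le> ennreal (cost H c K \<omega> powr m) + ennreal (C powr m) * ?h \<omega>"
        by (rule epowr_stopped_cost_split) (use c C m in auto)
      finally show ?case .
    qed
  qed
  also have "\<dots> = moment K + ennreal (C powr m) * (\<integral>\<^sup>+\<omega>. ?h \<omega> \<partial>cond_law H i)"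
    unfolding moment_def using h cm by (simp add: nn_integral_add nn_integral_cmult)
  finally show ?thesis .
qed

text \<open>A strategy that stops after \<open>K\<close> pays at least the cost up to
  \<open>K\<close>; stopping earlier saves at most \<open>(C * K) powr m\<close>, on an event of
  probability at most \<open>\<rho>\<close>.\<close>

lemma moment_le_best:
  assumes rare: "\<forall>s\<in>admissible H R. emeasure (cond_law H i) {\<omega> \<in> space (Prob H). fst s \<omega> \<le> enat K} \<le> ennreal \<rho>"
    and \<rho>: "0 \<le> \<rho>"
  shows "moment K \<le> best_delay R + ennreal ((C * real K) powr m * \<rho>)"
proof -
  let ?e = "ennreal ((C * real K) powr m * \<rho>)"
  \<comment> \<open>The error is moved to the left, with truncated subtraction, so that the bound
    passes to the infimum over strategies.\<close>
  have "moment K - ?e \<le> delay H c m i (fst s)" if s: "s \<in> admissible H R" for s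
  proof -
    let ?A = "{\<omega> \<in> space (Prob H). fst s \<omega> \<le> enat K}"
    have \<tau>: "fst s \<in> measurable (Prob H) (count_space UNIV)"
      by (rule strategy_time_measurable) (use s in \<open>simp add: admissible_def\<close>)
    have A: "?A \<in> events"
      by (rule strategy_stops_by_event) (use s in \<open>simp add: admissible_def\<close>)
    have sm: "(\<lambda>\<omega>. epowr (stopped_cost H c (fst s \<omega>) \<omega>) m) \<in> borel_measurable (cond_law H i)"
      using measurable_compose[OF stopped_cost_measurable[OF \<tau>] epowr_measurable] by measurable
    have "moment K \<le> (\<integral>\<^sup>+\<omega>. epowr (stopped_cost H c (fst s \<omega>) \<omega>) m
        + ennreal ((C * real K) powr m) * indicator ?A \<omega> \<partial>cond_law H i)"
      unfolding moment_def
    proof (rule nn_integral_mono)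
      fix \<omega> assume \<omega>: "\<omega> \<in> space (cond_law H i)"
      show "ennreal (cost H c K \<omega> powr m) \<le> epowr (stopped_cost H c (fst s \<omega>) \<omega>) m
          + ennreal ((C * real K) powr m) * indicator ?A \<omega>"
      proof (cases "fst s \<omega> \<le> enat K")
        case True
        have "cost H c K \<omega> powr m \<le> (C * real K) powr m"
          using c m by (intro powr_mono2 cost_le cost_nonneg) auto
        then show ?thesis using True \<omega> by (simp add: ennreal_leI add_increasing)
      next
        case False
        then have "epowr (stopped_cost H c (enat K) \<omega>) m \<le> epowr (stopped_cost H c (fst s \<omega>) \<omega>) m"
          using m by (intro epowr_mono stopped_cost_mono) auto
        then show ?thesis
          using epowr_ennreal[OF cost_nonneg[of c H K \<omega>, OF c(1)], of m]
          by (simp add: stopped_cost_enat c add_increasing2)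
      qed
    qed
    also have "\<dots> = delay H c m i (fst s) + ennreal ((C * real K) powr m) * emeasure (cond_law H i) ?A"
      unfolding delay_eq using sm A by (simp add: nn_integral_add nn_integral_cmult_indicator)
    also have "\<dots> \<le> delay H c m i (fst s) + ennreal ((C * real K) powr m) * ennreal \<rho>"
      using rare s by (intro add_left_mono mult_left_mono) auto
    also have "ennreal ((C * real K) powr m) * ennreal \<rho> = ?e"
      using \<rho> by (simp add: ennreal_mult)
    finally show ?thesis by (simp add: ennreal_minus_le_iff add.commute)
  qed
  then have "moment K - ?e \<le> best_delay R"
    unfolding best_delay_def by (rule INF_greatest)
  then show ?thesis by (simp add: ennreal_minus_le_iff add.commute)
qed

text \<open>Between \<open>K\<close> and \<open>K'\<close> the cost grows by at most
  \<open>C * (K' - K)\<close>. For \<open>K'\<close> of order \<open>b\<close> and a gap of order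
  \<open>\<epsilon> * b\<close>, the tangent bound gives an increment of order
  \<open>\<epsilon> * b^m\<close>.\<close>

lemma moment_increment:
  assumes "K \<le> K'"
  shows "moment K' \<le> moment K + ennreal (m * (C * real (K' - K)) * (C * real K') powr (m - 1))"
proof -
  let ?e = "m * (C * real (K' - K)) * (C * real K') powr (m - 1)"
  have "cost H c K' \<omega> powr m \<le> cost H c K \<omega> powr m + ?e" for \<omega>
  proof -
    define h where "h = cost H c K' \<omega> - cost H c K \<omega>"
    have h0: "0 \<le> h" using cost_mono[OF assms] by (simp add: h_def)
    have "h = (\<Sum>t\<in>{K..<K'}. c (state H t \<omega>))"
      using assms sum_diff_nat_ivl[of 0 K K' "\<lambda>t. c (state H t \<omega>)"]
      by (simp add: h_def cost_def atLeast0LessThan)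
    also have "\<dots> \<le> (\<Sum>t\<in>{K..<K'}. C)" by (intro sum_mono c)
    finally have h: "h \<le> C * real (K' - K)" by (simp add: mult.commute)
    have "cost H c K' \<omega> powr m = (cost H c K \<omega> + h) powr m" by (simp add: h_def)
    also have "\<dots> \<le> cost H c K \<omega> powr m + m * h * (cost H c K \<omega> + h) powr (m - 1)"
      using m h0 c by (intro powr_add_le cost_nonneg)
    also have "m * h * (cost H c K \<omega> + h) powr (m - 1) \<le> ?e"
    proof (intro mult_mono powr_mono2)
      show "cost H c K \<omega> + h \<le> C * real K'" using cost_le[of c C H K' \<omega>] c by (simp add: h_def)
    qed (use m h h0 c C in \<open>auto simp: cost_nonneg\<close>)
    finally show ?thesis by simp
  qed
  then have "moment K' \<le> (\<integral>\<^sup>+\<omega>. ennreal (cost H c K \<omega> powr m) + ennreal ?e \<partial>cond_law H i)"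
    unfolding moment_def using m C
    by (intro nn_integral_mono) (simp add: ennreal_plus[symmetric] ennreal_leI del: ennreal_plus)
  also have "\<dots> = moment K + ennreal ?e"
    unfolding moment_def by (subst nn_integral_add) (auto simp: emeasure_cond_law_space)
  finally show ?thesis .
qed

lemma best_ge_moment:
  assumes \<epsilon>: "0 < \<epsilon>" "\<epsilon> < 1" and \<rho>: "0 < \<rho>"
  shows "\<forall>\<^sub>F R in bounds_to_0 H \<beta>. moment (nat \<lfloor>(1 - \<epsilon>) * log_thr R / \<gamma>\<rfloor>)
    \<le> best_delay R + ennreal (\<rho> * log_thr R powr m)"
proof -
  define \<rho>' where "\<rho>' = \<rho> / (C / \<gamma>) powr m"
  have \<rho>': "0 < \<rho>'" using \<rho> C \<gamma>_pos by (simp add: \<rho>'_def)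
  show ?thesis
    using early_stopping_rare[OF \<epsilon> \<rho>'] log_thr_at_top[of 0]
  proof eventually_elim
    case (elim R)
    let ?K = "nat \<lfloor>(1 - \<epsilon>) * log_thr R / \<gamma>\<rfloor>"
    have "real ?K \<le> (1 - \<epsilon>) * log_thr R / \<gamma>" using elim(2) \<epsilon> \<gamma>_pos by simp
    also have "\<dots> \<le> 1 * log_thr R / \<gamma>"
      using elim(2) \<epsilon> \<gamma>_pos by (intro divide_right_mono mult_right_mono) auto
    finally have "C * real ?K \<le> C * (log_thr R / \<gamma>)" using C by (intro mult_left_mono) auto
    then have "(C * real ?K) powr m \<le> (C / \<gamma> * log_thr R) powr m"
      using C m by (intro powr_mono2) auto
    also have "\<dots> = (C / \<gamma>) powr m * log_thr R powr m" by (rule powr_mult)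
    finally have "(C * real ?K) powr m * \<rho>' \<le> (C / \<gamma>) powr m * log_thr R powr m * \<rho>'"
      using \<rho>' by (intro mult_right_mono) auto
    also have "\<dots> = \<rho> * log_thr R powr m" using C \<gamma>_pos by (simp add: \<rho>'_def)
    finally have "ennreal ((C * real ?K) powr m * \<rho>') \<le> ennreal (\<rho> * log_thr R powr m)"
      by (rule ennreal_leI)
    then show ?case
      using moment_le_best[OF elim(1)] \<rho>' by (meson add_left_mono less_imp_le order_trans)
  qed
qed

lemma strategy_le_moment:
  assumes \<epsilon>: "0 < \<epsilon>" and \<rho>: "0 < \<rho>" and js: "js i = j" and cond: "cond_UI H js \<beta> m \<or> cond_RQ H l m"
  shows "\<forall>\<^sub>F R in bounds_to_0 H \<beta>. strategy_delay R
    \<le> moment (nat \<lceil>(1 + \<epsilon>) * log_thr R / \<gamma>\<rceil>) + ennreal (\<rho> * log_thr R powr m)"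
proof -
  \<comment> \<open>Chosen so that \<open>(\<gamma> - \<delta>) * (1 + \<epsilon>) = \<gamma> * (1 +
    \<epsilon>/2)\<close>: the remaining \<open>\<epsilon>/2 * b\<close> absorbs the shift
    \<open>- ln (\<beta> i)\<close> between the thresholds.\<close>
  define \<delta> where "\<delta> = \<gamma> * (\<epsilon>/2) / (1 + \<epsilon>)"
  have "\<gamma> * (\<epsilon>/2) < \<gamma> * (1 + \<epsilon>)" using \<epsilon> \<gamma>_pos by (intro mult_strict_left_mono) auto
  then have \<delta>: "0 < \<delta>" "\<delta> < \<gamma>" using \<epsilon> \<gamma>_pos by (auto simp: \<delta>_def pos_divide_less_eq)
  define \<rho>' where "\<rho>' = \<rho> / C powr m"
  have \<rho>': "0 < \<rho>'" using \<rho> C by (simp add: \<rho>'_def)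
  obtain K0 \<eta> where \<eta>: "0 < \<eta>" and excess: "\<And>b K. b \<in> small_thresholds H i (\<beta> i) \<eta> \<Longrightarrow> K0 \<le> K \<Longrightarrow>
    (\<forall>k\<in>others H i. - ln (b k) \<le> (\<gamma> - \<delta>) * real K) \<Longrightarrow>
    (\<integral>\<^sup>+\<omega>. epowr (ennreal_of_enat (upsilon1 H i b \<omega>)) m * (if enat K < upsilon1 H i b \<omega> then 1 else 0) \<partial>cond_law H i)
      \<le> ennreal (\<rho>' * (- ln (b j)) powr m)"
    using excess_moment[OF \<delta> m \<rho>' js cond] by blast
  have "\<forall>\<^sub>F R in bounds_to_0 H \<beta>. thr R \<in> small_thresholds H i (\<beta> i) \<eta>"
    by (rule eventually_bounds_to_0I[of "\<eta> * nu H i"]) (use \<eta> nu_i thr_small in auto)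
  then show ?thesis
    using eventually_good log_thr_at_top[of "max 0 (max (\<gamma> * real K0) (- ln (\<beta> i) / (\<epsilon>/2)))"]
  proof eventually_elim
    case (elim R)
    let ?b = "log_thr R"
    let ?K = "nat \<lceil>(1 + \<epsilon>) * ?b / \<gamma>\<rceil>"
    have b: "0 \<le> ?b" "\<gamma> * real K0 \<le> ?b" "- ln (\<beta> i) / (\<epsilon>/2) \<le> ?b" using elim(3) by auto
    have K: "(1 + \<epsilon>) * ?b / \<gamma> \<le> real ?K" by (rule real_nat_ceiling_ge)
    have "K0 \<le> ?K"
    proof -
      have "real K0 \<le> ?b / \<gamma>" using b(2) \<gamma>_pos by (simp add: pos_le_divide_eq mult.commute)
      also have "\<dots> \<le> (1 + \<epsilon>) * ?b / \<gamma>" using b(1) \<epsilon> \<gamma>_pos by (intro divide_right_mono) (auto simp: algebra_simps)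
      finally show ?thesis using K by linarith
    qed
    moreover have "\<forall>k\<in>others H i. - ln (thr R k) \<le> (\<gamma> - \<delta>) * real ?K"
    proof
      fix k assume k: "k \<in> others H i"
      have "- ln (thr R k) \<le> ?b - ln (\<beta> i)" by (rule thr_log_le[OF elim(2) k])
      also have "\<dots> \<le> ?b + \<epsilon>/2 * ?b" using b(3) \<epsilon> by (simp add: field_simps)
      also have "\<dots> = (\<gamma> - \<delta>) * ((1 + \<epsilon>) * ?b / \<gamma>)"
      proof -
        have "(\<gamma> - \<delta>) * (1 + \<epsilon>) = \<gamma> * (1 + \<epsilon>/2)"
          using \<epsilon> by (simp add: \<delta>_def left_diff_distrib) (simp add: field_simps)
        then have "(\<gamma> - \<delta>) * ((1 + \<epsilon>) * ?b / \<gamma>) = \<gamma> * (1 + \<epsilon>/2) * ?b / \<gamma>"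
          by (metis mult.assoc times_divide_eq_right)
        also have "\<dots> = (1 + \<epsilon>/2) * ?b" using \<gamma>_pos by simp
        also have "\<dots> = ?b + \<epsilon>/2 * ?b" by (simp add: distrib_right)
        finally show ?thesis by (rule sym)
      qed
      also have "\<dots> \<le> (\<gamma> - \<delta>) * real ?K" using K \<delta> by (intro mult_left_mono) auto
      finally show "- ln (thr R k) \<le> (\<gamma> - \<delta>) * real ?K" .
    qed
    ultimately have "(\<integral>\<^sup>+\<omega>. epowr (ennreal_of_enat (upsilon1 H i (thr R) \<omega>)) m
        * (if enat ?K < upsilon1 H i (thr R) \<omega> then 1 else 0) \<partial>cond_law H i) \<le> ennreal (\<rho>' * ?b powr m)"
      unfolding log_thr_def[of R] by (intro excess elim(1)) (auto simp: log_thr_def)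
    then have "strategy_delay R \<le> moment ?K + ennreal (C powr m) * ennreal (\<rho>' * ?b powr m)"
      by (intro order_trans[OF strategy_delay_upper[of R ?K]] add_left_mono mult_left_mono) auto
    also have "ennreal (C powr m) * ennreal (\<rho>' * ?b powr m) = ennreal (\<rho> * ?b powr m)"
      using C \<rho> by (subst ennreal_mult[symmetric]) (auto simp: \<rho>'_def)
    finally show ?case .
  qed
qed

lemma asymp_optimal:
  assumes js: "js i = j" and cond: "cond_UI H js \<beta> m \<or> cond_RQ H l m"
  shows "ennreal_asymp_equiv (bounds_to_0 H \<beta>) strategy_delay best_delay"
proof -
  note upper = strategy_le_moment[OF _ _ js cond]
  have fin: "\<forall>\<^sub>F R in bounds_to_0 H \<beta>. strategy_delay R < \<infinity>"
    using upper[of 1 1]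
    by (auto elim!: eventually_mono intro!: le_less_trans[of "strategy_delay _"] simp: moment_finite[unfolded infinity_ennreal_def] infinity_ennreal_def)
  have ge: "\<forall>\<^sub>F R in bounds_to_0 H \<beta>. best_delay R \<le> strategy_delay R"
    using eventually_good by eventually_elim (rule best_le_strategy)
  show ?thesis
  proof (rule cost_dichotomy[of c i m, OF c(1) i m])
    fix \<kappa> n0 assume \<kappa>: "0 < \<kappa>" and mom0: "\<And>n. n0 \<le> n \<Longrightarrow>
      ennreal (\<kappa> * real n powr m) \<le> (\<integral>\<^sup>+\<omega>. ennreal (cost H c n \<omega> powr m) \<partial>cond_law H i)"
    then have mom: "ennreal (\<kappa> * real n powr m) \<le> moment n" if "n0 \<le> n" for n
      using that by (simp add: moment_def)
    \<comment> \<open>The earlier time \<open>K1\<close> is at least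
      \<open>b / (2 * \<gamma>)\<close>, which turns \<open>\<kappa> * K1^m\<close> into
      \<open>\<kappa>' * b^m\<close>.\<close>
    define \<kappa>' where "\<kappa>' = \<kappa> * (1 / (2 * \<gamma>)) powr m"
    have \<kappa>': "0 < \<kappa>'" using \<kappa> \<gamma>_pos by (simp add: \<kappa>'_def)
    show ?thesis
    proof (rule ennreal_asymp_equiv_additive_error[OF \<kappa>' _ fin ge, of "\<lambda>R. log_thr R powr m"])
      fix \<rho> :: real assume \<rho>: "0 < \<rho>"
      \<comment> \<open>From \<open>K2 - K1 \<le> 4 / \<gamma> * \<epsilon> * b\<close> and
        \<open>K2 \<le> 2 / \<gamma> * b\<close> the increment of the moments is at most
        \<open>D * \<epsilon> * b powr m\<close>.\<close>
      define D where "D = m * (C * (4 / \<gamma>)) * (C * (2 / \<gamma>)) powr (m - 1)"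
      have D: "0 < D" using m C \<gamma>_pos by (simp add: D_def)
      define \<epsilon> where "\<epsilon> = min (1/4) (\<rho> / (2 * D))"
      have \<epsilon>: "0 < \<epsilon>" "\<epsilon> \<le> 1/4" "\<epsilon> < 1" using \<rho> D by (auto simp: \<epsilon>_def)
      have "\<epsilon> \<le> \<rho> / (2 * D)" by (simp add: \<epsilon>_def)
      then have D\<epsilon>: "D * \<epsilon> \<le> \<rho> / 2" using D by (simp add: field_simps)
      have \<rho>4: "0 < \<rho>/4" using \<rho> by simp
      show "\<forall>\<^sub>F R in bounds_to_0 H \<beta>. strategy_delay R \<le> best_delay R + ennreal (\<rho> * log_thr R powr m)
          \<and> ennreal (\<kappa>' * log_thr R powr m) \<le> best_delay R + ennreal (\<rho> * log_thr R powr m)"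
        using upper[OF \<epsilon>(1) \<rho>4] best_ge_moment[OF \<epsilon>(1,3) \<rho>4]
          log_thr_at_top[of "max (\<gamma> / \<epsilon>) (2 * \<gamma> * real n0)"]
      proof eventually_elim
        case (elim R)
        define b where "b = log_thr R"
        define K1 where "K1 = nat \<lfloor>(1 - \<epsilon>) * b / \<gamma>\<rfloor>"
        define K2 where "K2 = nat \<lceil>(1 + \<epsilon>) * b / \<gamma>\<rceil>"
        have b: "\<gamma> / \<epsilon> \<le> b" "2 * \<gamma> * real n0 \<le> b" using elim(3) by (auto simp: b_def)
        have "0 < \<gamma> / \<epsilon>" using \<gamma>_pos \<epsilon> by simp
        then have b0: "0 < b" using b(1) by linarith
        \<comment> \<open>Rounding to integers moves each time by at most 1, hence by at most
          another \<open>\<epsilon> * (b / \<gamma>)\<close>; this explains the factors 2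
          below.\<close>
        have one: "1 \<le> \<epsilon> * (b / \<gamma>)" using b(1) \<gamma>_pos \<epsilon> by (simp add: field_simps)
        have b\<gamma>: "0 < b / \<gamma>" using b0 \<gamma>_pos by simp
        have x: "(1 - \<epsilon>) * b / \<gamma> = b / \<gamma> - \<epsilon> * (b / \<gamma>)" "(1 + \<epsilon>) * b / \<gamma> = b / \<gamma> + \<epsilon> * (b / \<gamma>)"
          by (simp_all add: left_diff_distrib distrib_right diff_divide_distrib add_divide_distrib)
        have quarter: "\<epsilon> * (b / \<gamma>) \<le> 1/4 * (b / \<gamma>)" using \<epsilon>(2) b\<gamma> by (intro mult_right_mono) auto
        have K1: "b / \<gamma> - 2 * (\<epsilon> * (b / \<gamma>)) \<le> real K1" "real K1 \<le> b / \<gamma>"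
          unfolding K1_def x using one quarter b\<gamma> by linarith+
        have K2: "real K2 \<le> b / \<gamma> + 2 * (\<epsilon> * (b / \<gamma>))" "b / \<gamma> \<le> real K2"
          unfolding K2_def x using one b\<gamma> by linarith+
        have K12: "K1 \<le> K2" using K1 K2 by linarith
        have d: "real (K2 - K1) \<le> 4 / \<gamma> * \<epsilon> * b"
          using K1 K2 K12 by (simp add: of_nat_diff)
        have K2': "real K2 \<le> 2 / \<gamma> * b" using K2(1) quarter b\<gamma> by simp
        have "m * (C * real (K2 - K1)) * (C * real K2) powr (m - 1)
            \<le> m * (C * (4 / \<gamma> * \<epsilon> * b)) * (C * (2 / \<gamma> * b)) powr (m - 1)"
          using m C d K2' b0 \<epsilon> \<gamma>_pos by (intro mult_mono mult_left_mono powr_mono2) auto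
        also have "(C * (2 / \<gamma> * b)) powr (m - 1) = (C * (2 / \<gamma>)) powr (m - 1) * b powr (m - 1)"
          using powr_mult[of "C * (2 / \<gamma>)" b "m - 1"] by (simp only: mult.assoc)
        also have "m * (C * (4 / \<gamma> * \<epsilon> * b)) * ((C * (2 / \<gamma>)) powr (m - 1) * b powr (m - 1))
            = D * \<epsilon> * (b * b powr (m - 1))" by (simp add: D_def mult_ac)
        also have "b * b powr (m - 1) = b powr m" using b0 by (simp add: powr_diff)
        also have "D * \<epsilon> * b powr m \<le> \<rho> / 2 * b powr m" using D\<epsilon> by (intro mult_right_mono) auto
        finally have inc: "moment K2 \<le> moment K1 + ennreal (\<rho> / 2 * b powr m)"
          by (intro order_trans[OF moment_increment[OF K12]] add_left_mono ennreal_leI)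
        have up: "strategy_delay R \<le> moment K2 + ennreal (\<rho>/4 * b powr m)"
          and lo: "moment K1 \<le> best_delay R + ennreal (\<rho>/4 * b powr m)"
          using elim(1,2) by (simp_all only: b_def K1_def K2_def)
        have "strategy_delay R \<le> best_delay R + ennreal (\<rho>/4 * b powr m) + ennreal (\<rho> / 2 * b powr m) + ennreal (\<rho>/4 * b powr m)"
          using up inc lo by (meson add_right_mono order_trans)
        also have "\<dots> = best_delay R + ennreal (\<rho>/4 * b powr m + \<rho> / 2 * b powr m + \<rho>/4 * b powr m)"
          using \<rho> by (simp add: add.assoc ennreal_plus[symmetric] del: ennreal_plus)
        also have "\<rho>/4 * b powr m + \<rho> / 2 * b powr m + \<rho>/4 * b powr m = \<rho> * b powr m" by simp
        finally have 1: "strategy_delay R \<le> best_delay R + ennreal (\<rho> * b powr m)" .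
        have half: "1 / (2 * \<gamma>) * b \<le> real K1" using K1(1) quarter by simp
        have "real n0 \<le> 1 / (2 * \<gamma>) * b" using b(2) \<gamma>_pos by (simp add: field_simps)
        then have "n0 \<le> K1" using half by linarith
        have "(1 / (2 * \<gamma>)) powr m * b powr m \<le> real K1 powr m"
          unfolding powr_mult[symmetric] using half m b0 \<gamma>_pos by (intro powr_mono2) auto
        then have "\<kappa>' * b powr m \<le> \<kappa> * real K1 powr m"
          using \<kappa> by (simp add: \<kappa>'_def mult.assoc)
        then have "ennreal (\<kappa>' * b powr m) \<le> moment K1"
          using mom[OF \<open>n0 \<le> K1\<close>] by (meson ennreal_leI order_trans)
        also have "\<dots> \<le> best_delay R + ennreal (\<rho> * b powr m)"
          using \<rho> by (intro order_trans[OF lo] add_left_mono ennreal_leI mult_right_mono) auto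
        finally show ?case using 1 by (simp add: b_def)
      qed
    qed (auto intro: always_eventually)
  next
    fix tail :: "nat \<Rightarrow> real"
    assume tail: "tail \<longlonglongrightarrow> 0" "\<And>K. 0 \<le> tail K" and total0: "\<And>K. (\<integral>\<^sup>+\<omega>. epowr (stopped_cost H c \<infinity> \<omega>) m \<partial>cond_law H i)
      \<le> (\<integral>\<^sup>+\<omega>. ennreal (cost H c K \<omega> powr m) \<partial>cond_law H i) + ennreal (tail K)"
    have total: "strategy_delay R \<le> moment K + ennreal (tail K)" for R K
      unfolding moment_def by (rule order_trans[OF strategy_le_total total0])
    show ?thesis
    proof (cases "\<forall>K. moment K = 0")
      case True
      \<comment> \<open>If all moments vanish, so do both delays, and the ratio \<open>0 / 0\<close>
        counts as 1.\<close>
      have "strategy_delay R = 0" for R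
      proof -
        have "(\<lambda>K. ennreal (tail K)) \<longlonglongrightarrow> ennreal 0" by (intro tendsto_ennrealI tail)
        then have "strategy_delay R \<le> ennreal 0"
          by (rule LIMSEQ_le_const) (use total[of R] True in auto)
        then show ?thesis by simp
      qed
      then show ?thesis using fin ge by (intro ennreal_asymp_equivI) auto
    next
      case False
      then obtain K0 where K0: "moment K0 \<noteq> 0" by auto
      obtain v where v: "moment K0 = ennreal v" "0 \<le> v"
        using moment_finite[of K0] by (cases "moment K0") auto
      then have v0: "0 < v" using K0 by (cases "v = 0") auto
      show ?thesis
      proof (rule ennreal_asymp_equiv_additive_error[OF v0 _ fin ge, of "\<lambda>_. 1"])
        fix \<rho> :: real assume \<rho>: "0 < \<rho>"
        have "\<forall>\<^sub>F K in sequentially. tail K < \<rho>/2 \<and> K0 \<le> K"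
          using order_tendstoD(2)[OF tail(1), of "\<rho>/2"] \<rho> eventually_ge_at_top[of K0]
          by (auto intro: eventually_conj)
        then obtain K where K: "tail K < \<rho>/2" "K0 \<le> K" by (auto simp: eventually_sequentially)
        \<comment> \<open>The summand 1 keeps the denominator positive for
          \<open>K = 0\<close>.\<close>
        define \<rho>' where "\<rho>' = \<rho> / (2 * ((C * real K) powr m + 1))"
        have pos: "0 < (C * real K) powr m + 1" by (simp add: add_nonneg_pos)
        then have \<rho>': "0 < \<rho>'" using \<rho> by (simp add: \<rho>'_def)
        have "(C * real K) powr m * \<rho>' \<le> ((C * real K) powr m + 1) * \<rho>'"
          using \<rho>' by (intro mult_right_mono) auto
        also have "((C * real K) powr m + 1) * \<rho>' = \<rho>/2"
        proof -
          have "p * (\<rho> / (2 * p)) = \<rho>/2" if "0 < p" for p :: real using that by simp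
          from this[OF pos] show ?thesis unfolding \<rho>'_def .
        qed
        finally have small: "(C * real K) powr m * \<rho>' \<le> \<rho>/2" .
        show "\<forall>\<^sub>F R in bounds_to_0 H \<beta>. strategy_delay R \<le> best_delay R + ennreal (\<rho> * 1)
            \<and> ennreal (v * 1) \<le> best_delay R + ennreal (\<rho> * 1)"
          using early_stopping_rare[of "1/2" \<rho>', OF _ _ \<rho>', simplified] log_thr_at_top[of "2 * \<gamma> * real K"]
        proof eventually_elim
          case (elim R)
          \<comment> \<open>With \<open>\<epsilon> = 1/2\<close>, stopping before
            \<open>b / (2 * \<gamma>)\<close> is rare, and this time eventually exceeds the fixed
            \<open>K\<close>.\<close>
          have "real K \<le> (1/2) * log_thr R / \<gamma>" using elim(2) \<gamma>_pos by (simp add: field_simps)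
          then have "int K \<le> \<lfloor>log_thr R / (2 * \<gamma>)\<rfloor>" by (simp add: le_floor_iff)
          then have KK: "K \<le> nat \<lfloor>log_thr R / (2 * \<gamma>)\<rfloor>" by simp
          have "\<forall>s\<in>admissible H R. emeasure (cond_law H i) {\<omega> \<in> space (Prob H). fst s \<omega> \<le> enat K} \<le> ennreal \<rho>'"
          proof
            fix s assume s: "s \<in> admissible H R"
            have "{\<omega> \<in> space (Prob H). fst s \<omega> \<le> enat n} \<in> events" for n
              by (rule strategy_stops_by_event) (use s in \<open>simp add: admissible_def\<close>)
            then have "emeasure (cond_law H i) {\<omega> \<in> space (Prob H). fst s \<omega> \<le> enat K}
                \<le> emeasure (cond_law H i) {\<omega> \<in> space (Prob H). fst s \<omega> \<le> enat (nat \<lfloor>log_thr R / (2 * \<gamma>)\<rfloor>)}"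
              using KK by (intro emeasure_mono) (auto elim: order_trans)
            then show "emeasure (cond_law H i) {\<omega> \<in> space (Prob H). fst s \<omega> \<le> enat K} \<le> ennreal \<rho>'"
              using elim(1) s by (meson order_trans)
          qed
          from moment_le_best[OF this] \<rho>' have "moment K \<le> best_delay R + ennreal ((C * real K) powr m * \<rho>')" by simp
          also have "\<dots> \<le> best_delay R + ennreal (\<rho>/2)" by (intro add_left_mono ennreal_leI small)
          finally have lo: "moment K \<le> best_delay R + ennreal (\<rho>/2)" .
          have "strategy_delay R \<le> best_delay R + ennreal (\<rho>/2) + ennreal (\<rho>/2)"
            using total[of R K] lo K(1) by (meson add_mono ennreal_leI less_imp_le order_trans)
          also have "\<dots> = best_delay R + ennreal \<rho>"
            using \<rho> by (simp add: add.assoc ennreal_plus[symmetric] del: ennreal_plus)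
          finally have 1: "strategy_delay R \<le> best_delay R + ennreal \<rho>" .
          have "ennreal v \<le> moment K" using moment_mono[OF K(2)] v by simp
          also have "\<dots> \<le> best_delay R + ennreal \<rho>"
            using \<rho> by (intro order_trans[OF lo] add_left_mono ennreal_leI) auto
          finally show ?case using 1 by simp
        qed
      qed auto
    qed
  qed
qed

end

end

theorem proposition3p8:
  fixes H :: "('w, 'y::finite, 'e) hmm"
    and l :: "nat \<Rightarrow> nat \<Rightarrow> ereal" and js :: "nat \<Rightarrow> nat"
    and m :: real and c :: "'y \<Rightarrow> real" and \<beta> :: "nat \<Rightarrow> real"
    and d :: "(nat \<Rightarrow> nat \<Rightarrow> real) \<Rightarrow> 'w \<Rightarrow> nat"
  assumes "hidden_markov H"
    and "nondegenerate_likelihoods H"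
    and "llr_rates H l"
    and "occupation_limits H"
    and "\<forall>i\<in>hyps H. js i \<in> others H i \<and> l i (js i) = lmin H l i"
    and "m \<ge> 1" and "\<forall>y. c y \<ge> 0"
    and "\<forall>i\<in>hyps H. \<beta> i > 0"
    and "cond_UI H js \<beta> m \<or> cond_RQ H l m"
    and "\<forall>B. \<forall>\<omega>\<in>space (Prob H).
           is_arg_min (\<lambda>i. upsilon1 H i (B i) \<omega>) (\<lambda>i. i \<in> hyps H) (d B \<omega>)"
  shows "asymptotically_optimal H c m \<beta>
           (\<lambda>R. (upsilon H (thresholds H R), d (thresholds H R)))"
  unfolding asymptotically_optimal_def
proof
  fix i assume i: "i \<in> hyps H"
  have j: "js i \<in> others H i" "l i (js i) = lmin H l i" using assms(5) i by auto
  have "0 < l i (js i)" using assms(3) i j(1) by (auto simp: llr_rates_def)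
  moreover have "lmin H l i < \<infinity>" using assms(3) i by (auto simp: llr_rates_def)
  ultimately obtain \<gamma> where \<gamma>: "lmin H l i = ereal \<gamma>" using j(2) by (cases "lmin H l i") auto
  interpret hidden_markov H by fact
  interpret llr_model H l \<beta> i "js i" \<gamma>
    by unfold_locales (use assms i j \<gamma> in auto)
  \<comment> \<open>The summand 1 makes \<open>C\<close> positive even if \<open>c\<close> vanishes
    identically.\<close>
  define C where "C = 1 + Max (range c)"
  have c: "0 \<le> c y" for y using assms(7) by simp
  have le_Max: "c y \<le> Max (range c)" for y by (rule Max_ge) auto
  have cC: "c y \<le> C" for y unfolding C_def using le_Max[of y] by linarith
  have C: "0 < C" unfolding C_def using le_Max[of undefined] c[of undefined] by linarith
  have "ennreal_asymp_equiv (bounds_to_0 H \<beta>) (strategy_delay c m) (best_delay c m)"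
    by (rule asymp_optimal[OF c cC C assms(6) refl assms(9)])
  then show "ennreal_asymp_equiv (bounds_to_0 H \<beta>)
      (\<lambda>R. delay H c m i (fst (upsilon H (thresholds H R), d (thresholds H R))))
      (\<lambda>R. INF (\<tau>, d)\<in>admissible H R. delay H c m i \<tau>)"
    by (simp add: strategy_delay_def[OF c cC C assms(6), abs_def] best_delay_def[OF c cC C assms(6), abs_def] case_prod_beta)
qed
end
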